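(* Let $K$ be a field, $A = K[X_1,\ldots,X_n]$, and let $I \subsetneq A$ be a universal squarefree lexsegment ideal (USLI) generated in degrees $d_1<d_2<\cdots<d_t$. Then: (1) the projective dimension of $I$ is $\mathrm{proj}_A(I)=|G(I)|-1$ and the Castelnuovo-Mumford regularity of $I$ is $\mathrm{reg}_A(I)=d_t$; (2) $\mathrm{depth}_A(A/I)=n-|G(I)|$.
   Context: $A=K[X_1,\dots,X_n]$ is standard graded. For a monomial ideal $I$, $G(I)$ is its unique minimal set of monomial generators; $I$ is generated in degrees $d_1<\cdots<d_t$ ($t\ge1$) if $\{d_1,\dots,d_t\}$ is exactly the set of degrees of the elements of $G(I)$. For squarefree monomials of the same degree $u=X_{i_1}\cdots X_{i_d}$, $v=X_{j_1}\cdots X_{j_d}$ with $i_1<\cdots<i_d$ and $j_1<\cdots<j_d$, write $u>_{\mathrm{slex}}v$ if for some $1\le s\le d$ one has $i_1=j_1,\ldots,i_{s-1}=j_{s-1}$ and $i_s<j_s$. A monomial ideal $I\subsetneq A$ is a squarefree lexsegment ideal if it is generated by squarefree monomials and for all squarefree monomials $u\in I$ and all squarefree monomials $v\in A$ with $\deg u=\deg v$ and $v>_{\mathrm{slex}}u$ one has $v\in I$. For $m\ge1$ put $A_{[m]}=K[X_1,\ldots,X_n,X_{n+1},\ldots,X_{n+m}]$. A squarefree lexsegment ideal $I$ of $A$ is a universal squarefree lexsegment ideal (USLI) if for every integer $m\ge 1$ the ideal $IA_{[m]}$ is a squarefree lexsegment ideal of $A_{[m]}$. With $\beta_{i,j}(I)=\dim_K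 \mathrm{Tor}_i^A(K,I)_j$, one has $\mathrm{proj}_A(I)=\max\{i:\beta_{i,j}(I)\ne0 \text{ for some } j\}$ and $\mathrm{reg}_A(I)=\max\{j-i:\beta_{i,j}(I)\neq0\}$. *)

theory Defs
  imports
    "HOL-Library.Function_Algebras"
    "HOL-Library.Poly_Mapping"
    "HOL-Library.Extended_Real"
    "HOL-Algebra.QuotRing"
    "HOL-Algebra.Module"
begin

section \<open>The polynomial rings\<close>

text \<open>Monomials are written as exponent vectors of type \<open>nat \<Rightarrow>\<^sub>0 nat\<close>, and all the rings
  \<open>K[X\<^sub>1, \<dots>, X\<^sub>n]\<close> live inside the polynomial ring over \<open>K\<close> in countably many variables.  The
  inclusion of \<open>A\<close> into \<open>A\<^bsub>[m]\<^esub>\<close> is thus an inclusion of sets.\<close>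

type_synonym exps = "nat \<Rightarrow>\<^sub>0 nat"
type_synonym 'k mpoly = "exps \<Rightarrow>\<^sub>0 'k"

definition monoms :: "nat \<Rightarrow> exps set"
  where "monoms n = {u. Poly_Mapping.keys u \<subseteq> {1..n}}"

definition mdeg :: "exps \<Rightarrow> nat"
  where "mdeg u = (\<Sum>i\<in>Poly_Mapping.keys u. Poly_Mapping.lookup u i)"

definition mono_poly :: "exps \<Rightarrow> 'k::field mpoly"
  where "mono_poly u = Poly_Mapping.single u 1"

definition polys :: "nat \<Rightarrow> 'k::field mpoly set"
  where "polys n = {p. Poly_Mapping.keys p \<subseteq> monoms n}"

definition poly_ring :: "nat \<Rightarrow> 'k::field mpoly ring"
  where "poly_ring n = \<lparr>carrier = polys n, monoid.mult = (*), one = 1, zero = 0, add = (+)\<rparr>"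

definition irrelevant_ideal :: "nat \<Rightarrow> 'k::field mpoly set"
  where "irrelevant_ideal n =
    Idl\<^bsub>poly_ring n\<^esub> ((\<lambda>i. mono_poly (Poly_Mapping.single i 1)) ` {1..n})"

lemma poly_ring_simps [simp]:
  "carrier (poly_ring n) = polys n" "monoid.mult (poly_ring n) = (*)"
  "one (poly_ring n) = 1" "zero (poly_ring n) = 0" "add (poly_ring n) = (+)"
  by (simp_all add: poly_ring_def)

lemma polys_0 [simp]: "0 \<in> polys n"
  by (simp add: polys_def)

lemma polys_1 [simp]: "1 \<in> polys n"
  by (simp add: polys_def monoms_def)

lemma polys_add: "p \<in> polys n \<Longrightarrow> q \<in> polys n \<Longrightarrow> p + q \<in> polys n"
  using keys_add[of p q] by (auto simp: polys_def)

lemma polys_uminus: "p \<in> polys n \<Longrightarrow> - p \<in> polys n"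
  by (auto simp: polys_def in_keys_iff lookup_uminus subset_iff)

lemma monoms_add: "u \<in> monoms n \<Longrightarrow> v \<in> monoms n \<Longrightarrow> u + v \<in> monoms n"
  using keys_add[of u v] by (auto simp: monoms_def)

lemma polys_mult: "p \<in> polys n \<Longrightarrow> q \<in> polys n \<Longrightarrow> p * q \<in> polys n"
  using keys_mult[of p q] monoms_add[of _ n] unfolding polys_def by blast

lemma cring_poly_ring: "cring (poly_ring n :: 'k::field mpoly ring)"
proof (rule cringI)
  show "abelian_group (poly_ring n :: 'k mpoly ring)"
  proof (rule abelian_groupI)
    fix x :: "'k mpoly" assume "x \<in> carrier (poly_ring n)"
    then show "\<exists>y\<in>carrier (poly_ring n). y \<oplus>\<^bsub>poly_ring n\<^esub> x = \<zero>\<^bsub>poly_ring n\<^esub>"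
      using polys_uminus by (intro bexI[of _ "- x"]) auto
  qed (auto simp: polys_add ac_simps)
  show "Group.comm_monoid (poly_ring n :: 'k mpoly ring)"
    by (rule comm_monoidI) (auto simp: polys_mult ac_simps)
qed (auto simp: algebra_simps)


section \<open>Monomial ideals\<close>

text \<open>\<open>min_gens n I\<close> is \<open>G(I)\<close>; the description is proper for monomial ideals only.\<close>

definition min_gens :: "nat \<Rightarrow> 'k::field mpoly set \<Rightarrow> exps set"
  where "min_gens n I = (THE G. G \<subseteq> monoms n \<and> Idl\<^bsub>poly_ring n\<^esub> (mono_poly ` G) = I \<and>
    (\<forall>H. H \<subset> G \<longrightarrow> Idl\<^bsub>poly_ring n\<^esub> (mono_poly ` H) \<noteq> I))"

definition sqfree_monoms :: "nat \<Rightarrow> exps set"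
  where "sqfree_monoms n = {u \<in> monoms n. \<forall>i. Poly_Mapping.lookup u i \<le> 1}"

definition slex_greater :: "exps \<Rightarrow> exps \<Rightarrow> bool"
  where "slex_greater u v \<longleftrightarrow>
    (let is = sorted_list_of_set (Poly_Mapping.keys u);
         js = sorted_list_of_set (Poly_Mapping.keys v)
     in length is = length js \<and>
        (\<exists>s < length is. (\<forall>r < s. is ! r = js ! r) \<and> is ! s < js ! s))"

definition sqfree_lexsegment :: "nat \<Rightarrow> 'k::field mpoly set \<Rightarrow> bool"
  where "sqfree_lexsegment n I \<longleftrightarrow>
    ideal I (poly_ring n) \<and> I \<noteq> polys n \<and>
    (\<exists>S \<subseteq> sqfree_monoms n. I = Idl\<^bsub>poly_ring n\<^esub> (mono_poly ` S)) \<and>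
    (\<forall>u \<in> sqfree_monoms n. \<forall>v \<in> sqfree_monoms n.
       mono_poly u \<in> I \<longrightarrow> mdeg u = mdeg v \<longrightarrow> slex_greater v u \<longrightarrow> mono_poly v \<in> I)"

definition usli :: "nat \<Rightarrow> 'k::field mpoly set \<Rightarrow> bool"
  where "usli n I \<longleftrightarrow> sqfree_lexsegment n I \<and>
    (\<forall>m\<ge>1. sqfree_lexsegment (n + m) (Idl\<^bsub>poly_ring (n + m)\<^esub> I))"


section \<open>Graded Betti numbers, projective dimension and regularity\<close>

text \<open>A complex \<open>\<dots> \<rightarrow> F\<^sub>1 \<rightarrow> F\<^sub>0 \<rightarrow> I\<close> with \<open>F\<^sub>i = \<Oplus>\<^sub>k A(-a\<^sub>i\<^sub>k)\<close> a graded free module of finite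
  rank.  Here \<open>rnk F i\<close> is the rank of \<open>F\<^sub>i\<close>, \<open>shft F i k = a\<^sub>i\<^sub>k\<close> is the degree of its \<open>k\<close>-th basis
  element, \<open>augm F k\<close> is the image in \<open>I\<close> of the \<open>k\<close>-th basis element of \<open>F\<^sub>0\<close>, and \<open>difl F i\<close> is
  the matrix (row index first) of the differential from \<open>F\<^bsub>i+1\<^esub>\<close> to \<open>F\<^sub>i\<close>.  Values at indices beyond
  the ranks are irrelevant.\<close>

record (overloaded) ('k::zero) free_complex =
  rnk :: "nat \<Rightarrow> nat"
  shft :: "nat \<Rightarrow> nat \<Rightarrow> int"
  augm :: "nat \<Rightarrow> 'k mpoly"
  difl :: "nat \<Rightarrow> nat \<Rightarrow> nat \<Rightarrow> 'k mpoly"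

definition homogeneous :: "int \<Rightarrow> 'k::field mpoly \<Rightarrow> bool"
  where "homogeneous d p \<longleftrightarrow> (\<forall>u\<in>Poly_Mapping.keys p. int (mdeg u) = d)"

definition free_mod :: "nat \<Rightarrow> nat \<Rightarrow> (nat \<Rightarrow> 'k::field mpoly) set"
  where "free_mod n r = {x. (\<forall>k<r. x k \<in> polys n) \<and> (\<forall>k\<ge>r. x k = 0)}"

definition mat_app :: "nat \<Rightarrow> nat \<Rightarrow> (nat \<Rightarrow> nat \<Rightarrow> 'r::comm_semiring_1) \<Rightarrow> (nat \<Rightarrow> 'r) \<Rightarrow> nat \<Rightarrow> 'r"
  where "mat_app r s D x = (\<lambda>k. if k < r then \<Sum>l<s. D k l * x l else 0)"

definition difl_map :: "'k::field free_complex \<Rightarrow> nat \<Rightarrow> (nat \<Rightarrow> 'k mpoly) \<Rightarrow> nat \<Rightarrow> 'k mpoly"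
  where "difl_map F i = mat_app (rnk F i) (rnk F (Suc i)) (difl F i)"

definition augm_map :: "'k::field free_complex \<Rightarrow> (nat \<Rightarrow> 'k mpoly) \<Rightarrow> 'k mpoly"
  where "augm_map F x = (\<Sum>k<rnk F 0. augm F k * x k)"

definition graded_free_resolution :: "nat \<Rightarrow> 'k::field mpoly set \<Rightarrow> 'k free_complex \<Rightarrow> bool"
  where "graded_free_resolution n I F \<longleftrightarrow>
    (\<forall>k < rnk F 0. augm F k \<in> I \<and> homogeneous (shft F 0 k) (augm F k)) \<and>
    (\<forall>i. \<forall>k < rnk F i. \<forall>l < rnk F (Suc i).
       difl F i k l \<in> polys n \<and> homogeneous (shft F (Suc i) l - shft F i k) (difl F i k l)) \<and>
    augm_map F ` free_mod n (rnk F 0) = I \<and>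
    {x \<in> free_mod n (rnk F 0). augm_map F x = 0} = difl_map F 0 ` free_mod n (rnk F 1) \<and>
    (\<forall>i. {x \<in> free_mod n (rnk F (Suc i)). difl_map F i x = (\<lambda>_. 0)} =
         difl_map F (Suc i) ` free_mod n (rnk F (Suc (Suc i))))"

text \<open>The complex \<open>K \<otimes>\<^sub>A F\<close>, where \<open>K = A / (X\<^sub>1, \<dots>, X\<^sub>n)\<close>: since \<open>K \<otimes>\<^sub>A A(-a) = K(-a)\<close>, its
  \<open>i\<close>-th module is \<open>\<Oplus>\<^sub>k K(-a\<^sub>i\<^sub>k)\<close>, and the matrices of its differentials arise from those of \<open>F\<close> by
  the residue map \<open>A \<rightarrow> K\<close>, which takes constant terms.  \<open>K\<close>-vectors are functions on \<open>nat\<close>.\<close>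

definition tensor_comp :: "'k::field free_complex \<Rightarrow> nat \<Rightarrow> int \<Rightarrow> (nat \<Rightarrow> 'k) set"
  where "tensor_comp F i j = {c. \<forall>k. c k \<noteq> 0 \<longrightarrow> k < rnk F i \<and> shft F i k = j}"

definition tensor_difl :: "'k::field free_complex \<Rightarrow> nat \<Rightarrow> (nat \<Rightarrow> 'k) \<Rightarrow> nat \<Rightarrow> 'k"
  where "tensor_difl F i = mat_app (rnk F i) (rnk F (Suc i))
    (\<lambda>k l. Poly_Mapping.lookup (difl F i k l) 0)"

definition tor_cycles :: "'k::field free_complex \<Rightarrow> nat \<Rightarrow> int \<Rightarrow> (nat \<Rightarrow> 'k) set"
  where "tor_cycles F i j = (case i of 0 \<Rightarrow> tensor_comp F 0 j
    | Suc i' \<Rightarrow> {c \<in> tensor_comp F i j. tensor_difl F i' c = (\<lambda>_. 0)})"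

definition tor_boundaries :: "'k::field free_complex \<Rightarrow> nat \<Rightarrow> int \<Rightarrow> (nat \<Rightarrow> 'k) set"
  where "tor_boundaries F i j = tensor_difl F i ` tensor_comp F (Suc i) j"

lemma vector_space_fun: "vector_space (\<lambda>(a::'k::field) (c::nat \<Rightarrow> 'k) k. a * c k)"
  by unfold_locales (auto simp: fun_eq_iff algebra_simps)

definition fun_dim :: "(nat \<Rightarrow> 'k::field) set \<Rightarrow> nat"
  where "fun_dim V = vector_space.dim (\<lambda>(a::'k) c k. a * c k) V"

text \<open>\<open>betti n I i j\<close> is the dimension of the homology of \<open>K \<otimes>\<^sub>A F\<close> in homological degree \<open>i\<close> and
  internal degree \<open>j\<close>, for a graded free resolution \<open>F\<close> of the homogeneous ideal \<open>I\<close>; as usual, Tor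
  does not depend on the resolution.  All spaces involved are finite-dimensional and the boundaries
  lie in the cycles, so the difference is that of the dimensions.\<close>

definition betti :: "nat \<Rightarrow> 'k::field mpoly set \<Rightarrow> nat \<Rightarrow> int \<Rightarrow> nat"
  where "betti n I i j = (let F = (SOME F. graded_free_resolution n I F)
    in fun_dim (tor_cycles F i j) - fun_dim (tor_boundaries F i j))"

text \<open>The maxima are taken as suprema of extended reals, so that no value is assigned by accident to
  an unbounded set.\<close>

definition proj_dim :: "nat \<Rightarrow> 'k::field mpoly set \<Rightarrow> ereal"
  where "proj_dim n I = Sup {ereal (real i) | i. \<exists>j. betti n I i j \<noteq> 0}"

definition reg :: "nat \<Rightarrow> 'k::field mpoly set \<Rightarrow> ereal"
  where "reg n I = Sup {ereal (real_of_int (j - int i)) | i j. betti n I i j \<noteq> 0}"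


section \<open>Depth\<close>

text \<open>\<open>seq_mult M [f\<^sub>1, \<dots>, f\<^sub>r]\<close> is the submodule \<open>(f\<^sub>1, \<dots>, f\<^sub>r)M\<close>.  Depth is taken
  with respect to \<open>(X\<^sub>1, \<dots>, X\<^sub>n)\<close>; the regular sequences need not be homogeneous.\<close>

definition seq_mult :: "('a, 'b, 'c) module_scheme \<Rightarrow> 'a list \<Rightarrow> 'b set"
  where "seq_mult M fs =
    {(\<Oplus>\<^bsub>M\<^esub>i\<in>{..<length fs}. (fs ! i) \<odot>\<^bsub>M\<^esub> x i) | x. x \<in> {..<length fs} \<rightarrow> carrier M}"

definition regular_seq :: "('a, 'b, 'c) module_scheme \<Rightarrow> 'a list \<Rightarrow> bool"
  where "regular_seq M fs \<longleftrightarrow>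
    (\<forall>k < length fs. \<forall>x \<in> carrier M.
       (fs ! k) \<odot>\<^bsub>M\<^esub> x \<in> seq_mult M (take k fs) \<longrightarrow> x \<in> seq_mult M (take k fs)) \<and>
    seq_mult M fs \<noteq> carrier M"

definition depth :: "nat \<Rightarrow> ('k::field mpoly, 'b, 'c) module_scheme \<Rightarrow> ereal"
  where "depth n M = Sup {ereal (real (length fs)) | fs.
    set fs \<subseteq> irrelevant_ideal n \<and> regular_seq M fs}"

definition quot_module :: "('a, 'c) ring_scheme \<Rightarrow> 'a set \<Rightarrow> ('a, 'a set) module"
  where "quot_module R I = \<lparr>carrier = carrier (R Quot I), monoid.mult = monoid.mult (R Quot I),
    one = one (R Quot I), zero = zero (R Quot I), add = add (R Quot I),
    smult = (\<lambda>a x. (I +>\<^bsub>R\<^esub> a) \<otimes>\<^bsub>R Quot I\<^esub> x)\<rparr>"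

lemma quot_module_simps [simp]:
  "carrier (quot_module R I) = carrier (R Quot I)" "zero (quot_module R I) = zero (R Quot I)"
  "add (quot_module R I) = add (R Quot I)"
  "smult (quot_module R I) a x = (I +>\<^bsub>R\<^esub> a) \<otimes>\<^bsub>R Quot I\<^esub> x"
  by (simp_all add: quot_module_def)

lemma module_quot_module:
  assumes "cring R" "ideal I R"
  shows "module R (quot_module R I)"
proof -
  interpret R: cring R by fact
  interpret I: ideal I R by fact
  interpret Q: cring "R Quot I" by (rule I.quotient_is_cring) fact
  interpret h: ring_hom_ring R "R Quot I" "(+>\<^bsub>R\<^esub>) I" by (rule I.rcos_ring_hom_ring)
  show ?thesis
  proof (rule moduleI)
    show "abelian_group (quot_module R I)"
    proof (rule abelian_groupI)
      fix x assume "x \<in> carrier (quot_module R I)"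
      then show "\<exists>y\<in>carrier (quot_module R I). y \<oplus>\<^bsub>quot_module R I\<^esub> x = \<zero>\<^bsub>quot_module R I\<^esub>"
        by (intro bexI[of _ "\<ominus>\<^bsub>R Quot I\<^esub> x"]) (auto simp: Q.l_neg)
    qed (auto simp: Q.a_ac)
  qed (auto simp: R.cring_axioms assms Q.l_distr Q.r_distr Q.m_assoc)
qed

end

theory Submission
  imports Defs
begin

text \<open>A universal squarefree lexsegment ideal that does not contain the first variable \<open>x\<close> is
  divisible by \<open>x\<close>: otherwise, after adding enough variables, the lexsegment condition would produce
  an element \<open>x X\<^bsub>n+1\<^esub> \<cdots> X\<^bsub>n+d-1\<^esub>\<close> that lies over no generator.  Hence such an ideal arises from a
  principal ideal \<open>(X\<^sub>b)\<close> by repeatedly replacing \<open>J\<close> with \<open>J + (x)\<close> or \<open>xJ\<close> for a new variable \<open>x\<close>.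
  The second step only shifts degrees in the minimal free resolution, and the first one replaces it
  by the mapping cone of multiplication by \<open>x\<close>; this gives the projective dimension and the
  regularity, because Betti numbers can be read off any minimal resolution by the comparison theorem.

  For the upper bound on the depth, mapping cones along a regular sequence of length \<open>r\<close> yield a
  minimal resolution of length at least \<open>|G(I)| + r\<close>, which cannot exceed \<open>n\<close>.  For the lower bound,
  the differences \<open>X\<^sub>v - X\<^sub>b\<close>, where \<open>v \<noteq> b\<close> runs over the variables that were not added in a
  step \<open>J + (x)\<close>, form a regular sequence: \<open>A/I\<close> has a filtration whose quotients are polynomial rings
  in which these differences are independent linear forms.\<close>


section \<open>Polynomials\<close>

text \<open>\<open>betti\<close> is computed from a resolution picked by Hilbert choice, of which
  nothing is known except that it is a graded free resolution. The two maxima depend only on which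
  Betti numbers vanish, so it suffices to move the vanishing of Tor along chain maps in both
  directions; dimensions in different resolutions are never compared. Regular sequences in
  \<open>depth\<close> may be inhomogeneous. Hence exactness (\<open>resolves\<close>) and
  minimality (entries without constant term) are kept apart from the grading, and the bound
  \<open>n\<close> on the length of a minimal resolution comes from killing the variables one at a
  time, in place of the Auslander-Buchsbaum formula. It is A/J rather than J that is resolved: the
  module in degree 0 is then A itself, so the induction can start at the zero ideal, and one cone
  construction serves both the added variables and the regular sequences. Differences of variables,
  unlike general linear forms, work over every field, finite ones included.\<close>

definition X :: "nat \<Rightarrow> 'k::field mpoly"
  where "X i = mono_poly (Poly_Mapping.single i 1)"

lemma polys_diff: "p \<in> polys n \<Longrightarrow> q \<in> polys n \<Longrightarrow> p - q \<in> polys n"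
  using polys_add[of p n "- q"] polys_uminus[of q n] by simp

lemma polys_sum: "(\<And>i. i \<in> S \<Longrightarrow> f i \<in> polys n) \<Longrightarrow> sum f S \<in> polys n"
  by (induction S rule: infinite_finite_induct) (auto intro: polys_add)

lemma single_in_polys: "u \<in> monoms n \<Longrightarrow> Poly_Mapping.single u c \<in> polys n"
  by (auto simp: polys_def)

lemma X_in_polys: "i \<in> {1..n} \<Longrightarrow> X i \<in> polys n"
  unfolding X_def mono_poly_def by (rule single_in_polys) (auto simp: monoms_def)

lemma polys_mono: "n \<le> m \<Longrightarrow> polys n \<subseteq> polys m"
  by (fastforce simp: polys_def monoms_def subset_iff)

lemma poly_as_sum:
  fixes p :: "'a \<Rightarrow>\<^sub>0 'b::comm_monoid_add"
  shows "p = (\<Sum>u\<in>Poly_Mapping.keys p. Poly_Mapping.single u (Poly_Mapping.lookup p u))"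
  by (rule poly_mapping_eqI)
    (auto simp: lookup_sum lookup_single when_def in_keys_iff sum.delta')

lemma poly_induct [consumes 1, case_names zero add]:
  fixes p :: "'k::field mpoly"
  assumes "Poly_Mapping.keys p \<subseteq> S" "P 0"
    and "\<And>u c q. u \<in> S \<Longrightarrow> c \<noteq> 0 \<Longrightarrow> P q \<Longrightarrow> P (Poly_Mapping.single u c + q)"
  shows "P p"
proof -
  have "P (\<Sum>u\<in>T. Poly_Mapping.single u (Poly_Mapping.lookup p u))"
    if "finite T" "T \<subseteq> Poly_Mapping.keys p" for T
    using that assms by (induction T rule: finite_induct) (auto simp: in_keys_iff subset_iff)
  then show ?thesis
    using poly_as_sum[of p] by (metis finite_keys order_refl)
qed

lemma keys_add_nat: "Poly_Mapping.keys (u + v) = Poly_Mapping.keys u \<union> Poly_Mapping.keys (v :: exps)"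
  by (auto simp: in_keys_iff lookup_add)

text \<open>Exponents are natural numbers, so \<open>u + v = 0\<close> only for
  \<open>u = v = 0\<close>. The constant term is therefore multiplicative: it is the residue map to
  K modulo the variables.\<close>

lemma lookup_mult_0:
  fixes p q :: "'k::field mpoly"
  shows "Poly_Mapping.lookup (p * q) 0 = Poly_Mapping.lookup p 0 * Poly_Mapping.lookup q 0"
proof (induction p rule: poly_induct[OF order_refl])
  case (2 u c p)
  have "Poly_Mapping.lookup (Poly_Mapping.single u c * q) 0
      = Poly_Mapping.lookup (Poly_Mapping.single u c) 0 * Poly_Mapping.lookup q 0"
  proof (induction q rule: poly_induct[OF order_refl])
    case (2 v d q)
    have "u + v = 0 \<longleftrightarrow> u = 0 \<and> v = 0"
      by (metis Un_empty keys_add_nat keys_eq_empty)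
    then show ?case
      using 2 by (auto simp: distrib_left lookup_add mult_single lookup_single when_def)
  qed auto
  then show ?case using 2 by (simp add: distrib_right lookup_add)
qed auto

lemma mdeg_eq: "Poly_Mapping.keys u \<subseteq> S \<Longrightarrow> finite S \<Longrightarrow> mdeg u = (\<Sum>i\<in>S. Poly_Mapping.lookup u i)"
  unfolding mdeg_def by (rule sum.mono_neutral_left) (auto simp: in_keys_iff)

lemma mdeg_add: "mdeg (u + v) = mdeg u + mdeg v"
proof -
  let ?S = "Poly_Mapping.keys u \<union> Poly_Mapping.keys v"
  show ?thesis
    by (subst (1 2 3) mdeg_eq[where S = ?S]) (auto simp: keys_add_nat lookup_add sum.distrib)
qed

lemma mdeg_0 [simp]: "mdeg 0 = 0"
  by (simp add: mdeg_def)

lemma mdeg_single [simp]: "mdeg (Poly_Mapping.single i k) = k"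
  by (simp add: mdeg_def)

lemma X_nonzero [simp]: "X i \<noteq> (0 :: 'k::field mpoly)"
  by (metis X_def keys_eq_empty keys_single insert_not_empty mono_poly_def one_neq_zero)

lemma lookup_X_0 [simp]: "Poly_Mapping.lookup (X i :: 'k::field mpoly) 0 = 0"
  by (auto simp: X_def mono_poly_def lookup_single when_def dest: arg_cong[of _ _ Poly_Mapping.keys])

text \<open>Adding a fixed exponent vector is injective, so no terms cancel.\<close>

lemma keys_X_mult:
  fixes p :: "'k::field mpoly"
  shows "Poly_Mapping.keys (X i * p) = (+) (Poly_Mapping.single i 1) ` Poly_Mapping.keys p"
proof -
  let ?e = "Poly_Mapping.single i (1 :: nat)"
  have "Poly_Mapping.lookup (X i * p) (?e + u) = Poly_Mapping.lookup p u" for u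
  proof (induction p rule: poly_induct[OF order_refl])
    case (2 v c q)
    then show ?case
      by (simp add: distrib_left lookup_add X_def mono_poly_def mult_single lookup_single when_def)
  qed auto
  moreover have "Poly_Mapping.keys (X i * p) \<subseteq> (+) ?e ` Poly_Mapping.keys p"
    using keys_mult[of "X i" p] by (auto simp: X_def mono_poly_def)
  ultimately show ?thesis
    by (auto simp: in_keys_iff)
qed


subsection \<open>Homogeneous components\<close>

definition hpart :: "int \<Rightarrow> 'k::field mpoly \<Rightarrow> 'k mpoly"
  where "hpart d p = (\<Sum>u\<in>{u\<in>Poly_Mapping.keys p. int (mdeg u) = d}.
    Poly_Mapping.single u (Poly_Mapping.lookup p u))"

lemma lookup_hpart:
  "Poly_Mapping.lookup (hpart d p) u = (if int (mdeg u) = d then Poly_Mapping.lookup p u else 0)"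
  unfolding hpart_def lookup_sum lookup_single when_def
  by (auto simp: sum.delta' in_keys_iff)

lemma hpart_0 [simp]: "hpart d 0 = 0"
  by (simp add: hpart_def)

lemma hpart_add: "hpart d (p + q) = hpart d p + hpart d q"
  by (rule poly_mapping_eqI) (simp add: lookup_hpart lookup_add)

lemma hpart_sum: "hpart d (sum f S) = (\<Sum>i\<in>S. hpart d (f i))"
  by (induction S rule: infinite_finite_induct) (auto simp: hpart_add)

lemma hpart_in_polys: "p \<in> polys n \<Longrightarrow> hpart d p \<in> polys n"
  by (auto simp: polys_def in_keys_iff lookup_hpart subset_iff split: if_splits)

lemma homogeneous_hpart: "homogeneous d (hpart d p)"
  by (auto simp: homogeneous_def in_keys_iff lookup_hpart split: if_splits)

lemma hpart_homogeneous: "homogeneous d p \<Longrightarrow> hpart d p = p"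
  by (rule poly_mapping_eqI) (auto simp: lookup_hpart homogeneous_def in_keys_iff)

lemma hpart_single: "hpart d (Poly_Mapping.single u c) =
    (if int (mdeg u) = d then Poly_Mapping.single u c else 0)"
  by (rule poly_mapping_eqI) (auto simp: lookup_hpart lookup_single when_def)

text \<open>This lets an arbitrary solution of a linear system with homogeneous entries be replaced
  by a homogeneous one, in \<open>graded_lift\<close>.\<close>

lemma hpart_mult:
  assumes "homogeneous e q"
  shows "hpart (e + d) (q * p) = q * hpart d p"
proof -
  have "Poly_Mapping.keys q \<subseteq> {u. int (mdeg u) = e}"
    using assms by (auto simp: homogeneous_def)
  then show ?thesis
  proof (induction q rule: poly_induct)
    case (add u c q)
    have "hpart (e + d) (Poly_Mapping.single u c * p) = Poly_Mapping.single u c * hpart d p"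
      using add.hyps(1)
      by (induction p rule: poly_induct[OF order_refl])
        (auto simp: distrib_left hpart_add mult_single hpart_single mdeg_add)
    then show ?case using add.IH by (simp add: distrib_right hpart_add)
  qed auto
qed

lemma homogeneous_0 [simp]: "homogeneous d 0"
  by (simp add: homogeneous_def)

lemma homogeneous_1 [simp]: "homogeneous 0 1"
  by (simp add: homogeneous_def)

lemma homogeneous_add: "homogeneous d p \<Longrightarrow> homogeneous d q \<Longrightarrow> homogeneous d (p + q)"
  using keys_add[of p q] by (auto simp: homogeneous_def)

lemma homogeneous_uminus: "homogeneous d p \<Longrightarrow> homogeneous d (- p)"
  by (auto simp: homogeneous_def in_keys_iff)

lemma homogeneous_diff: "homogeneous d p \<Longrightarrow> homogeneous d q \<Longrightarrow> homogeneous d (p - q)"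
  using homogeneous_add[of d p "- q"] homogeneous_uminus[of d q] by simp

lemma homogeneous_sum: "(\<And>i. i \<in> S \<Longrightarrow> homogeneous d (f i)) \<Longrightarrow> homogeneous d (sum f S)"
  by (induction S rule: infinite_finite_induct) (auto intro: homogeneous_add)

lemma homogeneous_mult: "homogeneous d p \<Longrightarrow> homogeneous e q \<Longrightarrow> homogeneous (d + e) (p * q)"
  using keys_mult[of p q] by (fastforce simp: homogeneous_def mdeg_add)

lemma homogeneous_X: "homogeneous 1 (X i)"
  by (simp add: homogeneous_def X_def mono_poly_def)

lemma lookup_0_homogeneous: "homogeneous d p \<Longrightarrow> Poly_Mapping.lookup p 0 \<noteq> 0 \<Longrightarrow> d = 0"
  unfolding homogeneous_def by (metis in_keys_iff mdeg_0 of_nat_0)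


section \<open>Ideals\<close>

text \<open>An elementwise form of \<open>ideal\<close>, equivalent to it by
  \<open>ideal_iff_idl\<close>. Closure under negation comes from multiplication by
  \<open>- 1\<close>.\<close>

definition idl :: "nat \<Rightarrow> 'k::field mpoly set \<Rightarrow> bool"
  where "idl n J \<longleftrightarrow> J \<subseteq> polys n \<and> 0 \<in> J \<and> (\<forall>p\<in>J. \<forall>q\<in>J. p + q \<in> J) \<and>
    (\<forall>p\<in>J. \<forall>q\<in>polys n. q * p \<in> J)"

lemma idlD:
  assumes "idl n J"
  shows "J \<subseteq> polys n" "0 \<in> J" "p \<in> J \<Longrightarrow> q \<in> J \<Longrightarrow> p + q \<in> J"
    "p \<in> J \<Longrightarrow> q \<in> polys n \<Longrightarrow> q * p \<in> J" "p \<in> J \<Longrightarrow> q \<in> polys n \<Longrightarrow> p * q \<in> J"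
    "p \<in> J \<Longrightarrow> q \<in> J \<Longrightarrow> p - q \<in> J" "p \<in> J \<Longrightarrow> - p \<in> J"
proof -
  have neg: "- q \<in> J" if "q \<in> J" for q
    using assms that polys_uminus[OF polys_1] unfolding idl_def
    by (metis mult_minus_left mult_1)
  show "p \<in> J \<Longrightarrow> - p \<in> J" by (rule neg)
  show "p \<in> J \<Longrightarrow> q \<in> J \<Longrightarrow> p - q \<in> J"
    using assms neg[of q] unfolding idl_def by (metis uminus_add_conv_diff add.commute)
qed (use assms in \<open>auto simp: idl_def mult.commute\<close>)

lemma ideal_iff_idl: "ideal J (poly_ring n) \<longleftrightarrow> idl n J"
proof
  assume "ideal J (poly_ring n)"
  then interpret ideal J "poly_ring n" .
  show "idl n J"
    unfolding idl_def
    using a_subset additive_subgroup.zero_closed[OF additive_subgroup_axioms]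
      additive_subgroup.a_closed[OF additive_subgroup_axioms] I_l_closed
    by auto
next
  assume J: "idl n J"
  interpret R: cring "poly_ring n :: 'a mpoly ring" by (rule cring_poly_ring)
  have m: "\<ominus>\<^bsub>poly_ring n\<^esub> p = - p" if "p \<in> polys n" for p :: "'a mpoly"
    by (rule R.minus_equality) (use that in \<open>auto simp: polys_uminus\<close>)
  show "ideal J (poly_ring n)"
  proof (rule idealI)
    show "subgroup J (add_monoid (poly_ring n))"
    proof (unfold_locales)
      fix x assume "x \<in> J"
      then show "inv\<^bsub>add_monoid (poly_ring n)\<^esub> x \<in> J"
        using m idlD[OF J] unfolding a_inv_def by (metis subsetD)
    qed (use idlD[OF J] in auto)
  qed (use idlD[OF J] R.ring_axioms in \<open>auto\<close>)
qed

definition extend :: "nat \<Rightarrow> 'k::field mpoly set \<Rightarrow> 'k mpoly \<Rightarrow> 'k mpoly set"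
  where "extend n J f = {p + f * q | p q. p \<in> J \<and> q \<in> polys n}"

lemma extendI: "p \<in> J \<Longrightarrow> q \<in> polys n \<Longrightarrow> p + f * q \<in> extend n J f"
  by (auto simp: extend_def)

lemma extend_superset: "J \<subseteq> extend n J f"
  using extendI[of _ J 0 n f] by auto

lemma extend_self: "idl n J \<Longrightarrow> q \<in> polys n \<Longrightarrow> f * q \<in> extend n J f"
  using extendI[of 0 J q n f] idlD(2) by auto

lemma idl_extend: "idl n J \<Longrightarrow> f \<in> polys n \<Longrightarrow> idl n (extend n J f)"
proof -
  assume J: "idl n J" and f: "f \<in> polys n"
  have "p + f * q + (p' + f * q') \<in> extend n J f"
    if "p \<in> J" "q \<in> polys n" "p' \<in> J" "q' \<in> polys n" for p q p' q'
    using extendI[OF idlD(3)[OF J that(1,3)] polys_add[OF that(2,4)], of f]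
    by (simp add: algebra_simps)
  moreover have "c * (p + f * q) \<in> extend n J f"
    if "p \<in> J" "q \<in> polys n" "c \<in> polys n" for p q c
    using extendI[OF idlD(4)[OF J that(1,3)] polys_mult[OF that(3,2)], of f]
    by (simp add: algebra_simps)
  moreover have "0 \<in> extend n J f"
    using extend_superset idlD[OF J] by blast
  moreover have "extend n J f \<subseteq> polys n"
    using f idlD(1)[OF J] by (auto simp: extend_def intro!: polys_add polys_mult)
  ultimately show ?thesis
    unfolding idl_def extend_def by blast
qed

text \<open>Multiplication by \<open>f\<close> is injective on A/J. The quotient may be zero;
  properness is dealt with separately in \<open>regular_seq_iff\<close>.\<close>

definition nonzerodiv :: "nat \<Rightarrow> 'k::field mpoly set \<Rightarrow> 'k mpoly \<Rightarrow> bool"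
  where "nonzerodiv n J f \<longleftrightarrow> (\<forall>p\<in>polys n. f * p \<in> J \<longrightarrow> p \<in> J)"


section \<open>Squarefree monomial ideals\<close>

text \<open>A squarefree monomial divides \<open>u\<close> exactly if its support lies in that of
  \<open>u\<close>. For subsets of \<open>{1..n}\<close> this is thus the ideal generated by the
  squarefree monomials with supports in \<open>G\<close>, see \<open>genideal_sqmon\<close>, and
  membership is a condition on each term separately.\<close>

definition sqid :: "nat \<Rightarrow> nat set set \<Rightarrow> 'k::field mpoly set"
  where "sqid n G = {p \<in> polys n. \<forall>u\<in>Poly_Mapping.keys p. \<exists>g\<in>G. g \<subseteq> Poly_Mapping.keys u}"

lemma idl_sqid: "idl n (sqid n G)"
proof -
  have "p + q \<in> sqid n G" if "p \<in> sqid n G" "q \<in> sqid n G" for p q :: "'a mpoly"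
    using that keys_add[of p q] by (auto simp: sqid_def polys_add)
  moreover have "q * p \<in> sqid n G" if p: "p \<in> sqid n G" and q: "q \<in> polys n" for p q :: "'a mpoly"
    unfolding sqid_def
  proof (intro CollectI conjI ballI)
    show "q * p \<in> polys n" using p q by (intro polys_mult) (auto simp: sqid_def)
    fix u assume "u \<in> Poly_Mapping.keys (q * p)"
    from subsetD[OF keys_mult this] obtain v w where u: "u = v + w" and w: "w \<in> Poly_Mapping.keys p"
      by blast
    obtain g where "g \<in> G" "g \<subseteq> Poly_Mapping.keys w"
      using p w unfolding sqid_def by blast
    then show "\<exists>g\<in>G. g \<subseteq> Poly_Mapping.keys u" unfolding u keys_add_nat by blast
  qed
  moreover have "sqid n G \<subseteq> polys n" "0 \<in> sqid n G" by (auto simp: sqid_def)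
  ultimately show ?thesis
    unfolding idl_def by blast
qed

lemma sqid_empty: "sqid n {} = {0}"
  by (auto simp: sqid_def)

lemma split_keys:
  fixes p :: "'k::field mpoly"
  obtains q r where "p = q + r" "Poly_Mapping.keys q = {u\<in>Poly_Mapping.keys p. P u}"
    "Poly_Mapping.keys r = {u\<in>Poly_Mapping.keys p. \<not> P u}"
proof -
  define part where "part Q = (\<Sum>u\<in>{u\<in>Poly_Mapping.keys p. Q u}.
    Poly_Mapping.single u (Poly_Mapping.lookup p u))" for Q
  have l: "Poly_Mapping.lookup (part Q) u = (if Q u then Poly_Mapping.lookup p u else 0)" for Q u
    unfolding part_def lookup_sum lookup_single when_def
    by (auto simp: sum.delta' in_keys_iff)
  show thesis
  proof (rule that)
    show "p = part P + part (\<lambda>u. \<not> P u)"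
      by (rule poly_mapping_eqI) (simp add: lookup_add l)
    show "Poly_Mapping.keys (part P) = {u\<in>Poly_Mapping.keys p. P u}"
      "Poly_Mapping.keys (part (\<lambda>u. \<not> P u)) = {u\<in>Poly_Mapping.keys p. \<not> P u}"
      by (auto simp: in_keys_iff l split: if_splits)
  qed
qed

lemma divisible_by_X:
  fixes p :: "'k::field mpoly"
  assumes "\<forall>u\<in>Poly_Mapping.keys p. i \<in> Poly_Mapping.keys u"
  obtains q where "p = X i * q"
proof -
  let ?e = "Poly_Mapping.single i (1 :: nat)"
  have "Poly_Mapping.keys p \<subseteq> {u. i \<in> Poly_Mapping.keys u}" using assms by auto
  then have "\<exists>q. p = X i * q"
  proof (induction p rule: poly_induct)
    case zero
    show ?case by (intro exI[of _ 0]) simp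
  next
    case (add u c p)
    then obtain q where q: "p = X i * q" by blast
    have "u = ?e + (u - ?e)"
      using add.hyps
      by (intro poly_mapping_eqI) (auto simp: lookup_add lookup_minus lookup_single when_def in_keys_iff)
    then have "Poly_Mapping.single u c = X i * Poly_Mapping.single (u - ?e) c"
      by (metis X_def mono_poly_def mult_1 mult_single)
    with q have "Poly_Mapping.single u c + p = X i * (Poly_Mapping.single (u - ?e) c + q)"
      by (simp add: distrib_left)
    then show ?case by blast
  qed
  with that show thesis by blast
qed

lemma X_mult_in_polys_iff:
  assumes "i \<in> {1..n}" shows "X i * p \<in> polys n \<longleftrightarrow> p \<in> polys n"
proof -
  have "Poly_Mapping.single i 1 + u \<in> monoms n \<longleftrightarrow> u \<in> monoms n" for u
    using assms by (simp add: monoms_def keys_add_nat)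
  then show ?thesis unfolding polys_def mem_Collect_eq keys_X_mult image_subset_iff by auto
qed

text \<open>The set \<open>f J + B\<close>. With \<open>B\<close> generated by variables it is a
  multiplication step carried out modulo these variables, and with \<open>J = A\<close> it is
  \<open>B + (f)\<close>.\<close>

definition scale_mod :: "'k::field mpoly \<Rightarrow> 'k mpoly set \<Rightarrow> 'k mpoly set \<Rightarrow> 'k mpoly set"
  where "scale_mod f J B = {f * p + q | p q. p \<in> J \<and> q \<in> B}"

text \<open>As \<open>i\<close> occurs in no member of \<open>G\<close>, cancelling
  \<open>X i\<close> from a term over \<open>insert i g\<close> leaves a term over \<open>g\<close>.
  Terms over a member of \<open>B\<close> are split off beforehand, so \<open>i\<close> may occur in
  \<open>B\<close>.\<close>

lemma scale_mod_sqid: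
  assumes "i \<in> {1..n}" "i \<notin> \<Union> G"
  shows "scale_mod (X i) (sqid n (G \<union> B)) (sqid n B)
    = (sqid n (insert i ` G \<union> B) :: 'k::field mpoly set)"
proof (intro equalityI subsetI)
  fix f :: "'k mpoly" assume "f \<in> scale_mod (X i) (sqid n (G \<union> B)) (sqid n B)"
  then obtain p q where f: "f = X i * p + q" and p: "p \<in> sqid n (G \<union> B)" and q: "q \<in> sqid n B"
    by (auto simp: scale_mod_def)
  have "X i * p \<in> sqid n (insert i ` G \<union> B)"
    unfolding sqid_def
  proof (intro CollectI conjI ballI)
    show "X i * p \<in> polys n" using p assms by (simp add: X_mult_in_polys_iff sqid_def)
    fix u assume "u \<in> Poly_Mapping.keys (X i * p)"
    then obtain v where u: "u = Poly_Mapping.single i 1 + v" and v: "v \<in> Poly_Mapping.keys p"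
      unfolding keys_X_mult by blast
    have k: "Poly_Mapping.keys u = insert i (Poly_Mapping.keys v)"
      unfolding u keys_add_nat by simp
    have "\<exists>g\<in>G \<union> B. g \<subseteq> Poly_Mapping.keys v"
      using p v by (simp add: sqid_def)
    then show "\<exists>g\<in>insert i ` G \<union> B. g \<subseteq> Poly_Mapping.keys u"
      unfolding k by (metis UnE UnI1 UnI2 image_eqI insert_mono subset_insertI2)
  qed
  moreover have "q \<in> sqid n (insert i ` G \<union> B)" using q unfolding sqid_def by blast
  ultimately show "f \<in> sqid n (insert i ` G \<union> B)"
    unfolding f by (rule idlD(3)[OF idl_sqid])
next
  fix f :: "'k mpoly" assume f: "f \<in> sqid n (insert i ` G \<union> B)"
  obtain q r where qr: "f = q + r"
    "Poly_Mapping.keys q = {u\<in>Poly_Mapping.keys f. \<exists>g\<in>B. g \<subseteq> Poly_Mapping.keys u}"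
    "Poly_Mapping.keys r = {u\<in>Poly_Mapping.keys f. \<not> (\<exists>g\<in>B. g \<subseteq> Poly_Mapping.keys u)}"
    by (rule split_keys)
  have r: "\<exists>g\<in>G. insert i g \<subseteq> Poly_Mapping.keys u" if "u \<in> Poly_Mapping.keys r" for u
    using that f unfolding qr sqid_def by blast
  then have "\<forall>u\<in>Poly_Mapping.keys r. i \<in> Poly_Mapping.keys u" by blast
  then obtain p where p: "r = X i * p" by (rule divisible_by_X)
  have fn: "f \<in> polys n" using f by (auto simp: sqid_def)
  then have "r \<in> polys n" "q \<in> polys n" using qr by (auto simp: polys_def)
  have "p \<in> sqid n (G \<union> B)"
    unfolding sqid_def
  proof (intro CollectI conjI ballI)
    show "p \<in> polys n" using \<open>r \<in> polys n\<close> assms by (simp add: p X_mult_in_polys_iff)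
    fix v assume "v \<in> Poly_Mapping.keys p"
    then have "Poly_Mapping.single i 1 + v \<in> Poly_Mapping.keys r" by (simp add: p keys_X_mult)
    from r[OF this] obtain g where "g \<in> G" "g \<subseteq> insert i (Poly_Mapping.keys v)"
      unfolding keys_add_nat by auto
    then show "\<exists>g\<in>G \<union> B. g \<subseteq> Poly_Mapping.keys v" using assms(2) by blast
  qed
  moreover have "q \<in> sqid n B" using \<open>q \<in> polys n\<close> qr(2) by (simp add: sqid_def)
  moreover have "f = X i * p + q" using qr(1) p by (simp add: add.commute)
  ultimately show "f \<in> scale_mod (X i) (sqid n (G \<union> B)) (sqid n B)"
    unfolding scale_mod_def mem_Collect_eq by (intro exI conjI)
qed

lemma extend_sqid:
  assumes "i \<in> {1..n}"
  shows "extend n (sqid n G) (X i) = (sqid n (insert {i} G) :: 'k::field mpoly set)"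
proof -
  \<comment> \<open>The empty support stands for the monomial 1, so adding \<open>X i\<close> to an
    ideal is the case \<open>G = {{}}\<close> of \<open>scale_mod_sqid\<close>.\<close>
  have "sqid n ({{}} \<union> G) = (polys n :: 'k mpoly set)" by (auto simp: sqid_def)
  then have "scale_mod (X i) (polys n) (sqid n G) = (sqid n (insert {i} G) :: 'k mpoly set)"
    using scale_mod_sqid[OF assms, of "{{}}" G, where 'k = 'k] by simp
  moreover have "extend n J f = scale_mod f (polys n) J" for J and f :: "'k mpoly"
  proof (intro equalityI subsetI)
    fix x assume "x \<in> extend n J f"
    then obtain p q where "x = p + f * q" "p \<in> J" "q \<in> polys n" unfolding extend_def by auto
    then have "x = f * q + p" "q \<in> polys n" "p \<in> J" by (simp_all add: add.commute)
    then show "x \<in> scale_mod f (polys n) J" unfolding scale_mod_def mem_Collect_eq by (intro exI conjI)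
  next
    fix x assume "x \<in> scale_mod f (polys n) J"
    then obtain p q where "x = f * q + p" "p \<in> J" "q \<in> polys n" unfolding scale_mod_def by auto
    then have "x = p + f * q" "p \<in> J" "q \<in> polys n" by (simp_all add: add.commute)
    then show "x \<in> extend n J f" unfolding extend_def mem_Collect_eq by (intro exI conjI)
  qed
  ultimately show ?thesis by simp
qed

lemma nonzerodiv_sqid:
  assumes "i \<notin> \<Union> G" shows "nonzerodiv n (sqid n G) (X i)"
  unfolding nonzerodiv_def
proof (intro ballI impI)
  fix p :: "'a mpoly" assume p: "p \<in> polys n" "X i * p \<in> sqid n G"
  have "\<forall>v\<in>Poly_Mapping.keys p. \<exists>g\<in>G. g \<subseteq> Poly_Mapping.keys v"
  proof
    fix v assume "v \<in> Poly_Mapping.keys p"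
    then have "Poly_Mapping.single i 1 + v \<in> Poly_Mapping.keys (X i * p)"
      by (simp add: keys_X_mult)
    then have "\<exists>g\<in>G. g \<subseteq> Poly_Mapping.keys (Poly_Mapping.single i 1 + v)"
      using p(2) unfolding sqid_def by blast
    then obtain g where "g \<in> G" "g \<subseteq> insert i (Poly_Mapping.keys v)"
      unfolding keys_add_nat by auto
    with assms show "\<exists>g\<in>G. g \<subseteq> Poly_Mapping.keys v" by blast
  qed
  then show "p \<in> sqid n G" unfolding sqid_def using p(1) by (intro CollectI conjI)
qed


section \<open>Free modules and matrices\<close>

lemma mat_app_add: "mat_app r s D (x + y) = mat_app r s D x + mat_app r s D y"
  by (auto simp: mat_app_def fun_eq_iff distrib_left sum.distrib)

lemma mat_app_diff:
  fixes D :: "nat \<Rightarrow> nat \<Rightarrow> 'r::comm_ring_1"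
  shows "mat_app r s D (x - y) = mat_app r s D x - mat_app r s D y"
  by (auto simp: mat_app_def fun_eq_iff right_diff_distrib sum_subtractf)

lemma mat_app_uminus:
  fixes D :: "nat \<Rightarrow> nat \<Rightarrow> 'r::comm_ring_1"
  shows "mat_app r s D (- x) = - mat_app r s D x"
  by (auto simp: mat_app_def fun_eq_iff sum_negf)

lemma mat_app_smult: "mat_app r s D (\<lambda>k. f * x k) = (\<lambda>k. f * mat_app r s D x k)"
  by (auto simp: mat_app_def fun_eq_iff sum_distrib_left mult_ac)

lemma mat_app_zero [simp]: "mat_app r s D 0 = 0" "mat_app r s D (\<lambda>_. 0) = 0" "mat_app r s (\<lambda>_ _. 0) x = 0"
  by (auto simp: mat_app_def fun_eq_iff)

lemma mat_app_matrix_diff: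
  fixes D :: "nat \<Rightarrow> nat \<Rightarrow> 'r::comm_ring_1"
  shows "mat_app r s (\<lambda>k l. D k l - E k l) x = mat_app r s D x - mat_app r s E x"
  by (auto simp: mat_app_def fun_eq_iff left_diff_distrib sum_subtractf)

lemma mat_app_matrix_uminus:
  fixes D :: "nat \<Rightarrow> nat \<Rightarrow> 'r::comm_ring_1"
  shows "mat_app r s (\<lambda>k l. - D k l) x = - mat_app r s D x"
  by (auto simp: mat_app_def fun_eq_iff sum_negf)

lemma mat_app_cong:
  assumes "\<And>k l. k < r \<Longrightarrow> l < s \<Longrightarrow> D k l = E k l" "\<And>l. l < s \<Longrightarrow> x l = y l"
  shows "mat_app r s D x = mat_app r s E y"
  using assms by (auto simp: mat_app_def fun_eq_iff intro!: sum.cong)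

lemma mat_app_0_rows [simp]: "mat_app 0 s D x = 0"
  by (auto simp: mat_app_def fun_eq_iff)

lemma mat_app_unit:
  assumes "l < s"
  shows "mat_app r s D (\<lambda>j. if j = l then 1 else 0) = (\<lambda>k. if k < r then D k l else 0)"
  using assms by (auto simp: mat_app_def fun_eq_iff if_distrib[of "\<lambda>x. _ * x"] sum.delta' cong: if_cong)

definition mat_mult :: "nat \<Rightarrow> (nat \<Rightarrow> nat \<Rightarrow> 'r::comm_semiring_1) \<Rightarrow> (nat \<Rightarrow> nat \<Rightarrow> 'r) \<Rightarrow> nat \<Rightarrow> nat \<Rightarrow> 'r"
  where "mat_mult t M N = (\<lambda>k l. \<Sum>j<t. M k j * N j l)"

lemma mat_app_mat_mult: "mat_app r s (mat_mult t M N) x = mat_app r t M (mat_app t s N x)"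
proof -
  have "(\<Sum>l<s. (\<Sum>j<t. M k j * N j l) * x l) = (\<Sum>j<t. M k j * (\<Sum>l<s. N j l * x l))" for k
    by (simp add: sum_distrib_left sum_distrib_right mult.assoc) (rule sum.swap)
  then show ?thesis by (auto simp: mat_app_def mat_mult_def fun_eq_iff)
qed

lemma free_modD: "x \<in> free_mod n r \<Longrightarrow> x k \<in> polys n"
  by (cases "k < r") (auto simp: free_mod_def)

lemma free_mod_0 [simp]: "free_mod n 0 = {0}"
  by (auto simp: free_mod_def fun_eq_iff)

lemma free_mod_closed:
  assumes "x \<in> free_mod n r"
  shows "y \<in> free_mod n r \<Longrightarrow> x + y \<in> free_mod n r" "y \<in> free_mod n r \<Longrightarrow> x - y \<in> free_mod n r"
    "- x \<in> free_mod n r" "f \<in> polys n \<Longrightarrow> (\<lambda>k. f * x k) \<in> free_mod n r"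
  using assms by (auto simp: free_mod_def polys_add polys_diff polys_uminus polys_mult)

lemma unit_in_free_mod: "l < r \<Longrightarrow> (\<lambda>j. if j = l then 1 else 0) \<in> free_mod n r"
  by (auto simp: free_mod_def)

lemma mat_app_in_free_mod:
  assumes "\<And>k l. k < r \<Longrightarrow> l < s \<Longrightarrow> D k l \<in> polys n" "x \<in> free_mod n s"
  shows "mat_app r s D x \<in> free_mod n r"
  using assms by (auto simp: free_mod_def mat_app_def intro!: polys_sum polys_mult)

lemma mat_app_in_idl:
  assumes "idl n J" "\<And>k l. k < r \<Longrightarrow> l < s \<Longrightarrow> D k l \<in> polys n" "\<And>l. l < s \<Longrightarrow> x l \<in> J"
  shows "mat_app r s D x k \<in> J"
proof -
  have "(\<Sum>l\<in>S. D k l * x l) \<in> J" if "S \<subseteq> {..<s}" "k < r" for S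
    using finite_subset[OF that(1) finite_lessThan] that
    by (induction S rule: finite_induct)
      (auto intro!: idlD(2,3)[OF assms(1)] idlD(4)[OF assms(1)] assms(2,3))
  then show ?thesis using idlD(2)[OF assms(1)] by (auto simp: mat_app_def)
qed


subsection \<open>Direct sums\<close>

definition join :: "nat \<Rightarrow> (nat \<Rightarrow> 'r) \<Rightarrow> (nat \<Rightarrow> 'r) \<Rightarrow> nat \<Rightarrow> 'r"
  where "join a u v = (\<lambda>k. if k < a then u k else v (k - a))"

text \<open>The matrix with block rows \<open>P, Q\<close> and \<open>0, S\<close>. The zero block
  reflects that the first summand of a mapping cone is a subcomplex.\<close>

definition block :: "nat \<Rightarrow> nat \<Rightarrow> (nat \<Rightarrow> nat \<Rightarrow> 'r::zero) \<Rightarrow> (nat \<Rightarrow> nat \<Rightarrow> 'r) \<Rightarrow> (nat \<Rightarrow> nat \<Rightarrow> 'r)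
    \<Rightarrow> nat \<Rightarrow> nat \<Rightarrow> 'r"
  where "block a b P Q S = (\<lambda>k l. if k < a then (if l < b then P k l else Q k (l - b))
    else (if l < b then 0 else S (k - a) (l - b)))"

lemma sum_lessThan_add: "(\<Sum>l<b + b'. f l) = (\<Sum>l<b. f l) + (\<Sum>l<b'. f (b + l :: nat))"
  by (induction b') (auto simp: add.assoc)

lemma mat_app_block:
  "mat_app (a + a') (b + b') (block a b P Q S) (join b u v)
    = join a (mat_app a b P u + mat_app a b' Q v) (mat_app a' b' S v)"
  by (auto simp: fun_eq_iff mat_app_def block_def join_def sum_lessThan_add)

lemma join_in_free_mod:
  "u \<in> free_mod n a \<Longrightarrow> v \<in> free_mod n b \<Longrightarrow> join a u v \<in> free_mod n (a + b)"
  by (auto simp: free_mod_def join_def)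

lemma free_mod_joinE:
  assumes "x \<in> free_mod n (a + b)"
  obtains u v where "x = join a u v" "u \<in> free_mod n a" "v \<in> free_mod n b"
proof
  show "x = join a (\<lambda>k. if k < a then x k else 0) (\<lambda>k. x (a + k))"
    by (auto simp: join_def)
qed (use assms in \<open>auto simp: free_mod_def\<close>)

lemma join_eq_0_iff:
  assumes "u \<in> free_mod n a"
  shows "join a u v = (\<lambda>_. 0) \<longleftrightarrow> u = 0 \<and> v = 0"
proof
  assume j: "join a u v = (\<lambda>_. 0)"
  have "u k = 0" for k
    using fun_cong[OF j, of k] assms by (cases "k < a") (auto simp: join_def free_mod_def)
  moreover have "v k = 0" for k
    using fun_cong[OF j, of "a + k"] by (simp add: join_def)
  ultimately show "u = 0 \<and> v = 0" by (auto simp: fun_eq_iff)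
qed (auto simp: join_def fun_eq_iff)


section \<open>Resolutions\<close>

text \<open>A resolution of \<open>A/J\<close>, in which \<open>D i\<close> is the matrix of the map from the module in degree
  \<open>i + 1\<close> to that in degree \<open>i\<close>, and the module in degree \<open>0\<close> is \<open>A\<close>.  A resolution of the ideal
  \<open>J\<close> itself is obtained by shifting the homological degree by one.\<close>

definition resolves :: "nat \<Rightarrow> 'k::field mpoly set \<Rightarrow> (nat \<Rightarrow> nat) \<Rightarrow> (nat \<Rightarrow> nat \<Rightarrow> nat \<Rightarrow> 'k mpoly) \<Rightarrow> bool"
  where "resolves n J r D \<longleftrightarrow> r 0 = 1 \<and>
    (\<forall>i. \<forall>k < r i. \<forall>l < r (Suc i). D i k l \<in> polys n) \<and>
    (\<lambda>x. mat_app (r 0) (r 1) (D 0) x 0) ` free_mod n (r 1) = J \<and>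
    (\<forall>i. {x \<in> free_mod n (r (Suc i)). mat_app (r i) (r (Suc i)) (D i) x = (\<lambda>_. 0)} =
      mat_app (r (Suc i)) (r (Suc (Suc i))) (D (Suc i)) ` free_mod n (r (Suc (Suc i))))"

text \<open>Such matrices become zero after tensoring with K, so the reduced complex is its own
  homology. No grading is involved.\<close>

definition minimal_difl :: "(nat \<Rightarrow> nat) \<Rightarrow> (nat \<Rightarrow> nat \<Rightarrow> nat \<Rightarrow> 'k::field mpoly) \<Rightarrow> bool"
  where "minimal_difl r D \<longleftrightarrow>
    (\<forall>i. \<forall>k < r i. \<forall>l < r (Suc i). Poly_Mapping.lookup (D i k l) 0 = 0)"

text \<open>\<open>a i k\<close> is the degree of the \<open>k\<close>-th basis element in
  homological degree \<open>i\<close>; the normalisation \<open>a 0 0 = 0\<close> makes the module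
  in degree 0 an unshifted copy of A.\<close>

definition graded_difl :: "(nat \<Rightarrow> nat) \<Rightarrow> (nat \<Rightarrow> nat \<Rightarrow> int) \<Rightarrow> (nat \<Rightarrow> nat \<Rightarrow> nat \<Rightarrow> 'k::field mpoly) \<Rightarrow> bool"
  where "graded_difl r a D \<longleftrightarrow> a 0 0 = 0 \<and>
    (\<forall>i. \<forall>k < r i. \<forall>l < r (Suc i). homogeneous (a (Suc i) l - a i k) (D i k l))"

context
  fixes n :: nat and J :: "'k::field mpoly set" and r :: "nat \<Rightarrow> nat" and D
  assumes res: "resolves n J r D"
begin

lemma resolves_rank_0: "r 0 = 1"
  and resolves_entries: "k < r i \<Longrightarrow> l < r (Suc i) \<Longrightarrow> D i k l \<in> polys n"
  and resolves_image: "(\<lambda>x. mat_app (r 0) (r 1) (D 0) x 0) ` free_mod n (r 1) = J"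
  using res by (auto simp: resolves_def)

lemma resolves_exact:
  assumes "x \<in> free_mod n (r (Suc i))" "mat_app (r i) (r (Suc i)) (D i) x = 0"
  obtains y where "y \<in> free_mod n (r (Suc (Suc i)))"
    "x = mat_app (r (Suc i)) (r (Suc (Suc i))) (D (Suc i)) y"
  using assms res unfolding resolves_def zero_fun_def by blast

lemma resolves_difl_difl:
  assumes "x \<in> free_mod n (r (Suc (Suc i)))"
  shows "mat_app (r i) (r (Suc i)) (D i) (mat_app (r (Suc i)) (r (Suc (Suc i))) (D (Suc i)) x) = 0"
  using assms res unfolding resolves_def zero_fun_def by blast

lemma resolves_difl_in_free_mod:
  "x \<in> free_mod n (r (Suc i)) \<Longrightarrow> mat_app (r i) (r (Suc i)) (D i) x \<in> free_mod n (r i)"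
  by (rule mat_app_in_free_mod) (auto intro: resolves_entries)

end

text \<open>The start of the construction: A alone, in degree 0, resolves A/0, and the cone of
  \<open>X b\<close> on it resolves the quotient by the principal ideal of
  \<open>X b\<close>.\<close>

lemma resolves_zero: "resolves n {0 :: 'k::field mpoly} (\<lambda>i. if i = 0 then 1 else 0) D"
proof -
  have "mat_app a 0 E x = 0" for a E and x :: "nat \<Rightarrow> 'k mpoly"
    by (auto simp: mat_app_def fun_eq_iff)
  then show ?thesis
    by (auto simp: resolves_def fun_eq_iff)
qed

text \<open>Multiplication by a nonzero \<open>f\<close> is an isomorphism from \<open>J\<close> to
  \<open>f J\<close>, because A is a domain. So only the first matrix changes, the one whose image
  is the ideal.\<close>

lemma resolves_scale:
  fixes f :: "'k::field mpoly"
  assumes res: "resolves n J r D" and f: "f \<in> polys n" "f \<noteq> 0"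
  shows "resolves n ((*) f ` J) r (D(0 := \<lambda>k l. f * D 0 k l))"
proof -
  let ?D = "D(0 := \<lambda>k l. f * D 0 k l)"
  have d0: "mat_app (r 0) (r 1) (?D 0) x = (\<lambda>k. f * mat_app (r 0) (r 1) (D 0) x k)" for x
    by (auto simp: mat_app_def fun_eq_iff sum_distrib_left mult_ac)
  then have "mat_app (r 0) (r 1) (?D 0) x = (\<lambda>_. 0) \<longleftrightarrow> mat_app (r 0) (r 1) (D 0) x = (\<lambda>_. 0)" for x
    using f by (auto simp: fun_eq_iff)
  then have "mat_app (r i) (r (Suc i)) (?D i) x = (\<lambda>_. 0) \<longleftrightarrow> mat_app (r i) (r (Suc i)) (D i) x = (\<lambda>_. 0)" for i x
    by (cases i) auto
  moreover have "\<forall>i. \<forall>k < r i. \<forall>l < r (Suc i). ?D i k l \<in> polys n"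
    using resolves_entries[OF res] f by (auto intro: polys_mult)
  moreover have "(\<lambda>x. mat_app (r 0) (r 1) (?D 0) x 0) ` free_mod n (r 1) = (*) f ` J"
    unfolding d0 resolves_image[OF res, symmetric] by (simp add: image_image)
  ultimately show ?thesis
    using res unfolding resolves_def by simp
qed


subsection \<open>The mapping cone of a multiplication map\<close>

definition prev :: "(nat \<Rightarrow> nat) \<Rightarrow> nat \<Rightarrow> nat"
  where "prev r i = (case i of 0 \<Rightarrow> 0 | Suc j \<Rightarrow> r j)"

definition cone_rank :: "(nat \<Rightarrow> nat) \<Rightarrow> nat \<Rightarrow> nat"
  where "cone_rank r i = r i + prev r i"

text \<open>A pair \<open>(u, v)\<close> goes to \<open>(d u + f v, - d v)\<close>; the sign makes
  the composition of two such maps zero. In degree 0 the second component has no rows, so its block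
  is immaterial.\<close>

definition cone_difl :: "(nat \<Rightarrow> nat) \<Rightarrow> (nat \<Rightarrow> nat \<Rightarrow> nat \<Rightarrow> 'k::field mpoly) \<Rightarrow> 'k mpoly
    \<Rightarrow> nat \<Rightarrow> nat \<Rightarrow> nat \<Rightarrow> 'k mpoly"
  where "cone_difl r D f i = block (r i) (r (Suc i)) (D i) (\<lambda>k l. if k = l then f else 0)
    (case i of 0 \<Rightarrow> (\<lambda>_ _. 0) | Suc j \<Rightarrow> (\<lambda>k l. - D j k l))"

text \<open>The second summand is the old complex moved up by one homological degree and twisted by
  the degree \<open>e\<close> of \<open>f\<close>. For \<open>i = 0\<close> the truncated
  \<open>i - 1\<close> is harmless, as that summand then has rank 0.\<close>

definition cone_shift :: "(nat \<Rightarrow> nat) \<Rightarrow> (nat \<Rightarrow> nat \<Rightarrow> int) \<Rightarrow> int \<Rightarrow> nat \<Rightarrow> nat \<Rightarrow> int"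
  where "cone_shift r a e i = join (r i) (a i) (\<lambda>k. a (i - 1) k + e)"

lemma prev_simps [simp]: "prev r 0 = 0" "prev r (Suc i) = r i"
  by (auto simp: prev_def)

lemma mat_app_scalar:
  assumes "v \<in> free_mod n r"
  shows "mat_app r r (\<lambda>k l. if k = l then f else 0) v = (\<lambda>k. f * v k)"
proof
  fix k
  have "(\<Sum>l<r. (if k = l then f else 0) * v l) = (if k < r then f * v k else 0)"
    by (auto simp: if_distribR if_distrib[of "\<lambda>x. x * _"] sum.delta cong: if_cong)
  then show "mat_app r r (\<lambda>k l. if k = l then f else 0) v k = f * v k"
    using assms by (auto simp: mat_app_def free_mod_def)
qed

lemma cone_difl_join:
  assumes "v \<in> free_mod n (r i)"
  shows "mat_app (cone_rank r i) (cone_rank r (Suc i)) (cone_difl r D f i) (join (r (Suc i)) u v)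
    = join (r i) (mat_app (r i) (r (Suc i)) (D i) u + (\<lambda>k. f * v k))
        (case i of 0 \<Rightarrow> 0 | Suc j \<Rightarrow> - mat_app (r j) (r (Suc j)) (D j) v)"
  unfolding cone_rank_def prev_simps cone_difl_def mat_app_block mat_app_scalar[OF assms]
  by (cases i) (auto simp: mat_app_matrix_uminus)

lemma cone_entries:
  assumes res: "resolves n J r D" and f: "f \<in> polys n"
    and "k < cone_rank r i" "l < cone_rank r (Suc i)"
  shows "cone_difl r D f i k l \<in> polys n"
  using assms(3,4) f resolves_entries[OF res]
  by (auto simp: cone_difl_def block_def cone_rank_def split: nat.split intro!: polys_uminus)

text \<open>If \<open>(u, v)\<close> is a cycle of the cone, then \<open>v = d w\<close> for some
  \<open>w\<close>, and \<open>u + f w\<close> is a cycle of the old complex, hence equal to some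
  \<open>d y\<close>; so \<open>(u, v)\<close> is the image of \<open>(y, - w)\<close>. Regularity
  of \<open>f\<close> is used for finding \<open>w\<close> in the lowest degree.\<close>

theorem resolves_cone:
  assumes res: "resolves n J r D" and f: "f \<in> polys n" "nonzerodiv n J f"
  shows "resolves n (extend n J f) (cone_rank r) (cone_difl r D f)"
proof -
  let ?d = "\<lambda>i. mat_app (r i) (r (Suc i)) (D i)"
  let ?d' = "\<lambda>i. mat_app (cone_rank r i) (cone_rank r (Suc i)) (cone_difl r D f i)"
  note d_free = resolves_difl_in_free_mod[OF res] and dd = resolves_difl_difl[OF res]
  note cdj = cone_difl_join[where n = n and r = r and D = D and f = f]
  have cr: "cone_rank r (Suc i) = r (Suc i) + r i" for i
    by (simp add: cone_rank_def)
  have image: "(\<lambda>x. ?d' 0 x 0) ` free_mod n (cone_rank r 1) = extend n J f"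
  proof (intro equalityI subsetI)
    fix p assume "p \<in> (\<lambda>x. ?d' 0 x 0) ` free_mod n (cone_rank r 1)"
    then obtain x where x: "x \<in> free_mod n (r 1 + r 0)" "p = ?d' 0 x 0"
      using cr[of 0] by auto
    then obtain u v where uv: "x = join (r (Suc 0)) u v" "u \<in> free_mod n (r 1)" "v \<in> free_mod n (r 0)"
      by (metis One_nat_def free_mod_joinE)
    have "p = ?d 0 u 0 + f * v 0"
      unfolding x(2) uv(1) cdj[OF uv(3)] using resolves_rank_0[OF res] by (simp add: join_def)
    moreover have "?d 0 u 0 \<in> J" using uv(2) resolves_image[OF res] by auto
    ultimately show "p \<in> extend n J f"
      using extendI free_modD[OF uv(3)] by blast
  next
    fix p assume "p \<in> extend n J f"
    then obtain p' q where p: "p = p' + f * q" "p' \<in> J" "q \<in> polys n"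
      by (auto simp: extend_def)
    then obtain u where u: "u \<in> free_mod n (r 1)" "p' = ?d 0 u 0"
      using resolves_image[OF res] by auto
    define v where "v = (\<lambda>k::nat. if k = 0 then q else 0)"
    have v: "v \<in> free_mod n (r 0)" using p(3) resolves_rank_0[OF res] by (auto simp: v_def free_mod_def)
    have "?d' 0 (join (r (Suc 0)) u v) 0 = p"
      unfolding cdj[OF v] p(1) u(2) using resolves_rank_0[OF res]
      by (simp add: join_def v_def)
    moreover have "join (r (Suc 0)) u v \<in> free_mod n (cone_rank r 1)"
      using join_in_free_mod[OF u(1) v] cr[of 0] by simp
    ultimately show "p \<in> (\<lambda>x. ?d' 0 x 0) ` free_mod n (cone_rank r 1)" by force
  qed
  have sub: "?d' (Suc i) x \<in> free_mod n (cone_rank r (Suc i)) \<and> ?d' i (?d' (Suc i) x) = 0"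
    if x: "x \<in> free_mod n (cone_rank r (Suc (Suc i)))" for i x
  proof
    show "?d' (Suc i) x \<in> free_mod n (cone_rank r (Suc i))"
      using x cone_entries[OF res f(1)] by (intro mat_app_in_free_mod) auto
    obtain u v where uv: "x = join (r (Suc (Suc i))) u v"
        "u \<in> free_mod n (r (Suc (Suc i)))" "v \<in> free_mod n (r (Suc i))"
      using x free_mod_joinE[of x n "r (Suc (Suc i))" "r (Suc i)"] unfolding cr by metis
    have v': "- ?d i v \<in> free_mod n (r i)" using d_free[OF uv(3)] by (rule free_mod_closed)
    have 1: "?d i (?d (Suc i) u + (\<lambda>k. f * v k)) + (\<lambda>k. f * (- ?d i v) k) = 0"
      unfolding mat_app_add dd[OF uv(2)] mat_app_smult by (simp add: fun_eq_iff)
    have 2: "(case i of 0 \<Rightarrow> 0 | Suc j \<Rightarrow> - ?d j (- ?d i v)) = 0"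
      using dd uv(3) by (cases i) (auto simp: mat_app_uminus)
    have "?d' (Suc i) x = join (r (Suc i)) (?d (Suc i) u + (\<lambda>k. f * v k)) (- ?d i v)"
      unfolding uv(1) cdj[OF uv(3)] by simp
    then show "?d' i (?d' (Suc i) x) = 0"
      by (simp only: cdj[OF v'] 1 2) (simp add: join_def fun_eq_iff)
  qed
  have exact: "x \<in> ?d' (Suc i) ` free_mod n (cone_rank r (Suc (Suc i)))"
    if x: "x \<in> free_mod n (cone_rank r (Suc i))" and 0: "?d' i x = (\<lambda>_. 0)" for i x
  proof -
    obtain u v where uv: "x = join (r (Suc i)) u v"
        "u \<in> free_mod n (r (Suc i))" "v \<in> free_mod n (r i)"
      using x free_mod_joinE[of x n "r (Suc i)" "r i"] unfolding cr by metis
    have fv: "(\<lambda>k. f * v k) \<in> free_mod n (r i)" using uv(3) f(1) by (rule free_mod_closed)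
    have "?d i u + (\<lambda>k. f * v k) \<in> free_mod n (r i)" using d_free[OF uv(2)] fv by (rule free_mod_closed)
    then have du: "?d i u + (\<lambda>k. f * v k) = 0"
      and dv: "(case i of 0 \<Rightarrow> 0 | Suc j \<Rightarrow> - ?d j v) = 0"
      using 0 unfolding uv(1) cdj[OF uv(3)] by (simp_all add: join_eq_0_iff)
    obtain w where w: "w \<in> free_mod n (r (Suc i))" "v = ?d i w"
    proof (cases i)
      \<comment> \<open>Here \<open>v\<close> is one polynomial subject to no cycle condition. Since
        \<open>f v = - d u\<close> lies in \<open>J\<close>, so does \<open>v\<close>, and
        \<open>J\<close> is the image of \<open>d\<close>.\<close>
      case 0
      have "?d 0 u 0 + f * v 0 = 0" using fun_cong[OF du, of 0] 0 by simp
      then have "f * v 0 = - ?d 0 u 0" by (simp add: eq_neg_iff_add_eq_0 add.commute)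
      also have "\<dots> = ?d 0 (- u) 0" by (simp add: mat_app_uminus)
      also have "\<dots> \<in> J" using free_mod_closed(3)[OF uv(2)] 0 resolves_image[OF res] by auto
      finally have "v 0 \<in> J" using f(2) free_modD[OF uv(3)] by (auto simp: nonzerodiv_def)
      then obtain w where w: "w \<in> free_mod n (r 1)" "v 0 = ?d 0 w 0"
        using resolves_image[OF res] by auto
      have "v k = ?d 0 w k" for k
        using w(2) uv(3) 0 resolves_rank_0[OF res] by (cases k) (auto simp: free_mod_def mat_app_def)
      with w 0 that show thesis by auto
    next
      case (Suc j)
      with dv have "?d j v = 0" by (simp add: fun_eq_iff)
      with uv(3) Suc that show thesis using resolves_exact[OF res, of v j] by metis
    qed
    have "?d i (u + (\<lambda>k. f * w k)) = 0"
      using du unfolding mat_app_add mat_app_smult w(2) .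
    moreover have "u + (\<lambda>k. f * w k) \<in> free_mod n (r (Suc i))"
      using uv(2) free_mod_closed(4)[OF w(1) f(1)] by (rule free_mod_closed)
    ultimately obtain y where y: "y \<in> free_mod n (r (Suc (Suc i)))" "u + (\<lambda>k. f * w k) = ?d (Suc i) y"
      using resolves_exact[OF res] by metis
    have w': "- w \<in> free_mod n (r (Suc i))" using w(1) by (rule free_mod_closed)
    have "?d (Suc i) y + (\<lambda>k. f * (- w) k) = u"
      unfolding y(2)[symmetric] by (simp add: fun_eq_iff)
    then have "?d' (Suc i) (join (r (Suc (Suc i))) y (- w)) = x"
      unfolding cdj[OF w'] uv(1) w(2) by (simp add: mat_app_uminus)
    moreover have "join (r (Suc (Suc i))) y (- w) \<in> free_mod n (cone_rank r (Suc (Suc i)))"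
      unfolding cr using y(1) w' by (rule join_in_free_mod)
    ultimately show ?thesis by blast
  qed
  have ex: "{x \<in> free_mod n (cone_rank r (Suc i)). ?d' i x = (\<lambda>_. 0)} =
      ?d' (Suc i) ` free_mod n (cone_rank r (Suc (Suc i)))" for i
  proof (intro equalityI subsetI)
    fix x assume "x \<in> ?d' (Suc i) ` free_mod n (cone_rank r (Suc (Suc i)))"
    then show "x \<in> {x \<in> free_mod n (cone_rank r (Suc i)). ?d' i x = (\<lambda>_. 0)}"
      using sub unfolding zero_fun_def by auto
  qed (elim CollectE conjE exact)
  show ?thesis
    unfolding resolves_def
  proof (intro conjI allI impI)
    show "cone_rank r 0 = 1" using resolves_rank_0[OF res] by (simp add: cone_rank_def)
  qed (rule image[folded One_nat_def] | rule ex | rule cone_entries[OF res f(1)], assumption+)+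
qed

lemma minimal_cone:
  assumes "minimal_difl r D" "Poly_Mapping.lookup f 0 = 0"
  shows "minimal_difl (cone_rank r) (cone_difl r D f)"
  using assms unfolding minimal_difl_def
  by (auto simp: cone_difl_def block_def cone_rank_def split: nat.split)

lemma graded_cone:
  assumes "graded_difl r a D" "homogeneous e f" "r 0 = 1"
  shows "graded_difl (cone_rank r) (cone_shift r a e) (cone_difl r D f)"
proof -
  have "homogeneous (cone_shift r a e (Suc i) l - cone_shift r a e i k) (cone_difl r D f i k l)"
    if "k < cone_rank r i" "l < cone_rank r (Suc i)" for i k l
  proof -
    have 1: "homogeneous (a (Suc i) l - a i k) (D i k l)" if "k < r i" "l < r (Suc i)" for i k l
      using assms(1) that by (auto simp: graded_difl_def)
    have 2: "homogeneous (a (Suc i) l + e - (a i k + e)) (- D i k l)" if "k < r i" "l < r (Suc i)" for i k l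
      using homogeneous_uminus[OF 1[OF that]] by simp
    show ?thesis
      using that assms(2) 1 2
      by (auto simp: cone_shift_def cone_difl_def block_def cone_rank_def join_def split: nat.splits)
  qed
  moreover have "cone_shift r a e 0 0 = 0"
    using assms by (simp add: cone_shift_def join_def graded_difl_def)
  ultimately show ?thesis by (simp add: graded_difl_def)
qed


section \<open>Minimal resolutions have length at most the number of variables\<close>

text \<open>Reduction modulo a variable preserves exactness except in the lowest degree; after
  killing all the variables, the differentials vanish.\<close>

lemma exact_mod_variables:
  fixes D :: "nat \<Rightarrow> nat \<Rightarrow> nat \<Rightarrow> 'k::field mpoly"
  assumes res: "resolves n J r D" and "q \<le> n" "q \<le> i" "u \<in> free_mod n (r (Suc i))"
    and "\<And>k. mat_app (r i) (r (Suc i)) (D i) u k \<in> sqid n ((\<lambda>j. {j}) ` {1..q})"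
  shows "\<exists>y\<in>free_mod n (r (Suc (Suc i))). \<forall>k.
    u k - mat_app (r (Suc i)) (r (Suc (Suc i))) (D (Suc i)) y k \<in> sqid n ((\<lambda>j. {j}) ` {1..q})"
  using assms(2-5)
proof (induction q arbitrary: i u)
  case 0
  then have "mat_app (r i) (r (Suc i)) (D i) u = 0" by (auto simp: sqid_empty fun_eq_iff)
  with 0(3) obtain y where "y \<in> free_mod n (r (Suc (Suc i)))"
      "u = mat_app (r (Suc i)) (r (Suc (Suc i))) (D (Suc i)) y"
    by (rule resolves_exact[OF res])
  then show ?case by (intro bexI[of _ y]) (auto simp: sqid_empty)
next
  case (Suc q)
  let ?J = "\<lambda>q. sqid n ((\<lambda>j. {j}) ` {1..q}) :: 'k mpoly set" and ?f = "X (Suc q) :: 'k mpoly"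
  let ?d = "\<lambda>i. mat_app (r i) (r (Suc i)) (D i)"
  have J: "idl n (?J q)" by (rule idl_sqid)
  have f: "?f \<in> polys n" using Suc.prems(1) by (intro X_in_polys) auto
  have ext: "?J (Suc q) = extend n (?J q) ?f"
    using Suc.prems(1) by (subst extend_sqid) (auto simp: atLeastAtMostSuc_conv)
  \<comment> \<open>Each variable costs one homological degree, whence the hypothesis
    \<open>q \<le> i\<close>: the induction hypothesis is applied once in degree \<open>i'\<close>,
    to the coefficients of the new variable, and once in degree \<open>i\<close>.\<close>
  obtain i' where i: "i = Suc i'" using Suc.prems(2) by (cases i) auto
  have "\<exists>p q'. ?d i u k = p + ?f * q' \<and> p \<in> ?J q \<and> q' \<in> polys n" for k
    using Suc.prems(4)[of k] unfolding ext extend_def by auto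
  then obtain v0 v where v: "\<And>k. ?d i u k = v0 k + ?f * v k" "\<And>k. v0 k \<in> ?J q" "\<And>k. v k \<in> polys n"
    by metis
  define v0' v' where "v0' = (\<lambda>k. if k < r i then v0 k else 0)" and "v' = (\<lambda>k. if k < r i then v k else 0)"
  have v': "?d i u = v0' + (\<lambda>k. ?f * v' k)" "\<And>k. v0' k \<in> ?J q" "v' \<in> free_mod n (r i)"
  proof -
    have "?d i u k = v0' k + ?f * v' k" for k
      using v(1)[of k] by (cases "k < r i") (simp_all add: v0'_def v'_def mat_app_def)
    then show "?d i u = v0' + (\<lambda>k. ?f * v' k)" by (simp add: fun_eq_iff)
  qed (use v idlD(2)[OF J] in \<open>auto simp: v0'_def v'_def free_mod_def\<close>)
  have dJ: "mat_app (r i) (r (Suc i)) (D i) x k \<in> ?J q" if "\<And>k. x k \<in> ?J q" for i x k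
    using J resolves_entries[OF res] that by (rule mat_app_in_idl)
  \<comment> \<open>Applying the next differential to \<open>d u = v0' + f v'\<close> puts
    \<open>f d v'\<close> into the ideal of the first \<open>q\<close> variables. The new variable
    \<open>f\<close> is regular modulo that ideal, so \<open>d v'\<close> lies in it.\<close>
  have "?d i' (?d i u) = 0" using Suc.prems(3) unfolding i by (rule resolves_difl_difl[OF res])
  then have e: "?d i' v0' + (\<lambda>k. ?f * ?d i' v' k) = 0"
    unfolding v'(1) mat_app_add mat_app_smult .
  have "?d i' v' k \<in> ?J q" for k
  proof -
    have "?d i' v0' k + ?f * ?d i' v' k = 0"
      using fun_cong[OF e, of k] by simp
    then have "?f * ?d i' v' k = - ?d i' v0' k" by (simp add: eq_neg_iff_add_eq_0 add.commute)
    then have "?f * ?d i' v' k \<in> ?J q"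
      using idlD(7)[OF J dJ[OF v'(2), where i = i']] by simp
    moreover have "?d i' v' k \<in> polys n"
      using resolves_difl_in_free_mod[OF res] v'(3) free_modD unfolding i by blast
    moreover have "nonzerodiv n (?J q) ?f" by (rule nonzerodiv_sqid) auto
    ultimately show ?thesis by (auto simp: nonzerodiv_def)
  qed
  then obtain w where w: "w \<in> free_mod n (r (Suc i))" "\<And>k. v' k - ?d i w k \<in> ?J q"
    using Suc.IH[of i' v'] Suc.prems(1,2) v'(3) i by auto
  \<comment> \<open>Since \<open>v'\<close> is \<open>d w\<close> modulo the smaller ideal,
    subtracting \<open>f w\<close> from \<open>u\<close> removes from \<open>d u\<close> the part
    divisible by \<open>f\<close>.\<close>
  define u' where "u' = u - (\<lambda>k. ?f * w k)"
  have "?d i u' k \<in> ?J q" for k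
  proof -
    have "?d i u' k = v0' k + ?f * (v' k - ?d i w k)"
      unfolding u'_def mat_app_diff mat_app_smult v'(1) by (simp add: algebra_simps)
    then show ?thesis using idlD[OF J] f v'(2) w(2) by simp
  qed
  moreover have "u' \<in> free_mod n (r (Suc i))"
    unfolding u'_def using Suc.prems(3) free_mod_closed(4)[OF w(1) f] by (rule free_mod_closed)
  ultimately have "\<exists>y\<in>free_mod n (r (Suc (Suc i))). \<forall>k. u' k - ?d (Suc i) y k \<in> ?J q"
    using Suc.prems(1,2) by (intro Suc.IH) auto
  then obtain y where y: "y \<in> free_mod n (r (Suc (Suc i)))" "\<And>k. u' k - ?d (Suc i) y k \<in> ?J q"
    by blast
  have "u k - ?d (Suc i) y k \<in> ?J (Suc q)" for k
  proof -
    have "u k - ?d (Suc i) y k = (u' k - ?d (Suc i) y k) + ?f * w k" by (simp add: u'_def)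
    then show ?thesis unfolding ext using extendI[OF y(2) free_modD[OF w(1)]] by metis
  qed
  with y(1) show ?case by blast
qed

lemma maximal_sqid_iff:
  "p \<in> sqid n ((\<lambda>j. {j}) ` {1..n}) \<longleftrightarrow> p \<in> polys n \<and> Poly_Mapping.lookup p 0 = (0 :: 'k::field)"
proof -
  have "(\<exists>g\<in>(\<lambda>j. {j}) ` {1..n}. g \<subseteq> Poly_Mapping.keys u) \<longleftrightarrow> u \<noteq> 0" if "u \<in> monoms n" for u
  proof -
    have "u \<noteq> 0 \<longleftrightarrow> Poly_Mapping.keys u \<noteq> {}" by simp
    then show ?thesis using that unfolding monoms_def by blast
  qed
  then have "(\<forall>u\<in>Poly_Mapping.keys p. \<exists>g\<in>(\<lambda>j. {j}) ` {1..n}. g \<subseteq> Poly_Mapping.keys u) \<longleftrightarrow>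
      0 \<notin> Poly_Mapping.keys p" if "p \<in> polys n"
    using that unfolding polys_def by blast
  then show ?thesis unfolding sqid_def by (auto simp: in_keys_iff)
qed

text \<open>In a degree above \<open>n\<close>, a unit vector would be a cycle modulo all the
  variables by minimality, hence a boundary modulo the variables by
  \<open>exact_mod_variables\<close>; but boundaries have no constant terms.\<close>

theorem minimal_resolution_length:
  fixes D :: "nat \<Rightarrow> nat \<Rightarrow> nat \<Rightarrow> 'k::field mpoly"
  assumes res: "resolves n J r D" and min: "minimal_difl r D" and "r i > 0"
  shows "i \<le> n"
proof (rule ccontr)
  assume "\<not> i \<le> n"
  then obtain i' where i: "i = Suc i'" "n \<le> i'" by (cases i) auto
  let ?d = "\<lambda>i. mat_app (r i) (r (Suc i)) (D i)"
  have d0: "Poly_Mapping.lookup (?d i x k) 0 = 0" for i x k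
    using min by (auto simp: mat_app_def lookup_sum lookup_mult_0 minimal_difl_def)
  let ?u = "\<lambda>j::nat. if j = 0 then 1 else 0 :: 'k mpoly"
  have u: "?u \<in> free_mod n (r (Suc i'))" using assms(3) i by (intro unit_in_free_mod) auto
  have "?d i' ?u k \<in> sqid n ((\<lambda>j. {j}) ` {1..n})" for k
    unfolding maximal_sqid_iff using d0 resolves_difl_in_free_mod[OF res u] free_modD by blast
  then obtain y where "\<forall>k. ?u k - ?d (Suc i') y k \<in> sqid n ((\<lambda>j. {j}) ` {1..n})"
    using exact_mod_variables[OF res order_refl i(2) u] by blast
  then have "Poly_Mapping.lookup (?u 0 - ?d (Suc i') y 0) 0 = 0"
    unfolding maximal_sqid_iff by blast
  then show False using d0 by (simp add: lookup_minus)
qed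


section \<open>Comparison of graded resolutions\<close>

text \<open>The matrix of a degree-preserving map from the free module of rank \<open>r\<close> with
  basis degrees \<open>a\<close> to that of rank \<open>s\<close> with basis degrees
  \<open>b\<close>.\<close>

definition graded_mat :: "nat \<Rightarrow> nat \<Rightarrow> nat \<Rightarrow> (nat \<Rightarrow> int) \<Rightarrow> (nat \<Rightarrow> int) \<Rightarrow> (nat \<Rightarrow> nat \<Rightarrow> 'k::field mpoly) \<Rightarrow> bool"
  where "graded_mat n s r b a M \<longleftrightarrow>
    (\<forall>k<s. \<forall>l<r. M k l \<in> polys n \<and> homogeneous (a l - b k) (M k l))"

lemma graded_mat_mult:
  assumes "graded_mat n s t c b M" "graded_mat n t r b a N"
  shows "graded_mat n s r c a (mat_mult t M N)"
proof -
  have "mat_mult t M N k l \<in> polys n \<and> homogeneous (a l - c k) (mat_mult t M N k l)"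
    if "k < s" "l < r" for k l
    unfolding mat_mult_def
  proof (intro conjI polys_sum homogeneous_sum)
    fix j assume j: "j \<in> {..<t}"
    show "M k j * N j l \<in> polys n"
      using assms that j by (auto simp: graded_mat_def intro: polys_mult)
    have "homogeneous (b j - c k + (a l - b j)) (M k j * N j l)"
      using assms that j by (intro homogeneous_mult) (auto simp: graded_mat_def)
    then show "homogeneous (a l - c k) (M k j * N j l)" by simp
  qed
  then show ?thesis by (simp add: graded_mat_def)
qed

lemma graded_mat_diff:
  "graded_mat n s r b a M \<Longrightarrow> graded_mat n s r b a N \<Longrightarrow> graded_mat n s r b a (\<lambda>k l. M k l - N k l)"
  by (auto simp: graded_mat_def intro: polys_diff homogeneous_diff)

lemma graded_mat_app_in_free_mod:
  "graded_mat n s r b a M \<Longrightarrow> x \<in> free_mod n r \<Longrightarrow> mat_app s r M x \<in> free_mod n s"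
  by (rule mat_app_in_free_mod) (auto simp: graded_mat_def)

text \<open>Lift the unit vectors arbitrarily, then keep in each coordinate only the component of
  the degree that a graded matrix must have there. Comparing homogeneous components of the equations
  shows that this is still a lift.\<close>

lemma graded_lift:
  assumes E: "graded_mat n p q bp bq E" and M: "graded_mat n p s bp a M"
    and im: "\<And>x. x \<in> free_mod n s \<Longrightarrow> \<exists>y\<in>free_mod n q. mat_app p q E y = mat_app p s M x"
  shows "\<exists>N. graded_mat n q s bq a N \<and> (\<forall>x. mat_app p q E (mat_app q s N x) = mat_app p s M x)"
proof -
  have "\<exists>y. y \<in> free_mod n q \<and> mat_app p q E y = mat_app p s M (\<lambda>j. if j = l then 1 else 0)"
    if "l < s" for l
    using im[OF unit_in_free_mod[OF that]] by blast
  then obtain y where y: "\<And>l. l < s \<Longrightarrow> y l \<in> free_mod n q"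
      "\<And>l. l < s \<Longrightarrow> mat_app p q E (y l) = mat_app p s M (\<lambda>j. if j = l then 1 else 0)"
    by metis
  define N where "N k l = hpart (a l - bq k) (y l k)" for k l
  have "graded_mat n q s bq a N"
    using y(1) unfolding graded_mat_def N_def
    by (auto intro: hpart_in_polys homogeneous_hpart free_modD)
  moreover have EN: "mat_mult q E N k l = M k l" if kl: "k < p" "l < s" for k l
  proof -
    have "mat_mult q E N k l = (\<Sum>j<q. hpart (a l - bp k) (E k j * y l j))"
      unfolding mat_mult_def N_def
    proof (rule sum.cong[OF refl])
      fix j assume "j \<in> {..<q}"
      then have "homogeneous (bq j - bp k) (E k j)" using E kl by (auto simp: graded_mat_def)
      from hpart_mult[OF this, of "a l - bq j" "y l j"]
      show "E k j * hpart (a l - bq j) (y l j) = hpart (a l - bp k) (E k j * y l j)" by simp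
    qed
    also have "\<dots> = hpart (a l - bp k) (mat_app p q E (y l) k)"
      using kl by (simp add: hpart_sum mat_app_def)
    also have "\<dots> = hpart (a l - bp k) (M k l)"
      using kl y(2) by (simp add: mat_app_unit)
    also have "\<dots> = M k l" using M kl by (intro hpart_homogeneous) (auto simp: graded_mat_def)
    finally show ?thesis .
  qed
  have "mat_app p q E (mat_app q s N x) = mat_app p s M x" for x
    unfolding mat_app_mat_mult[symmetric] by (rule mat_app_cong) (use EN in auto)
  with calculation show ?thesis by blast
qed

definition graded_resolves :: "nat \<Rightarrow> 'k::field mpoly set \<Rightarrow> (nat \<Rightarrow> nat) \<Rightarrow> (nat \<Rightarrow> nat \<Rightarrow> int)
    \<Rightarrow> (nat \<Rightarrow> nat \<Rightarrow> nat \<Rightarrow> 'k mpoly) \<Rightarrow> bool"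
  where "graded_resolves n J r a D \<longleftrightarrow> resolves n J r D \<and> graded_difl r a D"

lemma graded_resolves_difl:
  "graded_resolves n J r a D \<Longrightarrow> graded_mat n (r i) (r (Suc i)) (a i) (a (Suc i)) (D i)"
  using resolves_entries[of n J r D]
  by (auto simp: graded_resolves_def graded_difl_def graded_mat_def)

lemma resolves_exact_ex:
  assumes "resolves n J r D" "x \<in> free_mod n (r (Suc i))" "mat_app (r i) (r (Suc i)) (D i) x = 0"
  shows "\<exists>y\<in>free_mod n (r (Suc (Suc i))). mat_app (r (Suc i)) (r (Suc (Suc i))) (D (Suc i)) y = x"
  using resolves_exact[OF assms] by metis

text \<open>The existence half of the comparison theorem, starting from the identity of A in degree
  0.\<close>

lemma chain_map_exists:
  fixes J :: "'k::field mpoly set"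
  assumes F: "graded_resolves n J r a D" and G: "graded_resolves n J r' a' D'"
  shows "\<exists>\<phi>. (\<forall>i. graded_mat n (r' i) (r i) (a' i) (a i) (\<phi> i)) \<and>
    (\<forall>x\<in>free_mod n 1. mat_app 1 1 (\<phi> 0) x = x) \<and>
    (\<forall>i x. mat_app (r' i) (r' (Suc i)) (D' i) (mat_app (r' (Suc i)) (r (Suc i)) (\<phi> (Suc i)) x)
      = mat_app (r' i) (r i) (\<phi> i) (mat_app (r i) (r (Suc i)) (D i) x))"
proof -
  let ?d = "\<lambda>i. mat_app (r i) (r (Suc i)) (D i)" and ?d' = "\<lambda>i. mat_app (r' i) (r' (Suc i)) (D' i)"
  have resF: "resolves n J r D" and resG: "resolves n J r' D'"
    using F G by (auto simp: graded_resolves_def)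
  have r0: "r 0 = 1" "r' 0 = 1" using resF resG by (auto simp: resolves_def)
  \<comment> \<open>The middle clause is the invariant that makes the next lift possible:
    \<open>M\<close> maps boundaries to boundaries. In degree 0 it holds because both complexes have
    image \<open>J\<close> in A.\<close>
  let ?P = "\<lambda>i M. graded_mat n (r' i) (r i) (a' i) (a i) M \<and>
    (\<forall>x\<in>free_mod n (r (Suc i)). \<exists>y\<in>free_mod n (r' (Suc i)). ?d' i y = mat_app (r' i) (r i) M (?d i x)) \<and>
    (i = 0 \<longrightarrow> (\<forall>x\<in>free_mod n 1. mat_app 1 1 M x = x))"
  let ?Q = "\<lambda>i M M'. \<forall>x. ?d' i (mat_app (r' (Suc i)) (r (Suc i)) M' x) = mat_app (r' i) (r i) M (?d i x)"
  have "\<exists>\<phi>. \<forall>i. ?P i (\<phi> i) \<and> ?Q i (\<phi> i) (\<phi> (Suc i))"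
  proof (rule dependent_nat_choice)
    have id: "mat_app 1 1 (\<lambda>_ _. 1) x = x" if "x \<in> free_mod n 1" for x :: "nat \<Rightarrow> 'k mpoly"
      using that by (auto simp: mat_app_def fun_eq_iff free_mod_def)
    have "\<exists>y\<in>free_mod n (r' (Suc 0)). ?d' 0 y = mat_app (r' 0) (r 0) (\<lambda>_ _. 1) (?d 0 x)"
      if x: "x \<in> free_mod n (r (Suc 0))" for x
    proof -
      have "?d 0 x 0 \<in> J" using x resolves_image[OF resF] by auto
      then obtain y where y: "y \<in> free_mod n (r' (Suc 0))" "?d' 0 y 0 = ?d 0 x 0"
        using resolves_image[OF resG] by force
      have "?d' 0 y k = ?d 0 x k" for k
        using y(2) r0 by (cases k) (auto simp: mat_app_def)
      moreover have "?d 0 x \<in> free_mod n 1"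
        using resolves_difl_in_free_mod[OF resF x] r0 by simp
      ultimately have "?d' 0 y = mat_app (r' 0) (r 0) (\<lambda>_ _. 1) (?d 0 x)"
        unfolding r0 using id by auto
      with y(1) show ?thesis by blast
    qed
    moreover have "graded_mat n (r' 0) (r 0) (a' 0) (a 0) (\<lambda>_ _. 1)"
      using F G r0 by (auto simp: graded_mat_def graded_resolves_def graded_difl_def)
    ultimately show "\<exists>M. ?P 0 M" using id by blast
  next
    fix M i assume M: "?P i M"
    have "\<exists>N. graded_mat n (r' (Suc i)) (r (Suc i)) (a' (Suc i)) (a (Suc i)) N \<and>
      (\<forall>x. ?d' i (mat_app (r' (Suc i)) (r (Suc i)) N x) = mat_app (r' i) (r (Suc i)) (mat_mult (r i) M (D i)) x)"
    proof (rule graded_lift)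
      show "graded_mat n (r' i) (r' (Suc i)) (a' i) (a' (Suc i)) (D' i)"
        by (rule graded_resolves_difl[OF G])
      show "graded_mat n (r' i) (r (Suc i)) (a' i) (a (Suc i)) (mat_mult (r i) M (D i))"
        using M graded_resolves_difl[OF F] by (blast intro: graded_mat_mult)
      fix x :: "nat \<Rightarrow> 'k mpoly" assume "x \<in> free_mod n (r (Suc i))"
      then show "\<exists>y\<in>free_mod n (r' (Suc i)). ?d' i y = mat_app (r' i) (r (Suc i)) (mat_mult (r i) M (D i)) x"
        unfolding mat_app_mat_mult using M by blast
    qed
    then obtain N where N: "graded_mat n (r' (Suc i)) (r (Suc i)) (a' (Suc i)) (a (Suc i)) N"
      and N2: "\<And>x. ?d' i (mat_app (r' (Suc i)) (r (Suc i)) N x) = mat_app (r' i) (r i) M (?d i x)"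
      unfolding mat_app_mat_mult by blast
    have ex: "\<exists>y\<in>free_mod n (r' (Suc (Suc i))).
        ?d' (Suc i) y = mat_app (r' (Suc i)) (r (Suc i)) N (?d (Suc i) x)"
      if x: "x \<in> free_mod n (r (Suc (Suc i)))" for x
    proof -
      have "?d' i (mat_app (r' (Suc i)) (r (Suc i)) N (?d (Suc i) x)) = 0"
        unfolding N2 resolves_difl_difl[OF resF x] by simp
      then show ?thesis
        by (rule resolves_exact_ex[OF resG
              graded_mat_app_in_free_mod[OF N resolves_difl_in_free_mod[OF resF x]]])
    qed
    show "\<exists>M'. ?P (Suc i) M' \<and> ?Q i M M'"
      by (intro exI[of _ N] conjI ballI allI N N2 ex) auto
  qed
  then obtain \<phi> where "\<forall>i. ?P i (\<phi> i) \<and> ?Q i (\<phi> i) (\<phi> (Suc i))" ..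
  note \<phi> = spec[OF this]
  show ?thesis
    by (intro exI[of _ \<phi>] conjI allI)
      (rule conjunct1[OF conjunct1[OF \<phi>]] mp[OF conjunct2[OF conjunct2[OF conjunct1[OF \<phi>]]] refl]
        spec[OF conjunct2[OF \<phi>]])+
qed

text \<open>The uniqueness half of the comparison theorem. The value \<open>h 0 = 0\<close> is
  recorded because the lowest Tor of the ideal comes without a cycle condition, and the homotopy
  term through \<open>h 0\<close> must vanish there.\<close>

lemma null_homotopy_exists:
  fixes J :: "'k::field mpoly set"
  assumes F: "graded_resolves n J r a D"
    and \<theta>: "\<And>i. graded_mat n (r i) (r i) (a i) (a i) (\<theta> i)"
    and \<theta>0: "\<And>x. x \<in> free_mod n 1 \<Longrightarrow> mat_app 1 1 (\<theta> 0) x = 0"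
    and comm: "\<And>i x. x \<in> free_mod n (r (Suc i)) \<Longrightarrow>
      mat_app (r i) (r (Suc i)) (D i) (mat_app (r (Suc i)) (r (Suc i)) (\<theta> (Suc i)) x)
      = mat_app (r i) (r i) (\<theta> i) (mat_app (r i) (r (Suc i)) (D i) x)"
  shows "\<exists>h. (\<forall>i. graded_mat n (r (Suc i)) (r i) (a (Suc i)) (a i) (h i)) \<and> h 0 = (\<lambda>_ _. 0) \<and>
    (\<forall>i x. mat_app (r (Suc i)) (r (Suc i)) (\<theta> (Suc i)) x =
      mat_app (r (Suc i)) (r (Suc (Suc i))) (D (Suc i)) (mat_app (r (Suc (Suc i))) (r (Suc i)) (h (Suc i)) x)
      + mat_app (r (Suc i)) (r i) (h i) (mat_app (r i) (r (Suc i)) (D i) x))"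
proof -
  let ?d = "\<lambda>i. mat_app (r i) (r (Suc i)) (D i)" and ?t = "\<lambda>i. mat_app (r i) (r i) (\<theta> i)"
  let ?h = "\<lambda>i. mat_app (r (Suc i)) (r i)"
  have res: "resolves n J r D" using F by (auto simp: graded_resolves_def)
  have r0: "r 0 = 1" using res by (auto simp: resolves_def)
  \<comment> \<open>The middle clause says that \<open>\<theta> - h d\<close> takes values in the
    cycles, so that it lifts through the next differential.\<close>
  let ?P = "\<lambda>i M. graded_mat n (r (Suc i)) (r i) (a (Suc i)) (a i) M \<and>
    (\<forall>x\<in>free_mod n (r (Suc i)). ?d i (?t (Suc i) x - ?h i M (?d i x)) = 0) \<and>
    (i = 0 \<longrightarrow> M = (\<lambda>_ _. 0))"
  let ?Q = "\<lambda>i M M'. \<forall>x. ?t (Suc i) x = ?d (Suc i) (?h (Suc i) M' x) + ?h i M (?d i x)"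
  have "\<exists>h. \<forall>i. ?P i (h i) \<and> ?Q i (h i) (h (Suc i))"
  proof (rule dependent_nat_choice)
    have "?d 0 (?t (Suc 0) x - ?h 0 (\<lambda>_ _. 0) (?d 0 x)) = 0" if x: "x \<in> free_mod n (r (Suc 0))" for x
      using comm[OF x] \<theta>0 resolves_difl_in_free_mod[OF res x] unfolding r0 by simp
    moreover have "graded_mat n (r (Suc 0)) (r 0) (a (Suc 0)) (a 0) (\<lambda>_ _. 0)"
      by (auto simp: graded_mat_def)
    ultimately show "\<exists>M. ?P 0 M" by blast
  next
    fix M i assume M: "?P i M"
    let ?M = "\<lambda>k l. \<theta> (Suc i) k l - mat_mult (r i) M (D i) k l"
    have Mx: "mat_app (r (Suc i)) (r (Suc i)) ?M x = ?t (Suc i) x - ?h i M (?d i x)" for x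
      unfolding mat_app_matrix_diff mat_app_mat_mult ..
    have gM: "graded_mat n (r (Suc i)) (r (Suc i)) (a (Suc i)) (a (Suc i)) ?M"
      using M graded_resolves_difl[OF F] by (intro graded_mat_diff \<theta>) (blast intro: graded_mat_mult)
    have "\<exists>N. graded_mat n (r (Suc (Suc i))) (r (Suc i)) (a (Suc (Suc i))) (a (Suc i)) N \<and>
      (\<forall>x. ?d (Suc i) (?h (Suc i) N x) = mat_app (r (Suc i)) (r (Suc i)) ?M x)"
    proof (rule graded_lift)
      show "graded_mat n (r (Suc i)) (r (Suc (Suc i))) (a (Suc i)) (a (Suc (Suc i))) (D (Suc i))"
        by (rule graded_resolves_difl[OF F])
      show "graded_mat n (r (Suc i)) (r (Suc i)) (a (Suc i)) (a (Suc i)) ?M" by (rule gM)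
      fix x :: "nat \<Rightarrow> 'k mpoly" assume x: "x \<in> free_mod n (r (Suc i))"
      then have "?d i (mat_app (r (Suc i)) (r (Suc i)) ?M x) = 0" unfolding Mx using M by blast
      then show "\<exists>y\<in>free_mod n (r (Suc (Suc i))). ?d (Suc i) y = mat_app (r (Suc i)) (r (Suc i)) ?M x"
        by (rule resolves_exact_ex[OF res graded_mat_app_in_free_mod[OF gM x]])
    qed
    then obtain N where N: "graded_mat n (r (Suc (Suc i))) (r (Suc i)) (a (Suc (Suc i))) (a (Suc i)) N"
      "\<And>x. ?d (Suc i) (?h (Suc i) N x) = mat_app (r (Suc i)) (r (Suc i)) ?M x"
      by blast
    have 1: "?d (Suc i) (?t (Suc (Suc i)) x - ?h (Suc i) N (?d (Suc i) x)) = 0"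
      if x: "x \<in> free_mod n (r (Suc (Suc i)))" for x
      unfolding mat_app_diff N(2) Mx comm[OF x] resolves_difl_difl[OF res x] by simp
    have 2: "?t (Suc i) x = ?d (Suc i) (?h (Suc i) N x) + ?h i M (?d i x)" for x
      unfolding N(2) Mx by simp
    show "\<exists>M'. ?P (Suc i) M' \<and> ?Q i M M'"
      by (intro exI[of _ N] conjI ballI allI N(1) 1 2) auto
  qed
  then obtain h where "\<forall>i. ?P i (h i) \<and> ?Q i (h i) (h (Suc i))" ..
  note h = spec[OF this]
  show ?thesis
    by (intro exI[of _ h] conjI allI)
      (rule conjunct1[OF conjunct1[OF h]] mp[OF conjunct2[OF conjunct2[OF conjunct1[OF h]]] refl]
        spec[OF conjunct2[OF h]])+
qed


section \<open>Reduction modulo the maximal ideal\<close>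

definition const_vec :: "(nat \<Rightarrow> 'k::field mpoly) \<Rightarrow> nat \<Rightarrow> 'k"
  where "const_vec x = (\<lambda>k. Poly_Mapping.lookup (x k) 0)"

definition const_mat :: "(nat \<Rightarrow> nat \<Rightarrow> 'k::field mpoly) \<Rightarrow> nat \<Rightarrow> nat \<Rightarrow> 'k"
  where "const_mat M = (\<lambda>k l. Poly_Mapping.lookup (M k l) 0)"

definition embed_vec :: "(nat \<Rightarrow> 'k::field) \<Rightarrow> nat \<Rightarrow> 'k mpoly"
  where "embed_vec c = (\<lambda>k. Poly_Mapping.single 0 (c k))"

definition degree_comp :: "nat \<Rightarrow> (nat \<Rightarrow> int) \<Rightarrow> int \<Rightarrow> (nat \<Rightarrow> 'k::field) set"
  where "degree_comp r a j = {c. \<forall>k. c k \<noteq> 0 \<longrightarrow> k < r \<and> a k = j}"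

lemma const_embed_vec [simp]: "const_vec (embed_vec c) = c"
  by (simp add: const_vec_def embed_vec_def)

lemma const_vec_add: "const_vec (x + y) = const_vec x + const_vec y"
  by (simp add: const_vec_def lookup_add fun_eq_iff)

lemma const_vec_diff: "const_vec (x - y) = const_vec x - const_vec y"
  by (simp add: const_vec_def lookup_minus fun_eq_iff)

lemma const_vec_mat_app: "const_vec (mat_app s r M x) = mat_app s r (const_mat M) (const_vec x)"
  by (auto simp: const_vec_def const_mat_def mat_app_def lookup_sum lookup_mult_0 fun_eq_iff)

lemma embed_vec_in_free_mod: "c \<in> degree_comp r a j \<Longrightarrow> embed_vec c \<in> free_mod n r"
  unfolding free_mod_def
proof (intro CollectI conjI allI impI)
  assume c: "c \<in> degree_comp r a j"
  show "embed_vec c k \<in> polys n" for k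
    unfolding embed_vec_def by (rule single_in_polys) (simp add: monoms_def)
  show "embed_vec c k = 0" if "k \<ge> r" for k
  proof -
    have "c k = 0" using c that by (metis (mono_tags, lifting) degree_comp_def leD mem_Collect_eq)
    then show ?thesis by (simp add: embed_vec_def)
  qed
qed

text \<open>An entry with nonzero constant term is homogeneous of degree 0, so it connects basis
  elements of equal degree.\<close>

lemma const_mat_degree_comp:
  assumes M: "graded_mat n s r b a M" and c: "c \<in> degree_comp r a j"
  shows "mat_app s r (const_mat M) c \<in> degree_comp s b j"
proof -
  have "b k = j" if k: "k < s" and nz: "(\<Sum>l<r. const_mat M k l * c l) \<noteq> 0" for k
  proof -
    obtain l where l: "l < r" "const_mat M k l \<noteq> 0" "c l \<noteq> 0"
      using sum.not_neutral_contains_not_neutral[OF nz] by auto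
    have "a l - b k = 0"
      using lookup_0_homogeneous[of "a l - b k" "M k l"] M l k by (auto simp: graded_mat_def const_mat_def)
    with l(3) c show ?thesis by (auto simp: degree_comp_def)
  qed
  then show ?thesis by (auto simp: degree_comp_def mat_app_def split: if_splits)
qed

text \<open>With the indexing of \<open>resolves\<close>, this says \<open>Tor\<^sub>i(K, J)\<^sub>j = 0\<close>; there is no condition on the
  cycles for \<open>i = 0\<close>.\<close>

definition tor_vanishes :: "(nat \<Rightarrow> nat) \<Rightarrow> (nat \<Rightarrow> nat \<Rightarrow> int) \<Rightarrow> (nat \<Rightarrow> nat \<Rightarrow> nat \<Rightarrow> 'k::field mpoly)
    \<Rightarrow> nat \<Rightarrow> int \<Rightarrow> bool"
  where "tor_vanishes r a D i j \<longleftrightarrow> (\<forall>c\<in>degree_comp (r (Suc i)) (a (Suc i)) j.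
    (i \<noteq> 0 \<longrightarrow> mat_app (r i) (r (Suc i)) (const_mat (D i)) c = 0) \<longrightarrow>
    c \<in> mat_app (r (Suc i)) (r (Suc (Suc i))) (const_mat (D (Suc i))) `
      degree_comp (r (Suc (Suc i))) (a (Suc (Suc i))) j)"

text \<open>Take chain maps \<open>\<phi>\<close> and \<open>\<psi>\<close> between the resolutions
  and a homotopy \<open>h\<close> between \<open>\<psi> \<phi>\<close> and the identity. After
  reduction, a cycle \<open>c\<close> is \<open>\<psi> \<phi> c\<close> plus the boundary of
  \<open>h c\<close>, and \<open>\<phi> c\<close> is a boundary by assumption. All maps preserve the
  internal degree \<open>j\<close>.\<close>

lemma tor_vanishes_transfer:
  assumes F: "graded_resolves n J r a D" and G: "graded_resolves n J r' a' D'"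
    and van: "tor_vanishes r' a' D' i j"
  shows "tor_vanishes r a D i j"
proof -
  let ?d = "\<lambda>i. mat_app (r i) (r (Suc i)) (D i)" and ?d' = "\<lambda>i. mat_app (r' i) (r' (Suc i)) (D' i)"
  let ?b = "\<lambda>i. mat_app (r i) (r (Suc i)) (const_mat (D i))"
    and ?b' = "\<lambda>i. mat_app (r' i) (r' (Suc i)) (const_mat (D' i))"
  have r0: "r 0 = 1" "r' 0 = 1" using F G by (auto simp: graded_resolves_def resolves_def)
  obtain \<phi> where \<phi>: "\<And>i. graded_mat n (r' i) (r i) (a' i) (a i) (\<phi> i)"
    "\<And>x. x \<in> free_mod n 1 \<Longrightarrow> mat_app 1 1 (\<phi> 0) x = x"
    "\<And>i x. ?d' i (mat_app (r' (Suc i)) (r (Suc i)) (\<phi> (Suc i)) x) = mat_app (r' i) (r i) (\<phi> i) (?d i x)"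
    using chain_map_exists[OF F G] by blast
  obtain \<psi> where \<psi>: "\<And>i. graded_mat n (r i) (r' i) (a i) (a' i) (\<psi> i)"
    "\<And>x. x \<in> free_mod n 1 \<Longrightarrow> mat_app 1 1 (\<psi> 0) x = x"
    "\<And>i x. ?d i (mat_app (r (Suc i)) (r' (Suc i)) (\<psi> (Suc i)) x) = mat_app (r i) (r' i) (\<psi> i) (?d' i x)"
    using chain_map_exists[OF G F] by blast
  define \<theta> where "\<theta> i = (\<lambda>k l. (if k = l then 1 else 0) - mat_mult (r' i) (\<psi> i) (\<phi> i) k l)" for i
  have \<theta>_app: "mat_app (r i) (r i) (\<theta> i) x
      = x - mat_app (r i) (r' i) (\<psi> i) (mat_app (r' i) (r i) (\<phi> i) x)" if "x \<in> free_mod n (r i)" for i x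
    unfolding \<theta>_def mat_app_matrix_diff mat_app_mat_mult mat_app_scalar[OF that] by simp
  have d_free: "?d i x \<in> free_mod n (r i)" if "x \<in> free_mod n (r (Suc i))" for i x
    using graded_resolves_difl[OF F] that by (rule graded_mat_app_in_free_mod)
  have "\<exists>h. (\<forall>i. graded_mat n (r (Suc i)) (r i) (a (Suc i)) (a i) (h i)) \<and> h 0 = (\<lambda>_ _. 0) \<and>
    (\<forall>i x. mat_app (r (Suc i)) (r (Suc i)) (\<theta> (Suc i)) x =
      ?d (Suc i) (mat_app (r (Suc (Suc i))) (r (Suc i)) (h (Suc i)) x) + mat_app (r (Suc i)) (r i) (h i) (?d i x))"
  proof (rule null_homotopy_exists[OF F, where \<theta> = \<theta>])
    have "graded_mat n (r i) (r i) (a i) (a i) (\<lambda>k l. if k = l then 1 else 0)" for i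
      by (auto simp: graded_mat_def)
    then show "graded_mat n (r i) (r i) (a i) (a i) (\<theta> i)" for i
      unfolding \<theta>_def by (rule graded_mat_diff[OF _ graded_mat_mult[OF \<psi>(1) \<phi>(1)]])
    show "mat_app 1 1 (\<theta> 0) x = 0" if "x \<in> free_mod n 1" for x
      using \<theta>_app[of x 0] \<phi>(2)[OF that] \<psi>(2)[OF that] that unfolding r0 by simp
    show "?d i (mat_app (r (Suc i)) (r (Suc i)) (\<theta> (Suc i)) x) = mat_app (r i) (r i) (\<theta> i) (?d i x)"
      if x: "x \<in> free_mod n (r (Suc i))" for i x
      unfolding \<theta>_app[OF x] \<theta>_app[OF d_free[OF x]] mat_app_diff \<psi>(3) \<phi>(3) ..
  qed
  then obtain h where h: "\<And>i. graded_mat n (r (Suc i)) (r i) (a (Suc i)) (a i) (h i)" "h 0 = (\<lambda>_ _. 0)"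
    "\<And>i x. mat_app (r (Suc i)) (r (Suc i)) (\<theta> (Suc i)) x =
      ?d (Suc i) (mat_app (r (Suc (Suc i))) (r (Suc i)) (h (Suc i)) x) + mat_app (r (Suc i)) (r i) (h i) (?d i x)"
    by blast
  show ?thesis
    unfolding tor_vanishes_def
  proof (intro ballI impI)
    fix c :: "nat \<Rightarrow> 'a" assume c: "c \<in> degree_comp (r (Suc i)) (a (Suc i)) j"
      and cyc: "i \<noteq> 0 \<longrightarrow> ?b i c = 0"
    \<comment> \<open>The identities hold over A; they are evaluated at the constant lift of
      \<open>c\<close> and then reduced by taking constant terms.\<close>
    let ?e = "embed_vec c"
    have e: "?e \<in> free_mod n (r (Suc i))" using c by (rule embed_vec_in_free_mod)
    define c' where "c' = mat_app (r' (Suc i)) (r (Suc i)) (const_mat (\<phi> (Suc i))) c"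
    have "?b' i c' = mat_app (r' i) (r i) (const_mat (\<phi> i)) (?b i c)"
      using arg_cong[OF \<phi>(3)[of i ?e], of const_vec] by (simp add: const_vec_mat_app c'_def)
    then have "i \<noteq> 0 \<longrightarrow> ?b' i c' = 0" using cyc by simp
    moreover have "c' \<in> degree_comp (r' (Suc i)) (a' (Suc i)) j"
      unfolding c'_def using \<phi>(1) c by (rule const_mat_degree_comp)
    ultimately obtain e' where e': "e' \<in> degree_comp (r' (Suc (Suc i))) (a' (Suc (Suc i))) j" "c' = ?b' (Suc i) e'"
      using van unfolding tor_vanishes_def by blast
    define f where "f = mat_app (r (Suc (Suc i))) (r' (Suc (Suc i))) (const_mat (\<psi> (Suc (Suc i)))) e'"
    define g where "g = mat_app (r (Suc (Suc i))) (r (Suc i)) (const_mat (h (Suc i))) c"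
    have f: "f \<in> degree_comp (r (Suc (Suc i))) (a (Suc (Suc i))) j"
      unfolding f_def using \<psi>(1) e'(1) by (rule const_mat_degree_comp)
    have g: "g \<in> degree_comp (r (Suc (Suc i))) (a (Suc (Suc i))) j"
      unfolding g_def using h(1) c by (rule const_mat_degree_comp)
    have "?b (Suc i) f = mat_app (r (Suc i)) (r' (Suc i)) (const_mat (\<psi> (Suc i))) c'"
      using arg_cong[OF \<psi>(3)[of "Suc i" "embed_vec e'"], of const_vec]
      by (simp add: const_vec_mat_app f_def e'(2))
    moreover have "c - mat_app (r (Suc i)) (r' (Suc i)) (const_mat (\<psi> (Suc i))) c'
        = ?b (Suc i) g + mat_app (r (Suc i)) (r i) (const_mat (h i)) (?b i c)"
      using arg_cong[OF h(3)[of i ?e], of const_vec]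
      unfolding \<theta>_app[OF e] by (simp add: const_vec_mat_app const_vec_add const_vec_diff g_def c'_def)
    \<comment> \<open>For \<open>i = 0\<close> there is no cycle condition on \<open>c\<close>; the
      term vanishes because the homotopy starts with zero.\<close>
    moreover have "mat_app (r (Suc i)) (r i) (const_mat (h i)) (?b i c) = 0"
    proof (cases "i = 0")
      case True
      then have "const_mat (h i) = (\<lambda>_ _. 0)" using h(2) by (simp add: const_mat_def)
      then show ?thesis by simp
    qed (use cyc in simp)
    ultimately have "c = ?b (Suc i) (f + g)"
      unfolding mat_app_add by (simp add: algebra_simps)
    moreover have "f + g \<in> degree_comp (r (Suc (Suc i))) (a (Suc (Suc i))) j"
      using f g unfolding degree_comp_def by force
    ultimately show "c \<in> ?b (Suc i) ` degree_comp (r (Suc (Suc i))) (a (Suc (Suc i))) j" by blast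
  qed
qed

lemma tor_vanishes_minimal:
  assumes "minimal_difl r D"
  shows "tor_vanishes r a D i j \<longleftrightarrow> \<not> (\<exists>k < r (Suc i). a (Suc i) k = j)"
proof -
  have z: "mat_app (r i) (r (Suc i)) (const_mat (D i)) c = 0" for i c
    using assms by (auto simp: mat_app_def const_mat_def minimal_difl_def fun_eq_iff)
  have "tor_vanishes r a D i j \<longleftrightarrow> (\<forall>c\<in>degree_comp (r (Suc i)) (a (Suc i)) j. c = (0 :: nat \<Rightarrow> 'a))"
  proof -
    have "(0 :: nat \<Rightarrow> 'a) \<in> degree_comp (r (Suc (Suc i))) (a (Suc (Suc i))) j" by (auto simp: degree_comp_def)
    then show ?thesis unfolding tor_vanishes_def z by auto
  qed
  also have "\<dots> \<longleftrightarrow> \<not> (\<exists>k < r (Suc i). a (Suc i) k = j)"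
  proof
    assume L: "\<forall>c\<in>degree_comp (r (Suc i)) (a (Suc i)) j. c = (0 :: nat \<Rightarrow> 'a)"
    show "\<not> (\<exists>k < r (Suc i). a (Suc i) k = j)"
    proof
      assume "\<exists>k < r (Suc i). a (Suc i) k = j"
      then obtain k where "k < r (Suc i)" "a (Suc i) k = j" by blast
      then have "(\<lambda>l. if l = k then 1 else 0 :: 'a) \<in> degree_comp (r (Suc i)) (a (Suc i)) j"
        by (auto simp: degree_comp_def)
      with L have "(\<lambda>l. if l = k then 1 else 0 :: 'a) = 0" by blast
      from fun_cong[OF this, of k] show False by simp
    qed
  qed (auto simp: degree_comp_def fun_eq_iff)
  finally show ?thesis .
qed


section \<open>Betti numbers\<close>

text \<open>A basis of \<open>B\<close> extends to one of \<open>Z\<close>, and both are finite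
  because vectors of \<open>Z\<close> live on the first \<open>m\<close> coordinates. The truncated
  difference of dimensions is then zero only if the two bases agree.\<close>

lemma fun_dim_diff_nonzero_iff:
  fixes B Z :: "(nat \<Rightarrow> 'k::field) set"
  assumes "B \<subseteq> Z" and Z: "\<And>c k. c \<in> Z \<Longrightarrow> k \<ge> m \<Longrightarrow> c k = 0"
    and B0: "0 \<in> B" "\<And>x y. x \<in> B \<Longrightarrow> y \<in> B \<Longrightarrow> x + y \<in> B" "\<And>c x. x \<in> B \<Longrightarrow> (\<lambda>k. c * x k) \<in> B"
  shows "fun_dim Z - fun_dim B \<noteq> 0 \<longleftrightarrow> \<not> Z \<subseteq> B"
proof -
  interpret V: vector_space "\<lambda>(a::'k) (c::nat \<Rightarrow> 'k) k. a * c k" by (rule vector_space_fun)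
  define T where "T = (\<lambda>l k. if k = l then 1 else 0 :: 'k) ` {..<m}"
  have "Z \<subseteq> V.span T"
  proof
    fix c assume c: "c \<in> Z"
    have c_eq: "c = (\<Sum>l<m. (\<lambda>k. c l * (if k = l then 1 else 0)))"
    proof
      fix k
      have "(\<Sum>l<m. (\<lambda>k. c l * (if k = l then 1 else 0))) k = (\<Sum>l<m. c l * (if k = l then 1 else 0))"
        by (induction m) auto
      also have "\<dots> = c k"
        using Z[OF c, of k] by (auto simp: if_distrib[of "\<lambda>x. _ * x"] sum.delta cong: if_cong)
      finally show "c k = (\<Sum>l<m. (\<lambda>k. c l * (if k = l then 1 else 0))) k" ..
    qed
    have span: "(\<lambda>k. c l * (if k = l then 1 else 0)) \<in> V.span T" if "l < m" for l
      using that by (intro V.span_scale V.span_base) (auto simp: T_def)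
    have "(\<Sum>l<m. (\<lambda>k. c l * (if k = l then 1 else 0))) \<in> V.span T"
      by (intro V.span_sum span) simp
    then show "c \<in> V.span T" by (subst c_eq)
  qed
  obtain b where b: "b \<subseteq> B" "V.independent b" "B \<subseteq> V.span b" "card b = V.dim B"
    by (rule V.basis_exists)
  obtain b' where b': "b \<subseteq> b'" "b' \<subseteq> Z" "V.independent b'" "Z \<subseteq> V.span b'"
    using V.maximal_independent_subset_extend[of b Z] b assms(1) by blast
  have fin: "finite b'"
    using V.independent_span_bound[of T b'] b'(2,3) \<open>Z \<subseteq> V.span T\<close> by (auto simp: T_def)
  have dZ: "V.dim Z = card b'" using b' by (intro V.dim_unique) auto
  have sB: "V.span b \<subseteq> B" using b(1) B0 by (intro V.span_minimal V.subspaceI) auto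
  have "card b' - card b \<noteq> 0 \<longleftrightarrow> b \<noteq> b'"
    using fin b'(1) by (metis card_mono card_subset_eq diff_is_0_eq le_antisym diff_self_eq_0)
  also have "\<dots> \<longleftrightarrow> \<not> Z \<subseteq> B"
  proof
    assume "b \<noteq> b'"
    then obtain x where x: "x \<in> b'" "x \<notin> b" using b'(1) by blast
    have "x \<notin> V.span b"
    proof
      assume "x \<in> V.span b"
      moreover have "V.span b \<subseteq> V.span (b' - {x})" using x b'(1) by (intro V.span_mono) auto
      ultimately show False using b'(3) x(1) unfolding V.dependent_def by blast
    qed
    then have "x \<notin> B" using b(3) by blast
    with x(1) b'(2) show "\<not> Z \<subseteq> B" by blast
  next
    assume "\<not> Z \<subseteq> B"
    then show "b \<noteq> b'" using b'(4) sB by blast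
  qed
  finally show ?thesis unfolding fun_dim_def dZ b(4)[symmetric] .
qed

text \<open>Putting A in front, with the augmentation as first matrix, turns a resolution of the
  ideal into one of the quotient. One notion asks for \<open>augm F k\<close> to lie in
  \<open>I\<close>, the other for it to lie in A; both follow from the condition on the
  image.\<close>

lemma graded_free_resolution_iff:
  assumes "I \<subseteq> polys n"
  shows "graded_free_resolution n I F \<longleftrightarrow> graded_resolves n I (case_nat 1 (rnk F))
    (case_nat (\<lambda>_. 0) (shft F)) (case_nat (\<lambda>_. augm F) (difl F))"
proof -
  let ?r = "case_nat 1 (rnk F)" and ?D = "case_nat (\<lambda>_. augm F) (difl F)" and ?a = "case_nat (\<lambda>_. 0) (shft F)"
  have aug: "mat_app 1 (rnk F 0) (\<lambda>_. augm F) x = (\<lambda>k. if k = 0 then augm_map F x else 0)" for x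
    by (auto simp: mat_app_def augm_map_def fun_eq_iff)
  have aug0: "mat_app 1 (rnk F 0) (\<lambda>_. augm F) x = (\<lambda>_. 0) \<longleftrightarrow> augm_map F x = 0" for x
    unfolding aug by (auto simp: fun_eq_iff)
  have all_nat: "(\<forall>i. P i) \<longleftrightarrow> P 0 \<and> (\<forall>i. P (Suc i))" for P
    by (metis nat.exhaust)
  have auI: "augm F l \<in> I" if "l < rnk F 0" "augm_map F ` free_mod n (rnk F 0) = I" for l
  proof -
    have "augm_map F (\<lambda>j. if j = l then 1 else 0) = augm F l"
      using that(1) by (auto simp: augm_map_def if_distrib[of "\<lambda>x. _ * x"] sum.delta' cong: if_cong)
    then show ?thesis using that unit_in_free_mod by (metis image_eqI)
  qed
  have 1: "resolves n I ?r ?D \<longleftrightarrow> (\<forall>l < rnk F 0. augm F l \<in> polys n) \<and>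
    (\<forall>i. \<forall>k < rnk F i. \<forall>l < rnk F (Suc i). difl F i k l \<in> polys n) \<and>
    augm_map F ` free_mod n (rnk F 0) = I \<and>
    {x \<in> free_mod n (rnk F 0). augm_map F x = 0} = difl_map F 0 ` free_mod n (rnk F 1) \<and>
    (\<forall>i. {x \<in> free_mod n (rnk F (Suc i)). difl_map F i x = (\<lambda>_. 0)} =
         difl_map F (Suc i) ` free_mod n (rnk F (Suc (Suc i))))"
  proof -
    have ent: "(\<forall>i. \<forall>k < ?r i. \<forall>l < ?r (Suc i). ?D i k l \<in> polys n) \<longleftrightarrow> (\<forall>l < rnk F 0. augm F l \<in> polys n) \<and>
        (\<forall>i. \<forall>k < rnk F i. \<forall>l < rnk F (Suc i). difl F i k l \<in> polys n)"
      by (subst all_nat) simp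
    have ker: "(\<forall>i. {x \<in> free_mod n (?r (Suc i)). mat_app (?r i) (?r (Suc i)) (?D i) x = (\<lambda>_. 0)} =
          mat_app (?r (Suc i)) (?r (Suc (Suc i))) (?D (Suc i)) ` free_mod n (?r (Suc (Suc i)))) \<longleftrightarrow>
        {x \<in> free_mod n (rnk F 0). augm_map F x = 0} = difl_map F 0 ` free_mod n (rnk F 1) \<and>
        (\<forall>i. {x \<in> free_mod n (rnk F (Suc i)). difl_map F i x = (\<lambda>_. 0)} =
         difl_map F (Suc i) ` free_mod n (rnk F (Suc (Suc i))))"
      unfolding difl_map_def by (subst all_nat) (simp add: aug0[simplified])
    have img: "(\<lambda>x. mat_app (?r 0) (?r 1) (?D 0) x 0) ` free_mod n (?r 1) = augm_map F ` free_mod n (rnk F 0)"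
      using aug by simp
    have r0: "?r 0 = 1" by simp
    show ?thesis unfolding resolves_def ent ker img by (simp only: r0 simp_thms conj_assoc)
  qed
  have 2: "graded_difl ?r ?a ?D \<longleftrightarrow> (\<forall>l < rnk F 0. homogeneous (shft F 0 l) (augm F l)) \<and>
    (\<forall>i. \<forall>k < rnk F i. \<forall>l < rnk F (Suc i). homogeneous (shft F (Suc i) l - shft F i k) (difl F i k l))"
    unfolding graded_difl_def by (subst (1) all_nat) simp
  have merge: "(\<forall>l<m. P l \<and> H l) \<and> (\<forall>i. \<forall>k<r i. \<forall>l<r (Suc i). E i k l \<and> H' i k l) \<and> C \<and> Q \<longleftrightarrow>
    ((\<forall>l<m. P' l) \<and> (\<forall>i. \<forall>k<r i. \<forall>l<r (Suc i). E i k l) \<and> C \<and> Q) \<and>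
    (\<forall>l<m. H l) \<and> (\<forall>i. \<forall>k<r i. \<forall>l<r (Suc i). H' i k l)"
    if "\<And>l. l < m \<Longrightarrow> C \<Longrightarrow> P l" "\<And>l. l < m \<Longrightarrow> C \<Longrightarrow> P' l"
    for m :: nat and P P' H C Q E H' and r :: "nat \<Rightarrow> nat"
    using that by blast
  show ?thesis
    unfolding graded_resolves_def 1 2 graded_free_resolution_def
  proof (rule merge)
    fix l assume l: "l < rnk F 0" "augm_map F ` free_mod n (rnk F 0) = I"
    show "augm F l \<in> I" using auI[OF l] .
    then show "augm F l \<in> polys n" using assms by blast
  qed
qed

lemma graded_resolves_cong:
  assumes "graded_resolves n J r a D"
    and D: "\<And>i k l. k < r i \<Longrightarrow> D i k l = D' i k l" and a: "\<And>i k. k < r i \<Longrightarrow> a i k = a' i k"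
  shows "graded_resolves n J r a' D'"
proof -
  have m: "mat_app (r i) s (D' i) x = mat_app (r i) s (D i) x" for i s x
    using D by (intro mat_app_cong) auto
  have "r 0 = 1" using assms(1) by (auto simp: graded_resolves_def resolves_def)
  then have "a' 0 0 = 0" using a[of 0 0] assms(1) by (simp add: graded_resolves_def graded_difl_def)
  then have "graded_difl r a' D'"
    using assms(1) by (simp add: graded_resolves_def graded_difl_def D[symmetric] a[symmetric])
  moreover have "\<forall>i. \<forall>k < r i. \<forall>l < r (Suc i). D' i k l \<in> polys n"
    using assms(1) by (simp add: graded_resolves_def resolves_def D[symmetric])
  then have "resolves n J r D'"
    using assms(1) unfolding graded_resolves_def resolves_def m by (intro conjI) (elim conjE, assumption)+
  ultimately show ?thesis by (simp add: graded_resolves_def)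
qed

text \<open>The given complex witnesses that the choice inside \<open>betti\<close> yields some
  graded resolution. The two are compared through \<open>tor_vanishes\<close>, which for a minimal
  complex only asks whether a basis element of the right degree exists.\<close>

theorem betti_nonzero_iff:
  fixes I :: "'k::field mpoly set"
  assumes I: "I \<subseteq> polys n" and G: "graded_resolves n I r a D" and min: "minimal_difl r D"
  shows "betti n I i j \<noteq> 0 \<longleftrightarrow> (\<exists>k < r (Suc i). a (Suc i) k = j)"
proof -
  define F where "F = (SOME F. graded_free_resolution n I F)"
  let ?F = "\<lparr>rnk = \<lambda>i. r (Suc i), shft = \<lambda>i. a (Suc i), augm = D 0 0, difl = \<lambda>i. D (Suc i)\<rparr>"
  have r0: "r 0 = 1" using G by (auto simp: graded_resolves_def resolves_def)
  have "graded_resolves n I (case_nat 1 (rnk ?F)) (case_nat (\<lambda>_. 0) (shft ?F)) (case_nat (\<lambda>_. augm ?F) (difl ?F))"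
  proof -
    have r: "case_nat 1 (rnk ?F) = r" using r0 by (auto simp: fun_eq_iff split: nat.split)
    show ?thesis
      unfolding r using G
    proof (rule graded_resolves_cong)
      show "D i k l = case_nat (\<lambda>_. augm ?F) (difl ?F) i k l" if "k < r i" for i k l
        using that r0 by (cases i) auto
      show "a i k = case_nat (\<lambda>_. 0) (shft ?F) i k" if "k < r i" for i k
        using that r0 G by (cases i) (auto simp: graded_resolves_def graded_difl_def)
    qed
  qed
  then have "graded_free_resolution n I ?F" unfolding graded_free_resolution_iff[OF I] .
  then have "graded_free_resolution n I F" unfolding F_def by (rule someI)
  note F = this[unfolded graded_free_resolution_iff[OF I]]
  let ?r = "case_nat 1 (rnk F)" and ?D = "case_nat (\<lambda>_. augm F) (difl F)" and ?a = "case_nat (\<lambda>_. 0) (shft F)"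
  define Z B where "Z = tor_cycles F i j" and "B = tor_boundaries F i j"
  have comp: "tensor_comp F i j = degree_comp (?r (Suc i)) (?a (Suc i)) j" for i
    by (simp add: tensor_comp_def degree_comp_def)
  have td: "tensor_difl F i = mat_app (?r (Suc i)) (?r (Suc (Suc i))) (const_mat (?D (Suc i)))" for i
    by (simp add: tensor_difl_def const_mat_def)
  have Zeq: "Z = {c \<in> degree_comp (?r (Suc i)) (?a (Suc i)) j.
      i \<noteq> 0 \<longrightarrow> mat_app (?r i) (?r (Suc i)) (const_mat (?D i)) c = 0}"
    unfolding Z_def tor_cycles_def comp td by (cases i) (auto simp: zero_fun_def)
  have Beq: "B = mat_app (?r (Suc i)) (?r (Suc (Suc i))) (const_mat (?D (Suc i))) `
      degree_comp (?r (Suc (Suc i))) (?a (Suc (Suc i))) j"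
    unfolding B_def tor_boundaries_def comp td ..
  have BZ: "B \<subseteq> Z"
  proof
    fix c assume "c \<in> B"
    then obtain e where e: "e \<in> degree_comp (?r (Suc (Suc i))) (?a (Suc (Suc i))) j"
      and c: "c = mat_app (?r (Suc i)) (?r (Suc (Suc i))) (const_mat (?D (Suc i))) e"
      unfolding Beq by blast
    have "c \<in> degree_comp (?r (Suc i)) (?a (Suc i)) j"
      unfolding c using graded_resolves_difl[OF F] e by (rule const_mat_degree_comp)
    moreover have "mat_app (?r i) (?r (Suc i)) (const_mat (?D i)) c = 0"
    proof -
      have "resolves n I ?r ?D" using F by (simp add: graded_resolves_def)
      from resolves_difl_difl[OF this embed_vec_in_free_mod[OF e]]
      have "const_vec (mat_app (?r i) (?r (Suc i)) (?D i)
          (mat_app (?r (Suc i)) (?r (Suc (Suc i))) (?D (Suc i)) (embed_vec e))) = const_vec 0"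
        by (rule arg_cong)
      also have "const_vec 0 = (0 :: nat \<Rightarrow> 'k)" by (simp add: const_vec_def fun_eq_iff)
      finally show ?thesis unfolding const_vec_mat_app const_embed_vec c .
    qed
    ultimately show "c \<in> Z" unfolding Zeq by blast
  qed
  have "betti n I i j \<noteq> 0 \<longleftrightarrow> fun_dim Z - fun_dim B \<noteq> 0"
    by (simp add: betti_def F_def Z_def B_def Let_def)
  also have "\<dots> \<longleftrightarrow> \<not> Z \<subseteq> B"
  proof (rule fun_dim_diff_nonzero_iff[OF BZ])
    show "c k = 0" if "c \<in> Z" "k \<ge> ?r (Suc i)" for c k
      using that unfolding Zeq degree_comp_def by force
    have z: "(0 :: nat \<Rightarrow> 'k) \<in> degree_comp r a j" for r a by (auto simp: degree_comp_def)
    show "0 \<in> B" unfolding Beq by (rule image_eqI[OF _ z]) simp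
    show "x + y \<in> B" if "x \<in> B" "y \<in> B" for x y
    proof -
      from that obtain u v where uv: "u \<in> degree_comp (?r (Suc (Suc i))) (?a (Suc (Suc i))) j"
        "v \<in> degree_comp (?r (Suc (Suc i))) (?a (Suc (Suc i))) j"
        "x + y = mat_app (?r (Suc i)) (?r (Suc (Suc i))) (const_mat (?D (Suc i))) (u + v)"
        unfolding Beq mat_app_add by blast
      have "u + v \<in> degree_comp (?r (Suc (Suc i))) (?a (Suc (Suc i))) j"
        using uv(1,2) unfolding degree_comp_def by force
      with uv(3) show ?thesis unfolding Beq by blast
    qed
    show "(\<lambda>k. c * x k) \<in> B" if "x \<in> B" for c x
    proof -
      from that obtain u where u: "u \<in> degree_comp (?r (Suc (Suc i))) (?a (Suc (Suc i))) j"
        "(\<lambda>k. c * x k) = mat_app (?r (Suc i)) (?r (Suc (Suc i))) (const_mat (?D (Suc i))) (\<lambda>k. c * u k)"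
        unfolding Beq mat_app_smult by blast
      have "(\<lambda>k. c * u k) \<in> degree_comp (?r (Suc (Suc i))) (?a (Suc (Suc i))) j"
        using u(1) unfolding degree_comp_def by force
      with u(2) show ?thesis unfolding Beq by blast
    qed
  qed
  also have "\<dots> \<longleftrightarrow> \<not> tor_vanishes ?r ?a ?D i j"
    unfolding tor_vanishes_def Zeq Beq by blast
  also have "\<dots> \<longleftrightarrow> \<not> tor_vanishes r a D i j"
    using tor_vanishes_transfer[OF F G] tor_vanishes_transfer[OF G F] by blast
  finally show ?thesis unfolding tor_vanishes_minimal[OF min] by blast
qed


section \<open>Resolutions of iterated ideals\<close>

text \<open>The universal squarefree lexsegment ideals arise from a principal ideal \<open>(X\<^sub>b)\<close> by adding or
  multiplying with new variables; \<open>A\<close> collects \<open>b\<close> and the added variables, \<open>R\<close> the factors.\<close>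

inductive stair :: "nat \<Rightarrow> nat set \<Rightarrow> nat set \<Rightarrow> nat set set \<Rightarrow> bool" where
  base: "stair b {b} {} {{b}}"
| add: "stair b A R G \<Longrightarrow> x \<notin> A \<union> R \<Longrightarrow> stair b (insert x A) R (insert {x} G)"
| mul: "stair b A R G \<Longrightarrow> x \<notin> A \<union> R \<Longrightarrow> stair b A (insert x R) (insert x ` G)"

lemma stair_facts:
  assumes "stair b A R G"
  shows "finite A" "finite R" "finite G" "b \<in> A" "A \<inter> R = {}" "\<Union> G \<subseteq> A \<union> R" "{} \<notin> G" "G \<noteq> {}"
    "\<And>g. g \<in> G \<Longrightarrow> finite g" "card G = card A"
proof -
  have "finite A \<and> finite R \<and> finite G \<and> b \<in> A \<and> A \<inter> R = {} \<and> \<Union> G \<subseteq> A \<union> R \<and> {} \<notin> G \<and> G \<noteq> {} \<and>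
      (\<forall>g\<in>G. finite g) \<and> card G = card A"
    using assms
  proof (induction rule: stair.induct)
    case (add b A R G x)
    then have "{x} \<notin> G" by auto
    with add show ?case by auto
  next
    case (mul b A R G x)
    then have "x \<notin> g" if "g \<in> G" for g using that by auto
    then have "inj_on (insert x) G" by (intro inj_onI) (metis insert_ident)
    with mul show ?case by (auto simp: card_image)
  qed auto
  then show "finite A" "finite R" "finite G" "b \<in> A" "A \<inter> R = {}" "\<Union> G \<subseteq> A \<union> R" "{} \<notin> G" "G \<noteq> {}"
    "\<And>g. g \<in> G \<Longrightarrow> finite g" "card G = card A" by auto
qed

text \<open>The new generator has degree 1, and no old generator has smaller degree since none is
  the empty set.\<close>

lemma Max_card_add:
  assumes "stair b A R G"
  shows "Max (card ` insert {x} G) = Max (card ` G)"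
proof -
  note st = stair_facts[OF assms]
  obtain g where g: "g \<in> G" using st(8) by blast
  have "1 \<le> card g" using st(7,9) g by (metis One_nat_def Suc_leI card_gt_0_iff)
  also have "\<dots> \<le> Max (card ` G)" using st(3) g by simp
  finally show ?thesis using st(3,8) by simp
qed

lemma Max_card_mul:
  assumes "stair b A R G" "x \<notin> A \<union> R"
  shows "Max (card ` insert x ` G) = Suc (Max (card ` G))"
proof -
  note st = stair_facts[OF assms(1)]
  have "card (insert x g) = Suc (card g)" if "g \<in> G" for g
    using st(6,9) assms(2) that by (intro card_insert_disjoint) auto
  then have "card ` insert x ` G = Suc ` card ` G" by (auto simp: image_iff)
  also have "Max \<dots> = Suc (Max (card ` G))"
    using st(3,8) by (subst mono_Max_commute[of Suc, symmetric]) (auto simp: mono_def)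
  finally show ?thesis .
qed

lemma graded_resolves_cone:
  assumes "graded_resolves n (sqid n G) r a D" "minimal_difl r D" "x \<in> {1..n}" "x \<notin> \<Union> G"
  shows "graded_resolves n (sqid n (insert {x} G)) (cone_rank r) (cone_shift r a 1) (cone_difl r D (X x))"
    "minimal_difl (cone_rank r) (cone_difl r D (X x))"
proof -
  have res: "resolves n (sqid n G) r D" using assms(1) by (simp add: graded_resolves_def)
  have "resolves n (extend n (sqid n G) (X x)) (cone_rank r) (cone_difl r D (X x))"
    using res X_in_polys[OF assms(3)] nonzerodiv_sqid[OF assms(4)] by (rule resolves_cone)
  then have "resolves n (sqid n (insert {x} G)) (cone_rank r) (cone_difl r D (X x))"
    unfolding extend_sqid[OF assms(3)] .
  moreover have "graded_difl (cone_rank r) (cone_shift r a 1) (cone_difl r D (X x))"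
    using assms(1) homogeneous_X resolves_rank_0[OF res]
    by (intro graded_cone) (simp_all add: graded_resolves_def)
  ultimately show "graded_resolves n (sqid n (insert {x} G)) (cone_rank r) (cone_shift r a 1) (cone_difl r D (X x))"
    by (simp add: graded_resolves_def)
  show "minimal_difl (cone_rank r) (cone_difl r D (X x))"
    using assms(2) by (rule minimal_cone) simp
qed

lemma scale_sqid:
  assumes "x \<in> {1..n}" "x \<notin> \<Union> G"
  shows "sqid n (insert x ` G) = (*) (X x) ` (sqid n G :: 'k::field mpoly set)"
proof -
  have "sqid n (insert x ` G) = scale_mod (X x) (sqid n G) (sqid n {} :: 'k mpoly set)"
    using scale_mod_sqid[OF assms, of "{}", where 'k = 'k] by simp
  then show ?thesis by (auto simp: scale_mod_def sqid_empty)
qed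

lemma graded_resolves_scale:
  fixes D :: "nat \<Rightarrow> nat \<Rightarrow> nat \<Rightarrow> 'k::field mpoly"
  assumes G: "graded_resolves n (sqid n G) r a D" and min: "minimal_difl r D"
    and x: "x \<in> {1..n}" "x \<notin> \<Union> G"
  defines "D' \<equiv> D(0 := \<lambda>k l. X x * D 0 k l)"
    and "a' \<equiv> \<lambda>i k. if i = 0 then a i k else a i k + 1"
  shows "graded_resolves n (sqid n (insert x ` G)) r a' D'" "minimal_difl r D'"
proof -
  have "resolves n (sqid n (insert x ` G)) r D'"
    unfolding scale_sqid[OF x] D'_def
    using G X_in_polys[OF x(1)] by (intro resolves_scale) (simp_all add: graded_resolves_def)
  moreover have "homogeneous (a' (Suc i) l - a' i k) (D' i k l)" if "k < r i" "l < r (Suc i)" for i k l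
  proof -
    have h: "homogeneous (a (Suc i) l - a i k) (D i k l)"
      using G that by (simp add: graded_resolves_def graded_difl_def)
    show ?thesis
    proof (cases i)
      case 0
      have "homogeneous (1 + (a (Suc i) l - a i k)) (X x * D i k l)"
        using homogeneous_X h by (rule homogeneous_mult)
      then show ?thesis by (simp add: 0 a'_def D'_def algebra_simps)
    qed (use h in \<open>simp add: a'_def D'_def\<close>)
  qed
  moreover have "a' 0 0 = 0" using G by (simp add: a'_def graded_resolves_def graded_difl_def)
  ultimately show "graded_resolves n (sqid n (insert x ` G)) r a' D'"
    by (simp add: graded_resolves_def graded_difl_def)
  show "minimal_difl r D'"
    using min unfolding minimal_difl_def D'_def by (auto simp: lookup_mult_0)
qed

text \<open>Index \<open>Suc i\<close> is homological degree \<open>i\<close> for the ideal, so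
  \<open>a (Suc i) k - int i\<close> is a value \<open>j - i\<close> entering the regularity. An
  added variable lengthens the resolution by one while a factor leaves the ranks alone; hence the
  length \<open>card A\<close>.\<close>

theorem stair_resolution:
  assumes "stair b A R G" "A \<union> R \<subseteq> {1..n}"
  shows "\<exists>r a (D :: nat \<Rightarrow> nat \<Rightarrow> nat \<Rightarrow> 'k::field mpoly).
    graded_resolves n (sqid n G) r a D \<and> minimal_difl r D \<and>
    0 < r (card A) \<and> (\<forall>i>card A. r i = 0) \<and>
    (\<forall>i. \<forall>k<r (Suc i). a (Suc i) k - int i \<le> int (Max (card ` G))) \<and>
    (\<exists>i. \<exists>k<r (Suc i). a (Suc i) k - int i = int (Max (card ` G)))"
  using assms
proof (induction rule: stair.induct)
  case (base b)
  let ?r = "\<lambda>i::nat. if i = 0 then 1 else 0 :: nat" and ?a = "\<lambda>_ _. 0 :: int"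
    and ?D = "\<lambda>_ _ _. 0 :: 'k mpoly"
  have "graded_resolves n (sqid n {}) ?r ?a ?D"
    using resolves_zero by (simp add: graded_resolves_def graded_difl_def sqid_empty)
  moreover have "minimal_difl ?r ?D" by (simp add: minimal_difl_def)
  ultimately have "graded_resolves n (sqid n {{b}}) (cone_rank ?r) (cone_shift ?r ?a 1) (cone_difl ?r ?D (X b))"
    "minimal_difl (cone_rank ?r) (cone_difl ?r ?D (X b))"
    using graded_resolves_cone[of n "{}" ?r ?a ?D b] base by auto
  moreover have r: "cone_rank ?r (Suc i) = ?r i" for i by (simp add: cone_rank_def)
  moreover have "cone_rank ?r i = 0" if "i > card {b}" for i
    using that by (cases i) (auto simp: r)
  moreover have "cone_shift ?r ?a 1 (Suc i) k - int i = 1" if "k < cone_rank ?r (Suc i)" for i k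
    using that by (auto simp: r cone_shift_def join_def split: if_splits)
  moreover have "Max (card ` {{b}}) = 1" "cone_rank ?r (card {b}) > 0" by (simp_all add: r)
  moreover have "\<exists>i. \<exists>k<cone_rank ?r (Suc i). cone_shift ?r ?a 1 (Suc i) k - int i = 1"
    by (intro exI[of _ 0]) (simp add: r cone_shift_def join_def)
  ultimately show ?case
    by (intro exI[of _ "cone_rank ?r"] exI[of _ "cone_shift ?r ?a 1"] exI[of _ "cone_difl ?r ?D (X b)"]
        conjI allI impI) simp_all
next
  case (add b A R G x)
  note st = stair_facts[OF add.hyps(1)]
  have "A \<union> R \<subseteq> {1..n}" using add.prems by blast
  from add.IH[OF this] obtain r a and D :: "nat \<Rightarrow> nat \<Rightarrow> nat \<Rightarrow> 'k mpoly" where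
    G: "graded_resolves n (sqid n G) r a D" "minimal_difl r D" and
    r: "0 < r (card A)" "\<forall>i>card A. r i = 0" and
    a: "\<forall>i. \<forall>k<r (Suc i). a (Suc i) k - int i \<le> int (Max (card ` G))"
      "\<exists>i. \<exists>k<r (Suc i). a (Suc i) k - int i = int (Max (card ` G))"
    by blast
  have cA: "card (insert x A) = Suc (card A)" using st(1) add.hyps(2) by simp
  have cr: "cone_rank r (Suc i) = r (Suc i) + r i" for i by (simp add: cone_rank_def)
  have x: "x \<in> {1..n}" "x \<notin> \<Union> G" using add st(6) by auto
  have r0: "r 0 = 1" "a 0 0 = 0"
    using G(1) by (auto simp: graded_resolves_def resolves_def graded_difl_def)
  have M1: "1 \<le> Max (card ` G)"
  proof -
    obtain g where g: "g \<in> G" using st(8) by blast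
    have "1 \<le> card g" using st(7,9) g by (metis One_nat_def Suc_leI card_gt_0_iff)
    also have "\<dots> \<le> Max (card ` G)" using st(3) g by simp
    finally show ?thesis .
  qed
  have "cone_shift r a 1 (Suc i) k - int i \<le> int (Max (card ` G))" if "k < cone_rank r (Suc i)" for i k
  proof (cases "k < r (Suc i)")
    case True
    then show ?thesis using a(1) by (simp add: cone_shift_def join_def)
  next
    \<comment> \<open>Basis elements of the second summand move up by one in both homological and
      internal degree, which leaves \<open>j - i\<close> unchanged. The exception is the generator
      of A: it becomes the basis element over \<open>x\<close> and contributes 1.\<close>
    case False
    then have k: "cone_shift r a 1 (Suc i) k = a i (k - r (Suc i)) + 1" "k - r (Suc i) < r i"
      using that by (auto simp: cone_shift_def join_def cr)
    show ?thesis
    proof (cases i)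
      case 0
      then show ?thesis using k r0 M1 by simp
    next
      case (Suc i')
      then have "a (Suc i') (k - r (Suc i)) - int i' \<le> int (Max (card ` G))" using k(2) a(1) by blast
      then show ?thesis using k(1) Suc by simp
    qed
  qed
  moreover have "\<exists>i. \<exists>k<cone_rank r (Suc i). cone_shift r a 1 (Suc i) k - int i = int (Max (card ` G))"
  proof -
    obtain i k where "k < r (Suc i)" "a (Suc i) k - int i = int (Max (card ` G))" using a(2) by blast
    then show ?thesis by (intro exI[of _ i] exI[of _ k]) (simp add: cr cone_shift_def join_def)
  qed
  moreover have "cone_rank r i = 0" if "i > card (insert x A)" for i
    using that r(2) unfolding cA by (cases i) (auto simp: cr)
  moreover have "cone_rank r (card (insert x A)) > 0" using r(1) unfolding cA by (simp add: cr)
  ultimately show ?case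
    unfolding Max_card_add[OF add.hyps(1)]
    using graded_resolves_cone[OF G x] by blast
next
  case (mul b A R G x)
  note st = stair_facts[OF mul.hyps(1)]
  have "A \<union> R \<subseteq> {1..n}" using mul.prems by blast
  from mul.IH[OF this] obtain r a and D :: "nat \<Rightarrow> nat \<Rightarrow> nat \<Rightarrow> 'k mpoly" where
    G: "graded_resolves n (sqid n G) r a D" "minimal_difl r D" and
    r: "0 < r (card A)" "\<forall>i>card A. r i = 0" and
    a: "\<forall>i. \<forall>k<r (Suc i). a (Suc i) k - int i \<le> int (Max (card ` G))"
      "\<exists>i. \<exists>k<r (Suc i). a (Suc i) k - int i = int (Max (card ` G))"
    by blast
  have x: "x \<in> {1..n}" "x \<notin> \<Union> G" using mul st(6) by auto
  let ?a = "\<lambda>i k. if i = 0 then a i k else a i k + 1"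
  have "?a (Suc i) k - int i \<le> int (Suc (Max (card ` G)))" if "k < r (Suc i)" for i k
    using a(1) that by fastforce
  moreover have "\<exists>i. \<exists>k<r (Suc i). ?a (Suc i) k - int i = int (Suc (Max (card ` G)))"
    using a(2) by (auto simp: algebra_simps)
  ultimately show ?case
    unfolding Max_card_mul[OF mul.hyps]
    using graded_resolves_scale[OF G x] r by blast
qed


section \<open>Universal squarefree lexsegment ideals\<close>

definition slex_sets :: "nat set \<Rightarrow> nat set \<Rightarrow> bool"
  where "slex_sets F F' \<longleftrightarrow>
    (let is = sorted_list_of_set F; js = sorted_list_of_set F'
     in length is = length js \<and>
        (\<exists>s < length is. (\<forall>r < s. is ! r = js ! r) \<and> is ! s < js ! s))"

lemma slex_greater_iff: "slex_greater u v \<longleftrightarrow> slex_sets (Poly_Mapping.keys u) (Poly_Mapping.keys v)"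
  by (simp add: slex_greater_def slex_sets_def)

lemma sorted_list_of_set_insert_less:
  assumes "finite F" "\<And>y. y \<in> F \<Longrightarrow> x < (y :: nat)"
  shows "sorted_list_of_set (insert x F) = x # sorted_list_of_set F"
proof -
  have "x \<notin> F" using assms(2) by blast
  then have "sorted_list_of_set (insert x F) = insort x (sorted_list_of_set F)"
    using assms(1) by (simp add: sorted_list_of_set_insert_remove)
  also have "\<dots> = x # sorted_list_of_set F"
    using assms by (intro insort_is_Cons) (auto intro: less_imp_le)
  finally show ?thesis .
qed

lemma slex_sets_insert:
  assumes "finite F" "finite F'" "\<And>y. y \<in> F \<union> F' \<Longrightarrow> x < y" "slex_sets F F'"
  shows "slex_sets (insert x F) (insert x F')"
proof -
  obtain s where s: "length (sorted_list_of_set F) = length (sorted_list_of_set F')"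
    "s < length (sorted_list_of_set F)"
    "\<forall>r<s. sorted_list_of_set F ! r = sorted_list_of_set F' ! r"
    "sorted_list_of_set F ! s < sorted_list_of_set F' ! s"
    using assms(4) by (auto simp: slex_sets_def Let_def)
  have l: "sorted_list_of_set (insert x F) = x # sorted_list_of_set F"
    "sorted_list_of_set (insert x F') = x # sorted_list_of_set F'"
    using assms(1-3) by (intro sorted_list_of_set_insert_less; blast)+
  have "\<forall>r<Suc s. (x # sorted_list_of_set F) ! r = (x # sorted_list_of_set F') ! r"
    using s(3) by (simp add: All_less_Suc2)
  then show ?thesis
    unfolding slex_sets_def Let_def l using s(1,2,4) by (intro conjI exI[of _ "Suc s"]) auto
qed

text \<open>The comparison is decided at the first position, whatever the rest of \<open>F\<close>
  is.\<close>

lemma slex_sets_smaller_min: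
  assumes "finite F" "finite F'" "F' \<noteq> {}" "card (insert x F) = card F'"
    and "\<And>y. y \<in> F \<union> F' \<Longrightarrow> x < y"
  shows "slex_sets (insert x F) F'"
proof -
  have l: "sorted_list_of_set (insert x F) = x # sorted_list_of_set F"
    using assms(1,5) by (intro sorted_list_of_set_insert_less) blast+
  have len: "length (sorted_list_of_set (insert x F)) = length (sorted_list_of_set F')"
    using assms(4) by (simp only: length_sorted_list_of_set)
  have "0 < length (sorted_list_of_set F')" using assms(2,3) by (simp add: card_gt_0_iff)
  from nth_mem[OF this] have "sorted_list_of_set F' ! 0 \<in> F'" using assms(2) by simp
  then have "x < sorted_list_of_set F' ! 0" using assms(5) by blast
  with len show ?thesis
    unfolding slex_sets_def Let_def by (intro conjI exI[of _ 0]) (auto simp: l)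
qed

text \<open>The sets \<open>F\<close> and \<open>F'\<close> in the last hypothesis may reach beyond
  \<open>n\<close>: this is where universality enters. The hypothesis passes to the numbers above
  \<open>x\<close>, because a set avoiding \<open>x\<close> does not lie over \<open>{x}\<close> in
  the one case, and because \<open>x\<close> can be put in front of both sets in the other.\<close>

lemma lex_family_stair:
  assumes "G \<subseteq> Pow {a<..n}" "{} \<notin> G" "G \<noteq> {}"
    and "\<And>g h. g \<in> G \<Longrightarrow> h \<in> G \<Longrightarrow> h \<subseteq> g \<Longrightarrow> h = g"
    and "\<And>F F'. finite F \<Longrightarrow> finite F' \<Longrightarrow> F \<subseteq> {a<..} \<Longrightarrow> F' \<subseteq> {a<..} \<Longrightarrow> card F = card F' \<Longrightarrow>
      slex_sets F' F \<Longrightarrow> \<exists>g\<in>G. g \<subseteq> F \<Longrightarrow> \<exists>g\<in>G. g \<subseteq> F'"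
  shows "\<exists>b A R. stair b A R G \<and> A \<union> R \<subseteq> {a<..n}"
  using assms
proof (induction "n - a" arbitrary: a G)
  case 0
  then show ?case by auto
next
  case (Suc m)
  define x where "x = Suc a"
  note sub = Suc.prems(1) and anti = Suc.prems(4) and lex = Suc.prems(5)
  have xn: "x \<le> n" using Suc.hyps(2) by (simp add: x_def)
  have m: "m = n - x" using Suc.hyps(2) by (simp add: x_def)
  have gt: "{a<..} = insert x {x<..}" "{a<..n} = insert x {x<..n}" using xn by (auto simp: x_def)
  have fin: "finite g" if "g \<in> G" for g using sub that by (auto intro: finite_subset)
  show ?case
  proof (cases "{x} \<in> G")
    case True
    have nx: "x \<notin> g" if "g \<in> G" "g \<noteq> {x}" for g
      using anti[OF that(1) True] that(2) by auto
    show ?thesis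
    proof (cases "G = {{x}}")
      case True
      then show ?thesis using stair.base[of x] gt by auto
    next
      case False
      define G' where "G' = G - {{x}}"
      have GG': "G = insert {x} G'" using True by (auto simp: G'_def)
      have "\<exists>b A R. stair b A R G' \<and> A \<union> R \<subseteq> {x<..n}"
      proof (rule Suc.hyps(1)[OF m])
        show "G' \<subseteq> Pow {x<..n}" using sub nx unfolding G'_def gt by fast
        show "{} \<notin> G'" using Suc.prems(2) unfolding G'_def by blast
        show "G' \<noteq> {}" using False unfolding GG' by blast
        show "h = g" if "g \<in> G'" "h \<in> G'" "h \<subseteq> g" for g h
          using anti that by (auto simp: G'_def)
        fix F F' assume F: "finite F" "finite F'" "F \<subseteq> {x<..}" "F' \<subseteq> {x<..}" "card F = card F'"
          "slex_sets F' F" "\<exists>g\<in>G'. g \<subseteq> F"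
        then have "\<exists>g\<in>G. g \<subseteq> F'" by (intro lex[of F F']) (auto simp: gt GG')
        moreover have "x \<notin> F'" using F(4) by auto
        ultimately show "\<exists>g\<in>G'. g \<subseteq> F'" by (auto simp: GG')
      qed
      then obtain b A R where st: "stair b A R G'" "A \<union> R \<subseteq> {x<..n}" by blast
      have "x \<notin> A \<union> R" using st(2) by auto
      from stair.add[OF st(1) this] have "stair b (insert x A) R G" by (simp add: GG')
      moreover have "insert x A \<union> R \<subseteq> {a<..n}" unfolding gt using st(2) by blast
      ultimately show ?thesis by blast
    qed
  next
    case False
    have x: "x \<in> g" if g: "g \<in> G" for g
    proof (rule ccontr)
      assume "x \<notin> g"
      \<comment> \<open>These are \<open>card g - 1\<close> new variables, as \<open>x\<close>
        supplies the remaining degree of \<open>g\<close>. All of them exceed \<open>n\<close>, so a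
        nonempty member of \<open>G\<close> inside \<open>insert x F'\<close> could only be
        \<open>{x}\<close>.\<close>
      define F' where "F' = {n<..<n + card g}"
      have "g \<noteq> {}" using g Suc.prems(2) by metis
      then have "card g > 0" using fin[OF g] by (simp add: card_gt_0_iff)
      then have card: "card (insert x F') = card g"
        using xn by (subst card_insert_disjoint) (auto simp: F'_def)
      have gx: "g \<subseteq> {x<..n}" using g sub \<open>x \<notin> g\<close> unfolding gt by blast
      have "\<exists>h\<in>G. h \<subseteq> insert x F'"
      proof (rule lex[of g])
        show "slex_sets (insert x F') g"
          using fin[OF g] \<open>g \<noteq> {}\<close> card gx xn
          by (intro slex_sets_smaller_min) (auto simp: F'_def)
        show "g \<subseteq> {a<..}" "insert x F' \<subseteq> {a<..}" using gx xn by (auto simp: F'_def x_def)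
        show "finite g" "\<exists>h\<in>G. h \<subseteq> g" using g fin by auto
        show "finite (insert x F')" by (simp add: F'_def)
      qed (use card in simp)
      then obtain h where h: "h \<in> G" "h \<subseteq> insert x F'" by blast
      have "h \<subseteq> {a<..n}" using h(1) sub by blast
      then have "h \<subseteq> {x}" using h(2) by (force simp: F'_def)
      then show False using h(1) False Suc.prems(2) by (metis subset_singletonD)
    qed
    define G' where "G' = (\<lambda>g. g - {x}) ` G"
    have GG': "G = insert x ` G'" using x by (auto simp: G'_def image_image insert_absorb)
    have xG': "x \<notin> g" if "g \<in> G'" for g using that by (auto simp: G'_def)
    have "\<exists>b A R. stair b A R G' \<and> A \<union> R \<subseteq> {x<..n}"
    proof (rule Suc.hyps(1)[OF m])
      show "G' \<subseteq> Pow {x<..n}" using sub unfolding G'_def gt by blast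
      show "{} \<notin> G'" using False by (auto simp: GG')
      show "G' \<noteq> {}" using Suc.prems(3) by (simp add: G'_def)
      show "h = g" if "g \<in> G'" "h \<in> G'" "h \<subseteq> g" for g h
      proof -
        have "insert x h = insert x g" using that by (intro anti) (auto simp: GG')
        with xG'[OF that(1)] xG'[OF that(2)] show ?thesis by (metis insert_ident)
      qed
      fix F F' assume F: "finite F" "finite F'" "F \<subseteq> {x<..}" "F' \<subseteq> {x<..}" "card F = card F'"
        "slex_sets F' F" "\<exists>g\<in>G'. g \<subseteq> F"
      have "\<exists>g\<in>G. g \<subseteq> insert x F'"
      proof (rule lex[of "insert x F"])
        have nx: "x \<notin> F" "x \<notin> F'" using F(3,4) by auto
        show "card (insert x F) = card (insert x F')" using F(1,2,5) nx by simp
        show "slex_sets (insert x F') (insert x F)"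
          using F by (intro slex_sets_insert) auto
        obtain g where g: "g \<in> G'" "g \<subseteq> F" using F(7) by blast
        then have "insert x g \<in> G" "insert x g \<subseteq> insert x F" unfolding GG' by blast+
        then show "\<exists>g\<in>G. g \<subseteq> insert x F" by blast
        show "insert x F \<subseteq> {a<..}" "insert x F' \<subseteq> {a<..}" unfolding gt using F(3,4) by blast+
        show "finite (insert x F)" "finite (insert x F')" using F(1,2) by simp_all
      qed
      then obtain g where "g \<in> G'" "insert x g \<subseteq> insert x F'" unfolding GG' by blast
      then show "\<exists>g\<in>G'. g \<subseteq> F'" using xG' by blast
    qed
    then obtain b A R where st: "stair b A R G'" "A \<union> R \<subseteq> {x<..n}" by blast
    have "x \<notin> A \<union> R" using st(2) by auto
    from stair.mul[OF st(1) this] have "stair b A (insert x R) G" by (simp add: GG')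
    moreover have "A \<union> insert x R \<subseteq> {a<..n}" unfolding gt using st(2) by blast
    ultimately show ?thesis by blast
  qed
qed


subsection \<open>Minimal generators\<close>

definition sqmon :: "nat set \<Rightarrow> exps"
  where "sqmon F = (\<Sum>i\<in>F. Poly_Mapping.single i 1)"

lemma lookup_sqmon: "finite F \<Longrightarrow> Poly_Mapping.lookup (sqmon F) i = (if i \<in> F then 1 else 0)"
  by (simp add: sqmon_def lookup_sum lookup_single when_def sum.delta')

lemma keys_sqmon: "finite F \<Longrightarrow> Poly_Mapping.keys (sqmon F) = F"
  by (auto simp: in_keys_iff lookup_sqmon split: if_splits)

lemma mdeg_sqmon: "finite F \<Longrightarrow> mdeg (sqmon F) = card F"
  by (simp add: mdeg_def keys_sqmon lookup_sqmon)

lemma sqmon_in_sqfree_monoms: "F \<subseteq> {1..n} \<Longrightarrow> sqmon F \<in> sqfree_monoms n"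
  by (auto simp: sqfree_monoms_def monoms_def keys_sqmon lookup_sqmon finite_subset[OF _ finite_atLeastAtMost])

lemma sqfree_monoms_divides_iff:
  assumes "h \<in> sqfree_monoms n"
  shows "(\<exists>v. u = h + v) \<longleftrightarrow> Poly_Mapping.keys h \<subseteq> Poly_Mapping.keys u"
proof
  assume h: "Poly_Mapping.keys h \<subseteq> Poly_Mapping.keys u"
  have "Poly_Mapping.lookup h i \<le> Poly_Mapping.lookup u i" for i
  proof (cases "i \<in> Poly_Mapping.keys h")
    case True
    then have "i \<in> Poly_Mapping.keys u" using h by blast
    then have "Poly_Mapping.lookup u i \<noteq> 0" by (simp add: in_keys_iff)
    moreover have "Poly_Mapping.lookup h i \<le> 1" using assms by (simp add: sqfree_monoms_def)
    ultimately show ?thesis by linarith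
  qed (simp add: in_keys_iff)
  then have "u = h + (u - h)"
    by (intro poly_mapping_eqI) (simp add: lookup_add lookup_minus)
  then show "\<exists>v. u = h + v" ..
qed (auto simp: keys_add_nat)

lemma mono_poly_in_polys: "u \<in> monoms n \<Longrightarrow> mono_poly u \<in> polys n"
  unfolding mono_poly_def by (rule single_in_polys)

lemma keys_mono_poly [simp]: "Poly_Mapping.keys (mono_poly u :: 'k::field mpoly) = {u}"
  by (simp add: mono_poly_def)

lemma genideal_mono:
  fixes H :: "exps set"
  assumes H: "H \<subseteq> monoms n"
  shows "Idl\<^bsub>poly_ring n\<^esub> (mono_poly ` H) =
    ({p \<in> polys n. \<forall>u\<in>Poly_Mapping.keys p. \<exists>h\<in>H. \<exists>v. u = h + v} :: 'k::field mpoly set)" (is "?L = ?R")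
proof -
  interpret P: cring "poly_ring n :: 'k mpoly ring" by (rule cring_poly_ring)
  have sub: "mono_poly ` H \<subseteq> carrier (poly_ring n :: 'k mpoly ring)"
    using H by (auto intro: mono_poly_in_polys)
  have "idl n ?R"
  proof -
    have add: "p + q \<in> ?R" if "p \<in> ?R" "q \<in> ?R" for p q
      using that keys_add[of p q] by (auto simp: polys_add)
    have mult: "q * p \<in> ?R" if p: "p \<in> ?R" and q: "q \<in> polys n" for p q
    proof (intro CollectI conjI ballI)
      show "q * p \<in> polys n" using p q by (intro polys_mult) auto
      fix u assume "u \<in> Poly_Mapping.keys (q * p)"
      from subsetD[OF keys_mult this] obtain v w where u: "u = v + w" and w: "w \<in> Poly_Mapping.keys p"
        by blast
      obtain h v' where "h \<in> H" "w = h + v'"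
        using p w by blast
      then have "u = h + (v + v')" unfolding u by (simp add: ac_simps)
      with \<open>h \<in> H\<close> show "\<exists>h\<in>H. \<exists>v. u = h + v" by blast
    qed
    have "?R \<subseteq> polys n" "0 \<in> ?R" by auto
    then show ?thesis unfolding idl_def by (intro conjI ballI add mult)
  qed
  moreover have "mono_poly ` H \<subseteq> ?R"
  proof
    fix p :: "'k mpoly" assume "p \<in> mono_poly ` H"
    then obtain h where h: "h \<in> H" "p = mono_poly h" by blast
    then have "\<exists>h'\<in>H. \<exists>v. h = h' + v" by (metis add.right_neutral)
    with h H show "p \<in> ?R" by (auto intro!: mono_poly_in_polys)
  qed
  ultimately have "?L \<subseteq> ?R"
    unfolding ideal_iff_idl[symmetric] by (rule P.genideal_minimal)
  moreover have "?R \<subseteq> ?L"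
  proof
    fix p :: "'k mpoly" assume p: "p \<in> ?R"
    have L: "idl n ?L" using P.genideal_ideal[OF sub] by (simp add: ideal_iff_idl)
    have "Poly_Mapping.keys p \<subseteq> {u \<in> monoms n. \<exists>h\<in>H. \<exists>v. u = h + v}"
      using p by (auto simp: polys_def)
    then show "p \<in> ?L"
    proof (induction p rule: poly_induct)
      case (add u c q)
      then obtain h v where u: "h \<in> H" "u = h + v" "u \<in> monoms n" by blast
      have "v \<in> monoms n" using u(3) by (simp add: u(2) monoms_def keys_add_nat)
      moreover have "mono_poly h \<in> ?L" using P.genideal_self[OF sub] u(1) by blast
      moreover have "Poly_Mapping.single u c = Poly_Mapping.single v c * mono_poly h"
        by (simp add: mono_poly_def mult_single u(2) add.commute)
      ultimately have "Poly_Mapping.single u c \<in> ?L"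
        using idlD(4)[OF L] single_in_polys by metis
      then show ?case using add.IH by (rule idlD(3)[OF L])
    qed (rule idlD(2)[OF L])
  qed
  ultimately show ?thesis by blast
qed

lemma genideal_sqfree:
  assumes "S \<subseteq> sqfree_monoms n"
  shows "Idl\<^bsub>poly_ring n\<^esub> (mono_poly ` S) = (sqid n (Poly_Mapping.keys ` S) :: 'k::field mpoly set)"
proof -
  have "S \<subseteq> monoms n" using assms by (auto simp: sqfree_monoms_def)
  moreover have "(\<exists>h\<in>S. \<exists>v. u = h + v) \<longleftrightarrow> (\<exists>g\<in>Poly_Mapping.keys ` S. g \<subseteq> Poly_Mapping.keys u)" for u
  proof -
    have "(\<exists>v. u = h + v) \<longleftrightarrow> Poly_Mapping.keys h \<subseteq> Poly_Mapping.keys u" if "h \<in> S" for h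
      using that assms by (intro sqfree_monoms_divides_iff) blast
    then show ?thesis by simp
  qed
  ultimately show ?thesis by (simp add: genideal_mono sqid_def)
qed

lemma genideal_sqmon:
  assumes "G \<subseteq> Pow {1..n}"
  shows "Idl\<^bsub>poly_ring n\<^esub> (mono_poly ` sqmon ` G) = (sqid n G :: 'k::field mpoly set)"
proof -
  have "finite g" if "g \<in> G" for g using that assms by (auto intro: finite_subset)
  then have "Poly_Mapping.keys ` sqmon ` G = G" by (simp add: image_image keys_sqmon cong: image_cong_simp)
  moreover have "sqmon ` G \<subseteq> sqfree_monoms n" using assms sqmon_in_sqfree_monoms by blast
  ultimately show ?thesis using genideal_sqfree[of "sqmon ` G" n] by simp
qed

lemma mono_poly_in_sqid_iff:
  "(mono_poly u :: 'k::field mpoly) \<in> sqid n G \<longleftrightarrow> u \<in> monoms n \<and> (\<exists>g\<in>G. g \<subseteq> Poly_Mapping.keys u)"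
  by (simp add: sqid_def polys_def)

text \<open>For uniqueness, let \<open>G'\<close> be any minimal generating set. Each
  \<open>sqmon g\<close> is a multiple of some \<open>h\<close> in \<open>G'\<close>, and
  \<open>h\<close> lies over some \<open>g'\<close> in \<open>G\<close>; the antichain condition
  forces \<open>g' = g\<close> and so \<open>h = sqmon g\<close>. Thus \<open>G'\<close> contains
  all these monomials, and its minimality excludes any others.\<close>

lemma min_gens_sqid:
  assumes G: "G \<subseteq> Pow {1..n}" and anti: "\<And>g h. g \<in> G \<Longrightarrow> h \<in> G \<Longrightarrow> h \<subseteq> g \<Longrightarrow> h = g"
  shows "min_gens n (sqid n G :: 'k::field mpoly set) = sqmon ` G"
  unfolding min_gens_def
proof (rule the_equality)
  let ?I = "sqid n G :: 'k mpoly set"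
  have fin: "finite g" if "g \<in> G" for g using that G by (auto intro: finite_subset)
  have sq: "sqmon ` G \<subseteq> sqfree_monoms n" using G sqmon_in_sqfree_monoms by blast
  then have mo: "sqmon ` G \<subseteq> monoms n" by (auto simp: sqfree_monoms_def)
  have inI: "(mono_poly (sqmon g) :: 'k mpoly) \<in> ?I" if "g \<in> G" for g
    using that mo fin by (auto simp: mono_poly_in_sqid_iff keys_sqmon)
  show "sqmon ` G \<subseteq> monoms n \<and> Idl\<^bsub>poly_ring n\<^esub> (mono_poly ` sqmon ` G) = ?I \<and>
      (\<forall>H. H \<subset> sqmon ` G \<longrightarrow> Idl\<^bsub>poly_ring n\<^esub> (mono_poly ` H) \<noteq> ?I)"
  proof (intro conjI allI impI mo genideal_sqmon G notI)
    fix H assume H: "H \<subset> sqmon ` G" and eq: "Idl\<^bsub>poly_ring n\<^esub> (mono_poly ` H) = ?I"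
    obtain g where g: "g \<in> G" "sqmon g \<notin> H" using H by blast
    have "H \<subseteq> sqfree_monoms n" using H sq by blast
    from inI[OF g(1)] have "\<exists>h\<in>Poly_Mapping.keys ` H. h \<subseteq> Poly_Mapping.keys (sqmon g)"
      unfolding eq[symmetric] genideal_sqfree[OF \<open>H \<subseteq> sqfree_monoms n\<close>] mono_poly_in_sqid_iff by blast
    then obtain h where h: "h \<in> H" "Poly_Mapping.keys h \<subseteq> g"
      using keys_sqmon[OF fin[OF g(1)]] by auto
    obtain g' where g': "g' \<in> G" "h = sqmon g'" using h(1) H by blast
    have "g' = g" using h(2) g' fin by (intro anti g(1)) (auto simp: keys_sqmon)
    then show False using h(1) g(2) g'(2) by simp
  qed
  fix G' assume "G' \<subseteq> monoms n \<and> Idl\<^bsub>poly_ring n\<^esub> (mono_poly ` G') = ?I \<and>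
      (\<forall>H. H \<subset> G' \<longrightarrow> Idl\<^bsub>poly_ring n\<^esub> (mono_poly ` H) \<noteq> ?I)"
  then have G': "G' \<subseteq> monoms n" "Idl\<^bsub>poly_ring n\<^esub> (mono_poly ` G') = ?I"
    "\<And>H. H \<subset> G' \<Longrightarrow> Idl\<^bsub>poly_ring n\<^esub> (mono_poly ` H) \<noteq> ?I" by auto
  have "sqmon g \<in> G'" if g: "g \<in> G" for g
  proof -
    have "\<exists>h\<in>G'. \<exists>v. sqmon g = h + v"
      using inI[OF g] unfolding G'(2)[symmetric] genideal_mono[OF G'(1)] by simp
    then obtain h v where h: "h \<in> G'" "sqmon g = h + v" by blast
    have "\<exists>h'\<in>G'. \<exists>v. h = h' + v" using h(1) by (metis add.right_neutral)
    then have "(mono_poly h :: 'k mpoly) \<in> ?I"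
      using h(1) G'(1) unfolding G'(2)[symmetric] genideal_mono[OF G'(1)]
      by (auto intro!: mono_poly_in_polys)
    then obtain g' where g': "g' \<in> G" "g' \<subseteq> Poly_Mapping.keys h" by (auto simp: mono_poly_in_sqid_iff)
    have kg: "g = Poly_Mapping.keys h \<union> Poly_Mapping.keys v"
      using arg_cong[OF h(2), of Poly_Mapping.keys] fin[OF g] by (simp add: keys_sqmon keys_add_nat)
    then have "g' = g" using g' by (intro anti g) auto
    then have kh: "Poly_Mapping.keys h = g" using g'(2) kg by blast
    have "Poly_Mapping.lookup (sqmon g) i = Poly_Mapping.lookup h i" for i
    proof (cases "i \<in> g")
      case True
      then have "Poly_Mapping.lookup h i \<noteq> 0" using kh by (auto simp: in_keys_iff)
      then show ?thesis
        using arg_cong[OF h(2), of "\<lambda>u. Poly_Mapping.lookup u i"] fin[OF g] True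
        by (simp add: lookup_add lookup_sqmon)
    next
      case False
      then have "Poly_Mapping.lookup h i = 0" using kh by (metis in_keys_iff)
      then show ?thesis using False fin[OF g] by (simp add: lookup_sqmon)
    qed
    then have "sqmon g = h" by (rule poly_mapping_eqI)
    with h(1) show ?thesis by simp
  qed
  then have "sqmon ` G \<subseteq> G'" by blast
  then show "G' = sqmon ` G"
    using G'(3)[of "sqmon ` G"] genideal_sqmon[OF G, where 'k = 'k] by blast
qed

text \<open>Both ideals are generated by the monomials \<open>sqmon g\<close>, so the supports do
  not change with the number of variables.\<close>

lemma genideal_sqid_extension:
  assumes G: "G \<subseteq> Pow {1..n}" and "n \<le> N"
  shows "Idl\<^bsub>poly_ring N\<^esub> (sqid n G) = (sqid N G :: 'k::field mpoly set)"
proof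
  interpret P: cring "poly_ring N :: 'k mpoly ring" by (rule cring_poly_ring)
  have nN: "sqid n G \<subseteq> (sqid N G :: 'k mpoly set)"
    using polys_mono[OF assms(2)] by (auto simp: sqid_def)
  have sub: "sqid n G \<subseteq> carrier (poly_ring N :: 'k mpoly ring)"
    using nN by (auto simp: sqid_def)
  show "Idl\<^bsub>poly_ring N\<^esub> (sqid n G) \<subseteq> (sqid N G :: 'k mpoly set)"
    using nN idl_sqid by (intro P.genideal_minimal) (auto simp: ideal_iff_idl)
  have "mono_poly ` sqmon ` G \<subseteq> (sqid n G :: 'k mpoly set)"
  proof
    fix p :: "'k mpoly" assume "p \<in> mono_poly ` sqmon ` G"
    then obtain g where g: "g \<in> G" "p = mono_poly (sqmon g)" by blast
    then have "g \<subseteq> {1..n}" "finite g" using G by (auto intro: finite_subset)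
    then show "p \<in> sqid n G" using g by (auto simp: mono_poly_in_sqid_iff keys_sqmon monoms_def)
  qed
  also have "\<dots> \<subseteq> Idl\<^bsub>poly_ring N\<^esub> (sqid n G)" by (rule P.genideal_self[OF sub])
  finally have "Idl\<^bsub>poly_ring N\<^esub> (mono_poly ` sqmon ` G) \<subseteq> Idl\<^bsub>poly_ring N\<^esub> (sqid n G :: 'k mpoly set)"
    by (intro P.genideal_minimal P.genideal_ideal sub)
  moreover have "G \<subseteq> Pow {1..N}" using G assms(2) by fastforce
  ultimately show "sqid N G \<subseteq> Idl\<^bsub>poly_ring N\<^esub> (sqid n G :: 'k mpoly set)"
    using genideal_sqmon[of G N, where 'k = 'k] by simp
qed

theorem usli_stair:
  fixes I :: "'k::field mpoly set"
  assumes I: "usli n I" and ne: "min_gens n I \<noteq> {}"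
  shows "\<exists>b A R G. stair b A R G \<and> A \<union> R \<subseteq> {1..n} \<and> I = sqid n G \<and> min_gens n I = sqmon ` G"
proof -
  have "sqfree_lexsegment n I" using I by (simp add: usli_def)
  then obtain S where S: "S \<subseteq> sqfree_monoms n" "I = Idl\<^bsub>poly_ring n\<^esub> (mono_poly ` S)" "I \<noteq> polys n"
    by (auto simp: sqfree_lexsegment_def)
  define \<S> where "\<S> = Poly_Mapping.keys ` S"
  have \<S>: "\<S> \<subseteq> Pow {1..n}" using S(1) by (auto simp: \<S>_def sqfree_monoms_def monoms_def)
  then have finS: "finite \<S>" by (rule finite_subset) simp
  define G where "G = {g \<in> \<S>. \<forall>h\<in>\<S>. h \<subseteq> g \<longrightarrow> h = g}"
  have G: "G \<subseteq> Pow {1..n}" using \<S> by (auto simp: G_def)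
  have anti: "h = g" if "g \<in> G" "h \<in> G" "h \<subseteq> g" for g h using that by (auto simp: G_def)
  have below: "\<exists>g\<in>G. g \<subseteq> s" if s: "s \<in> \<S>" for s
  proof -
    obtain g where g: "g \<in> \<S>" "g \<subseteq> s" "\<forall>h\<in>\<S>. h \<subseteq> g \<longrightarrow> g = h"
      using finite_has_minimal2[OF finS s] by blast
    then have "g \<in> G" unfolding G_def by blast
    with g(2) show ?thesis by blast
  qed
  have "sqid n \<S> = (sqid n G :: 'k mpoly set)"
  proof -
    have "(\<exists>s\<in>\<S>. s \<subseteq> u) \<longleftrightarrow> (\<exists>g\<in>G. g \<subseteq> u)" for u
    proof
      assume "\<exists>s\<in>\<S>. s \<subseteq> u"
      then obtain s where "s \<in> \<S>" "s \<subseteq> u" by blast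
      with below[of s] show "\<exists>g\<in>G. g \<subseteq> u" by blast
    qed (auto simp: G_def)
    then show ?thesis by (simp add: sqid_def)
  qed
  then have IG: "I = sqid n G" using S(2) genideal_sqfree[OF S(1), where 'k = 'k] by (simp add: \<S>_def)
  have mg: "min_gens n I = sqmon ` G" unfolding IG by (rule min_gens_sqid[OF G anti])
  have gt0: "{0<..n} = {1..n}" by auto
  have "\<exists>b A R. stair b A R G \<and> A \<union> R \<subseteq> {0<..n}"
  proof (rule lex_family_stair)
    show "G \<subseteq> Pow {0<..n}" using G unfolding gt0 .
    show "{} \<notin> G"
    proof
      assume "{} \<in> G"
      then have "I = polys n" unfolding IG sqid_def by auto
      with S(3) show False ..
    qed
    show "G \<noteq> {}" using ne mg by auto
    show "h = g" if "g \<in> G" "h \<in> G" "h \<subseteq> g" for g h using that by (rule anti)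
    fix F F' :: "nat set" assume F: "finite F" "finite F'" "F \<subseteq> {0<..}" "F' \<subseteq> {0<..}" "card F = card F'"
      "slex_sets F' F" "\<exists>g\<in>G. g \<subseteq> F"
    obtain m where m: "F \<union> F' \<subseteq> {..m}" using F(1,2) finite_nat_set_iff_bounded_le[of "F \<union> F'"] by auto
    \<comment> \<open>With \<open>Suc m\<close> further variables both sets fit into
      \<open>{1..N}\<close>, and the number of added variables is positive, as \<open>usli\<close>
      demands.\<close>
    define N where "N = n + Suc m"
    have FN: "F \<subseteq> {1..N}" "F' \<subseteq> {1..N}" using m F(3,4) by (fastforce simp: N_def)+
    have "sqfree_lexsegment N (Idl\<^bsub>poly_ring N\<^esub> I)"
      using I unfolding usli_def N_def by (metis le_add1 plus_1_eq_Suc)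
    moreover have "Idl\<^bsub>poly_ring N\<^esub> I = sqid N G"
      unfolding IG using G by (rule genideal_sqid_extension) (simp add: N_def)
    ultimately have lex: "sqfree_lexsegment N (sqid N G :: 'k mpoly set)" by simp
    have "(mono_poly (sqmon F') :: 'k mpoly) \<in> sqid N G"
    proof -
      have "(mono_poly (sqmon F) :: 'k mpoly) \<in> sqid N G"
        using F(1,7) FN(1) by (simp add: mono_poly_in_sqid_iff keys_sqmon monoms_def)
      moreover have "slex_greater (sqmon F') (sqmon F)" "mdeg (sqmon F) = mdeg (sqmon F')"
        using F by (simp_all add: slex_greater_iff keys_sqmon mdeg_sqmon)
      ultimately show ?thesis
        using lex sqmon_in_sqfree_monoms[OF FN(1)] sqmon_in_sqfree_monoms[OF FN(2)]
        unfolding sqfree_lexsegment_def by blast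
    qed
    then show "\<exists>g\<in>G. g \<subseteq> F'" using F(2) by (simp add: mono_poly_in_sqid_iff keys_sqmon)
  qed
  then show ?thesis unfolding gt0 using IG mg by blast
qed


section \<open>Regular sequences\<close>

text \<open>The recursion on the ideal suits inductions in which the ideal changes; the properness
  part of \<open>regular_seq\<close> is left out.\<close>

primrec weakly_regular :: "nat \<Rightarrow> 'k::field mpoly set \<Rightarrow> 'k mpoly list \<Rightarrow> bool" where
  "weakly_regular n J [] \<longleftrightarrow> True"
| "weakly_regular n J (f # fs) \<longleftrightarrow> nonzerodiv n J f \<and> weakly_regular n (extend n J f) fs"

lemma weakly_regular_iff_nth:
  "weakly_regular n J fs \<longleftrightarrow> (\<forall>k<length fs. nonzerodiv n (foldl (extend n) J (take k fs)) (fs ! k))"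
  by (induction fs arbitrary: J) (auto simp: All_less_Suc2)

lemma idl_foldl_extend:
  "idl n J \<Longrightarrow> set fs \<subseteq> polys n \<Longrightarrow> idl n (foldl (extend n) J fs)"
  by (induction fs arbitrary: J) (auto simp: idl_extend)

lemma foldl_extend_superset: "J \<subseteq> foldl (extend n) J fs"
proof (induction fs arbitrary: J)
  case (Cons f fs)
  then show ?case using extend_superset[of J n f] by fastforce
qed simp

lemma foldl_extend_subset:
  assumes "idl n M" "J \<subseteq> M" "set fs \<subseteq> M"
  shows "foldl (extend n) J fs \<subseteq> M"
  using assms(2,3)
proof (induction fs arbitrary: J)
  case (Cons f fs)
  have "extend n J f \<subseteq> M"
    using Cons.prems idlD(3,5)[OF assms(1)] by (auto simp: extend_def)
  then show ?case using Cons by simp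
qed simp

text \<open>Ungraded on purpose, as the members of \<open>fs\<close> need not be homogeneous: a
  vanishing constant term is all that minimality of the cone asks of them.\<close>

lemma weakly_regular_length_le:
  fixes D :: "nat \<Rightarrow> nat \<Rightarrow> nat \<Rightarrow> 'k::field mpoly"
  assumes "resolves n J r D" "minimal_difl r D" "0 < r s" "weakly_regular n J fs"
    and "\<And>f. f \<in> set fs \<Longrightarrow> f \<in> polys n \<and> Poly_Mapping.lookup f 0 = 0"
  shows "s + length fs \<le> n"
  using assms
proof (induction fs arbitrary: J r D s)
  case Nil
  then show ?case using minimal_resolution_length[of n J r D s] by simp
next
  case (Cons f fs)
  have "Suc s + length fs \<le> n"
  proof (rule Cons.IH)
    show "resolves n (extend n J f) (cone_rank r) (cone_difl r D f)"
      using Cons.prems by (intro resolves_cone) auto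
    show "minimal_difl (cone_rank r) (cone_difl r D f)"
      using Cons.prems by (intro minimal_cone) auto
    show "0 < cone_rank r (Suc s)" using Cons.prems(3) by (simp add: cone_rank_def)
  qed (use Cons.prems in auto)
  then show ?case by simp
qed

lemma extend_swap: "extend n (extend n B x) f \<subseteq> extend n (extend n B f) x"
proof
  fix p assume "p \<in> extend n (extend n B x) f"
  then obtain b c q where "p = b + x * c + f * q" "b \<in> B" "c \<in> polys n" "q \<in> polys n"
    by (auto simp: extend_def)
  then have "p = b + f * q + x * c" "b \<in> B" "c \<in> polys n" "q \<in> polys n" by simp_all
  then show "p \<in> extend n (extend n B f) x" using extendI by blast
qed

text \<open>The product \<open>f * (x * a)\<close> is absorbed by the multiples of \<open>f\<close>.
  Hence the shape \<open>x J + B\<close> survives when \<open>f\<close> is added, and the induction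
  can continue with both ideals enlarged.\<close>

lemma extend_scale_mod:
  assumes "idl n J" "x \<in> polys n"
  shows "extend n (scale_mod x J B) f = scale_mod x (extend n J f) (extend n B f)"
proof (intro equalityI subsetI)
  fix p assume "p \<in> extend n (scale_mod x J B) f"
  then obtain j b q where p: "p = x * j + b + f * q" "j \<in> J" "b \<in> B" "q \<in> polys n"
    by (auto simp: extend_def scale_mod_def)
  then have "p = x * j + (b + f * q)" by (simp add: add.assoc)
  moreover have "j \<in> extend n J f" using p(2) extend_superset by blast
  moreover have "b + f * q \<in> extend n B f" using p(3,4) by (rule extendI)
  ultimately show "p \<in> scale_mod x (extend n J f) (extend n B f)"
    unfolding scale_mod_def mem_Collect_eq by (intro exI conjI)
next
  fix p assume "p \<in> scale_mod x (extend n J f) (extend n B f)"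
  then obtain j a b c where p: "p = x * (j + f * a) + (b + f * c)" "j \<in> J" "b \<in> B" "a \<in> polys n" "c \<in> polys n"
    by (auto simp: extend_def scale_mod_def)
  have "p = (x * j + b) + f * (x * a + c)" unfolding p(1) by (simp add: algebra_simps)
  moreover have "x * j + b \<in> scale_mod x J B" using p(2,3) unfolding scale_mod_def by blast
  moreover have "x * a + c \<in> polys n" using assms(2) p(4,5) by (intro polys_add polys_mult)
  ultimately show "p \<in> extend n (scale_mod x J B) f" using extendI by blast
qed

text \<open>The idea is the exact sequence \<open>0 \<rightarrow> A/J \<rightarrow> A/(xJ + B) \<rightarrow> A/(x, B) \<rightarrow> 0\<close>, whose left map is
  multiplication by \<open>x\<close>.\<close>

lemma weakly_regular_scale_mod:
  assumes "idl n J" "idl n B" "B \<subseteq> J" "x \<in> polys n" "nonzerodiv n B x" "set fs \<subseteq> polys n"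
    and "weakly_regular n J fs" "weakly_regular n (extend n B x) fs"
  shows "weakly_regular n (scale_mod x J B) fs"
  using assms
proof (induction fs arbitrary: J B)
  case (Cons f fs)
  note J = Cons.prems(1) and B = Cons.prems(2) and BJ = Cons.prems(3) and x = Cons.prems(4)
  have f: "f \<in> polys n" and fJ: "nonzerodiv n J f" and fP: "nonzerodiv n (extend n B x) f"
    using Cons.prems by auto
  have xB: "c \<in> B" if "c \<in> polys n" "x * c \<in> B" for c
    using Cons.prems(5) that by (auto simp: nonzerodiv_def)
  have "nonzerodiv n (scale_mod x J B) f"
    unfolding nonzerodiv_def
  proof (intro ballI impI)
    fix p assume p: "p \<in> polys n" "f * p \<in> scale_mod x J B"
    then obtain j b where jb: "f * p = x * j + b" "j \<in> J" "b \<in> B" by (auto simp: scale_mod_def)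
    have jn: "j \<in> polys n" using jb(2) idlD(1)[OF J] by blast
    \<comment> \<open>Regularity of \<open>f\<close> on A/(x, B) writes \<open>p\<close> as
      \<open>e + x q\<close>; cancelling \<open>x\<close> modulo \<open>B\<close> then reduces the
      claim to \<open>q\<close> and to regularity of \<open>f\<close> on A/J.\<close>
    have "f * p \<in> extend n B x" using extendI[OF jb(3) jn, of x] jb(1) by (simp add: add.commute)
    then have "p \<in> extend n B x" using fP p(1) by (auto simp: nonzerodiv_def)
    then obtain e q where eq: "p = e + x * q" "e \<in> B" "q \<in> polys n" by (auto simp: extend_def)
    have "x * (f * q - j) = b - f * e" using jb(1) unfolding eq(1) by (simp add: algebra_simps)
    also have "\<dots> \<in> B" by (intro idlD(6)[OF B] idlD(4)[OF B] jb(3) eq(2) f)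
    finally have "x * (f * q - j) \<in> B" .
    then have "f * q - j \<in> B" using f eq(3) jn by (rule xB[OF polys_diff[OF polys_mult], rotated 3])
    then have "f * q - j + j \<in> J" using BJ jb(2) by (intro idlD(3)[OF J]) auto
    then have "q \<in> J" using fJ eq(3) by (auto simp: nonzerodiv_def)
    moreover have "p = x * q + e" using eq(1) by (simp add: add.commute)
    ultimately show "p \<in> scale_mod x J B" using eq(2) unfolding scale_mod_def mem_Collect_eq by (intro exI conjI)
  qed
  moreover have "weakly_regular n (scale_mod x (extend n J f) (extend n B f)) fs"
  proof (rule Cons.IH)
    show "idl n (extend n J f)" "idl n (extend n B f)" using J B f by (auto intro: idl_extend)
    show "extend n B f \<subseteq> extend n J f" using BJ by (auto simp: extend_def)
    \<comment> \<open>The sequence \<open>x\<close>, \<open>f\<close> is regular modulo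
      \<open>B\<close>, and \<open>x\<close> stays regular modulo \<open>B + (f)\<close>: in
      \<open>x c = b + f a\<close>, regularity of \<open>f\<close> modulo \<open>(x, B)\<close>
      gives \<open>a = b' + x e\<close>, and then \<open>x\<close> can be cancelled.\<close>
    show "nonzerodiv n (extend n B f) x"
      unfolding nonzerodiv_def
    proof (intro ballI impI)
      fix c assume c: "c \<in> polys n" "x * c \<in> extend n B f"
      then obtain b a where ba: "x * c = b + f * a" "b \<in> B" "a \<in> polys n" by (auto simp: extend_def)
      have "f * a = - b + x * c" using ba(1) by simp
      also have "\<dots> \<in> extend n B x" using idlD(7)[OF B ba(2)] c(1) by (rule extendI)
      finally have "a \<in> extend n B x" using fP ba(3) by (auto simp: nonzerodiv_def)
      then obtain b' e where e: "a = b' + x * e" "b' \<in> B" "e \<in> polys n" by (auto simp: extend_def)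
      have "x * (c - f * e) = b + f * b'" using ba(1) unfolding e(1) by (simp add: algebra_simps)
      also have "\<dots> \<in> B" by (intro idlD(3)[OF B] idlD(4)[OF B] ba(2) e(2) f)
      finally have "x * (c - f * e) \<in> B" .
      then have "c - f * e \<in> B" using c(1) f e(3) by (rule xB[OF polys_diff[OF _ polys_mult], rotated 3])
      from extendI[OF this e(3), of f] show "c \<in> extend n B f" by simp
    qed
    have "extend n (extend n B x) f = extend n (extend n B f) x"
      using extend_swap by blast
    then show "weakly_regular n (extend n (extend n B f) x) fs" using Cons.prems(8) by simp
  qed (use Cons.prems x in auto)
  ultimately show ?case by (simp add: extend_scale_mod[OF J x])
qed simp


subsection \<open>Substitutions\<close>

definition subst_mono :: "(nat \<Rightarrow> 'k::field mpoly) \<Rightarrow> exps \<Rightarrow> 'k mpoly"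
  where "subst_mono g u = (\<Prod>i\<in>Poly_Mapping.keys u. g i ^ Poly_Mapping.lookup u i)"

definition subst :: "(nat \<Rightarrow> 'k::field mpoly) \<Rightarrow> 'k mpoly \<Rightarrow> 'k mpoly"
  where "subst g p = (\<Sum>u\<in>Poly_Mapping.keys p. Poly_Mapping.single 0 (Poly_Mapping.lookup p u) * subst_mono g u)"

lemma subst_mono_add: "subst_mono g (u + v) = subst_mono g u * subst_mono g v"
proof -
  let ?S = "Poly_Mapping.keys u \<union> Poly_Mapping.keys v"
  have s: "subst_mono g w = (\<Prod>i\<in>?S. g i ^ Poly_Mapping.lookup w i)" if "Poly_Mapping.keys w \<subseteq> ?S" for w
    unfolding subst_mono_def using that by (intro prod.mono_neutral_left) (auto simp: in_keys_iff)
  show ?thesis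
    using s[of "u + v"] s[of u] s[of v] by (simp add: keys_add_nat lookup_add power_add prod.distrib)
qed

lemma subst_mono_0 [simp]: "subst_mono g 0 = 1"
  by (simp add: subst_mono_def)

lemma subst_add: "subst g (p + q) = subst g p + subst g q"
proof -
  let ?S = "Poly_Mapping.keys p \<union> Poly_Mapping.keys q"
  have s: "subst g r = (\<Sum>u\<in>?S. Poly_Mapping.single 0 (Poly_Mapping.lookup r u) * subst_mono g u)"
    if "Poly_Mapping.keys r \<subseteq> ?S" for r
    unfolding subst_def using that by (intro sum.mono_neutral_left) (auto simp: in_keys_iff)
  show ?thesis
    using s[of "p + q"] s[of p] s[of q] keys_add[of p q]
    by (simp add: lookup_add single_add distrib_right sum.distrib)
qed

lemma subst_0 [simp]: "subst g 0 = 0"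
  by (simp add: subst_def)

lemma subst_single: "subst g (Poly_Mapping.single u c) = Poly_Mapping.single 0 c * subst_mono g u"
  by (cases "c = 0") (simp_all add: subst_def)

lemma subst_mult: "subst g (p * q) = subst g p * subst g q"
proof (induction p rule: poly_induct[OF order_refl])
  case (2 u c p)
  have "subst g (Poly_Mapping.single u c * q) = subst g (Poly_Mapping.single u c) * subst g q"
  proof (induction q rule: poly_induct[OF order_refl])
    case (2 v d q)
    have "Poly_Mapping.single 0 (c * d) = Poly_Mapping.single 0 c * (Poly_Mapping.single 0 d :: 'a mpoly)"
      by (simp add: mult_single)
    then show ?case
      using 2 by (simp add: distrib_left subst_add mult_single subst_single subst_mono_add mult_ac)
  qed simp
  then show ?case using 2 by (simp add: distrib_right subst_add)
qed simp

lemma subst_diff: "subst g (p - q) = subst g p - subst g q"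
  using subst_add[of g "p - q" q] by simp

lemma subst_uminus [simp]: "subst g (- p) = - subst g p"
  using subst_diff[of g 0 p] by simp

lemma subst_const [simp]: "subst g (Poly_Mapping.single 0 c) = Poly_Mapping.single 0 c"
  by (simp add: subst_single)

lemma subst_1 [simp]: "subst g 1 = 1"
  using subst_const[of g 1] by simp

lemma subst_X [simp]: "subst g (X i) = g i"
  by (simp add: X_def mono_poly_def subst_single subst_mono_def)

lemma subst_power: "subst g (p ^ k) = subst g p ^ k"
  by (induction k) (simp_all add: subst_mult)

lemma subst_prod: "subst g (prod f S) = (\<Prod>i\<in>S. subst g (f i))"
  by (induction S rule: infinite_finite_induct) (simp_all add: subst_mult)

lemma subst_compose: "subst (\<lambda>i. subst \<sigma> (g i)) p = subst \<sigma> (subst g p)"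
proof (induction p rule: poly_induct[OF order_refl])
  case (2 u c p)
  then show ?case
    by (simp add: subst_add subst_single subst_mult subst_mono_def subst_prod subst_power)
qed simp

lemma single_eq_subst_mono: "Poly_Mapping.single u (1 :: 'k::field) = subst_mono X u"
proof -
  have pow: "X i ^ k = Poly_Mapping.single (Poly_Mapping.single i k) (1 :: 'k)" for i k
    by (induction k) (auto simp: X_def mono_poly_def mult_single single_add[symmetric])
  have prod: "(\<Prod>i\<in>S. Poly_Mapping.single (f i) (1 :: 'k)) = Poly_Mapping.single (sum f S) 1"
    for S and f :: "nat \<Rightarrow> exps"
    by (induction S rule: infinite_finite_induct) (auto simp: mult_single)
  show ?thesis
    unfolding subst_mono_def pow prod poly_as_sum[of u, symmetric] ..
qed

text \<open>A congruence that holds for the variables passes to products and sums. This gives the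
  half of the kernel description that \<open>presents\<close> does not contain outright.\<close>

lemma diff_subst_in_idl:
  assumes L: "idl n L" and g: "\<And>i. i \<in> {1..n} \<Longrightarrow> g i \<in> polys n \<and> X i - g i \<in> L"
    and p: "p \<in> polys n"
  shows "p - subst g p \<in> L"
proof -
  have mult: "a * b - a' * b' \<in> L \<and> a' * b' \<in> polys n"
    if "a - a' \<in> L \<and> a' \<in> polys n" "b - b' \<in> L \<and> b' \<in> polys n" for a a' b b'
  proof
    have b: "b \<in> polys n" using that(2) polys_add[of "b - b'" n b'] idlD(1)[OF L] by auto
    have "(a - a') * b + a' * (b - b') \<in> L" using that b by (intro idlD(3,4,5)[OF L]) auto
    then show "a * b - a' * b' \<in> L" by (simp add: algebra_simps)
    show "a' * b' \<in> polys n" using that by (simp add: polys_mult)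
  qed
  have one: "(1 - 1 :: 'a mpoly) \<in> L \<and> (1 :: 'a mpoly) \<in> polys n" using idlD(2)[OF L] by simp
  have pow: "X i ^ k - g i ^ k \<in> L \<and> g i ^ k \<in> polys n" if i: "i \<in> {1..n}" for i k
  proof (induction k)
    case (Suc k)
    have "X i - g i \<in> L \<and> g i \<in> polys n" using g[OF i] by blast
    from mult[OF this Suc] show ?case by simp
  qed (use one in simp)
  have prod: "(\<Prod>i\<in>S. X i ^ f i) - (\<Prod>i\<in>S. g i ^ f i) \<in> L \<and> (\<Prod>i\<in>S. g i ^ f i) \<in> polys n"
    if S: "finite S" "S \<subseteq> {1..n}" for S f
    using S
  proof (induction S rule: finite_induct)
    case (insert i S)
    have "X i ^ f i - g i ^ f i \<in> L \<and> g i ^ f i \<in> polys n" using insert.prems by (intro pow) auto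
    from mult[OF this insert.IH] insert show ?case by simp
  qed (use one in simp)
  have "Poly_Mapping.keys p \<subseteq> monoms n" using p by (simp add: polys_def)
  then show ?thesis
  proof (induction p rule: poly_induct)
    case zero
    then show ?case using idlD(2)[OF L] by simp
  next
    case (add u c p)
    have c: "Poly_Mapping.single 0 c \<in> polys n" by (rule single_in_polys) (simp add: monoms_def)
    have "Poly_Mapping.single u c = Poly_Mapping.single 0 c * subst_mono X u"
      unfolding single_eq_subst_mono[symmetric] by (simp add: mult_single)
    then have "Poly_Mapping.single u c - Poly_Mapping.single 0 c * subst_mono g u
        = Poly_Mapping.single 0 c * (subst_mono X u - subst_mono g u)"
      by (simp only: right_diff_distrib)
    then have eq: "Poly_Mapping.single u c + p - subst g (Poly_Mapping.single u c + p)
        = Poly_Mapping.single 0 c * (subst_mono X u - subst_mono g u) + (p - subst g p)"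
      unfolding subst_add subst_single by (simp only: add_diff_add)
    have "subst_mono X u - subst_mono g u \<in> L"
      unfolding subst_mono_def using prod[of "Poly_Mapping.keys u"] add.hyps(1) by (simp add: monoms_def)
    then show ?case unfolding eq by (intro idlD(3)[OF L] idlD(4)[OF L] add.IH c)
  qed
qed

text \<open>\<open>L\<close> is the kernel of the substitution \<open>g\<close>.\<close>

definition presents :: "nat \<Rightarrow> 'k::field mpoly set \<Rightarrow> (nat \<Rightarrow> 'k mpoly) \<Rightarrow> bool"
  where "presents n L g \<longleftrightarrow> idl n L \<and> (\<forall>p\<in>L. subst g p = 0) \<and>
    (\<forall>i\<in>{1..n}. g i \<in> polys n \<and> X i - g i \<in> L)"

text \<open>The substitution embeds A/L into a polynomial ring, which is a domain.\<close>

lemma presents_nonzerodiv: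
  assumes L: "presents n L g" and h: "subst g h \<noteq> 0"
  shows "nonzerodiv n L h"
  unfolding nonzerodiv_def
proof (intro ballI impI)
  fix p assume p: "p \<in> polys n" "h * p \<in> L"
  then have "subst g h * subst g p = 0" using L by (auto simp: presents_def subst_mult[symmetric])
  with h have "subst g p = 0" by simp
  moreover have "p - subst g p \<in> L"
    using L p(1) by (intro diff_subst_in_idl) (auto simp: presents_def)
  ultimately show "p \<in> L" by simp
qed

text \<open>The image of \<open>h\<close> is killed by a further substitution
  \<open>\<sigma>\<close>, which may move the variables only by elements of the enlarged
  ideal.\<close>

lemma presents_extend:
  assumes L: "presents n L g" and h: "h \<in> polys n"
    and \<sigma>: "\<And>i. i \<in> {1..n} \<Longrightarrow> \<sigma> i \<in> polys n \<and> X i - \<sigma> i \<in> extend n L h"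
    and 0: "subst \<sigma> (subst g h) = 0"
  shows "presents n (extend n L h) (\<lambda>i. subst \<sigma> (g i))"
  unfolding presents_def
proof (intro conjI ballI)
  have iL: "idl n L" using L by (simp add: presents_def)
  then show E: "idl n (extend n L h)" using h by (rule idl_extend)
  fix p assume "p \<in> extend n L h"
  then obtain l q where "p = l + h * q" "l \<in> L" by (auto simp: extend_def)
  then show "subst (\<lambda>i. subst \<sigma> (g i)) p = 0"
    using L 0 by (simp add: subst_compose subst_add subst_mult presents_def)
next
  have iL: "idl n L" using L by (simp add: presents_def)
  then have E: "idl n (extend n L h)" using h by (rule idl_extend)
  fix i assume i: "i \<in> {1..n}"
  have gi: "g i \<in> polys n" "X i - g i \<in> extend n L h"
    using L i extend_superset[of L n h] by (auto simp: presents_def)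
  have d: "g i - subst \<sigma> (g i) \<in> extend n L h" by (rule diff_subst_in_idl[OF E \<sigma> gi(1)])
  then have "g i - subst \<sigma> (g i) \<in> polys n" using idlD(1)[OF E] by blast
  from polys_diff[OF gi(1) this] show "subst \<sigma> (g i) \<in> polys n" by simp
  from idlD(3)[OF E gi(2) d] show "X i - subst \<sigma> (g i) \<in> extend n L h" by simp
qed

lemma X_inject [simp]: "X i = (X j :: 'k::field mpoly) \<longleftrightarrow> i = j"
proof
  assume "X i = (X j :: 'k mpoly)"
  then have "Poly_Mapping.single i (1::nat) = Poly_Mapping.single j 1"
    unfolding X_def by (metis keys_mono_poly singleton_inject)
  then have "{i} = {j}" by (metis keys_single one_neq_zero)
  then show "i = j" by simp
qed simp

text \<open>At most one of the variables \<open>b\<close>, \<open>vs\<close> is sent to zero and the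
  others are fixed, so the first difference has nonzero image. The quotient by it is of the same
  kind for the remaining variables: a nonzero \<open>X v\<close> is eliminated, and if
  \<open>X v\<close> is zero, then \<open>X b\<close> takes over as the one that is zero.\<close>

lemma weakly_regular_differences:
  fixes L :: "'k::field mpoly set"
  assumes "presents n L g" "distinct (b # vs)" "set (b # vs) \<subseteq> {1..n}"
    and "\<forall>v\<in>set (b # vs). g v = 0 \<or> g v = X v"
    and "\<forall>v\<in>set (b # vs). \<forall>w\<in>set (b # vs). g v = 0 \<longrightarrow> g w = 0 \<longrightarrow> v = w"
  shows "weakly_regular n L (map (\<lambda>v. X v - X b) vs)"
  using assms
proof (induction vs arbitrary: L g)
  case (Cons v vs)
  let ?h = "X v - X b :: 'k mpoly"
  note L = Cons.prems(1)
  have iL: "idl n L" using L by (simp add: presents_def)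
  have bv: "b \<noteq> v" "v \<notin> set vs" "b \<notin> set vs" "v \<in> {1..n}" "b \<in> {1..n}" using Cons.prems(2,3) by auto
  have gv: "g v = 0 \<or> g v = X v" and gb: "g b = 0 \<or> g b = X b" using Cons.prems(4) by auto
  have z: "\<not> (g v = 0 \<and> g b = 0)" using Cons.prems(5) bv(1) by auto
  have h: "?h \<in> polys n" using bv by (intro polys_diff X_in_polys)
  have hL: "?h \<in> extend n L ?h" using extend_self[OF iL polys_1, of ?h] by simp
  have E: "idl n (extend n L ?h)" using iL h by (rule idl_extend)
  have sub: "X i - g i \<in> extend n L ?h" "g i \<in> polys n" if "i \<in> {1..n}" for i
    using that L extend_superset[of L n ?h] by (auto simp: presents_def)
  have "nonzerodiv n L ?h"
    using gv gb z bv(1) by (intro presents_nonzerodiv[OF L]) (auto simp: subst_diff)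
  moreover have "weakly_regular n (extend n L ?h) (map (\<lambda>v. X v - X b) vs)"
  proof (cases "g v = 0")
    case False
    then have gv: "g v = X v" using gv by blast
    \<comment> \<open>The value is \<open>g b\<close> instead of \<open>X b\<close>, since
      \<open>X b\<close> may already be zero modulo \<open>L\<close>.\<close>
    define \<sigma> where "\<sigma> = (X :: nat \<Rightarrow> 'k mpoly)(v := g b)"
    have \<sigma>g: "subst \<sigma> (g w) = g w" if "w \<in> set (b # vs)" for w
    proof -
      have "w \<noteq> v" "g w = 0 \<or> g w = X w" using that bv Cons.prems(4) by auto
      then show ?thesis by (auto simp: \<sigma>_def)
    qed
    have "presents n (extend n L ?h) (\<lambda>i. subst \<sigma> (g i))"
    proof (rule presents_extend[OF L h])
      fix i assume i: "i \<in> {1..n}"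
      have "X v - g b = (X v - X b) + (X b - g b)" by simp
      also have "\<dots> \<in> extend n L ?h" by (intro idlD(3)[OF E] hL sub bv)
      finally show "\<sigma> i \<in> polys n \<and> X i - \<sigma> i \<in> extend n L ?h"
        using i sub(2)[OF bv(5)] idlD(2)[OF E] by (auto simp: \<sigma>_def intro: X_in_polys)
    next
      show "subst \<sigma> (subst g ?h) = 0"
        using \<sigma>g[of b] gv by (simp add: subst_diff \<sigma>_def)
    qed
    then show ?thesis
    proof (rule Cons.IH)
      show "\<forall>w\<in>set (b # vs). subst \<sigma> (g w) = 0 \<or> subst \<sigma> (g w) = X w"
        using Cons.prems(4) by (intro ballI) (simp only: \<sigma>g, auto)
      show "\<forall>w\<in>set (b # vs). \<forall>w'\<in>set (b # vs). subst \<sigma> (g w) = 0 \<longrightarrow> subst \<sigma> (g w') = 0 \<longrightarrow> w = w'"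
        using Cons.prems(5) by (intro ballI) (simp only: \<sigma>g, auto)
    qed (use Cons.prems(2,3) in auto)
  next
    case True
    then have gb: "g b = X b" using gb z by blast
    define \<sigma> where "\<sigma> = (X :: nat \<Rightarrow> 'k mpoly)(b := 0)"
    have gw: "g w = X w" if "w \<in> set vs" for w
    proof -
      have "w \<noteq> v" using that bv(2) by blast
      moreover have "g v = 0 \<longrightarrow> g w = 0 \<longrightarrow> v = w" using Cons.prems(5) that by simp
      ultimately have "g w \<noteq> 0" using True by blast
      moreover have "g w = 0 \<or> g w = X w" using Cons.prems(4) that by simp
      ultimately show ?thesis by blast
    qed
    have \<sigma>g: "subst \<sigma> (g w) = X w" if "w \<in> set vs" for w
      using gw[OF that] that bv by (auto simp: \<sigma>_def)
    have \<sigma>b: "subst \<sigma> (g b) = 0" by (simp add: gb \<sigma>_def)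
    have "presents n (extend n L ?h) (\<lambda>i. subst \<sigma> (g i))"
    proof (rule presents_extend[OF L h])
      fix i assume i: "i \<in> {1..n}"
      have "X b = (X v - g v) - (X v - X b)" using True by simp
      also have "\<dots> \<in> extend n L ?h" by (intro idlD(6)[OF E] hL sub bv)
      finally show "\<sigma> i \<in> polys n \<and> X i - \<sigma> i \<in> extend n L ?h"
        using i idlD(2)[OF E] by (auto simp: \<sigma>_def intro: X_in_polys)
    next
      show "subst \<sigma> (subst g ?h) = 0"
        using True gb by (simp add: subst_diff \<sigma>_def)
    qed
    then show ?thesis
      by (rule Cons.IH) (use Cons.prems(2,3) \<sigma>g \<sigma>b in auto)
  qed
  ultimately show ?case by simp
qed simp

lemma presents_variables:
  assumes "Z \<subseteq> {1..n}"
  shows "presents n (sqid n ((\<lambda>z. {z}) ` Z)) (\<lambda>i. if i \<in> Z then 0 else (X i :: 'k::field mpoly))"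
  unfolding presents_def
proof (intro conjI ballI idl_sqid)
  let ?g = "\<lambda>i. if i \<in> Z then 0 else (X i :: 'k mpoly)"
  have L: "idl n (sqid n ((\<lambda>z. {z}) ` Z) :: 'k mpoly set)" by (rule idl_sqid)
  {
    fix p :: "'k mpoly" assume p: "p \<in> sqid n ((\<lambda>z. {z}) ` Z)"
    have "subst_mono ?g u = 0" if "u \<in> Poly_Mapping.keys p" for u
    proof -
      have "\<exists>z\<in>Z. z \<in> Poly_Mapping.keys u" using p that by (simp add: sqid_def)
      then obtain z where z: "z \<in> Z" "z \<in> Poly_Mapping.keys u" by blast
      then have "?g z ^ Poly_Mapping.lookup u z = 0" by (simp add: in_keys_iff)
      then have "\<exists>i\<in>Poly_Mapping.keys u. ?g i ^ Poly_Mapping.lookup u i = 0" using z(2) by blast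
      then show ?thesis unfolding subst_mono_def by (intro prod_zero) simp_all
    qed
    then show "subst ?g p = 0" by (simp add: subst_def)
  }
  fix i assume i: "i \<in> {1..n}"
  have Xi: "(X i :: 'k mpoly) \<in> polys n" using i by (rule X_in_polys)
  then show "?g i \<in> polys n" by simp
  show "X i - ?g i \<in> sqid n ((\<lambda>z. {z}) ` Z)"
  proof (cases "i \<in> Z")
    case True
    then show ?thesis using Xi by (auto simp: sqid_def X_def)
  qed (use idlD(2)[OF L] in simp)
qed

text \<open>\<open>Y\<close> collects variables already set to zero, so that an added variable can
  be moved into it. A factor \<open>x\<close> produces the quotient A/(x, Y), where \<open>x\<close>
  is the only variable among \<open>b\<close>, \<open>vs\<close> that may vanish; in the base case
  \<open>b\<close> is the only one. Thus never more than one is lost, as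
  \<open>weakly_regular_differences\<close> requires.\<close>

theorem stair_weakly_regular:
  assumes "stair b A R G" "A \<union> R \<subseteq> {1..n}" "Y \<subseteq> {1..n}" "Y \<inter> (A \<union> R) = {}"
    and "distinct vs" "set vs \<subseteq> {1..n}" "set vs \<inter> (A \<union> Y) = {}"
  shows "weakly_regular n (sqid n (G \<union> (\<lambda>z. {z}) ` Y)) (map (\<lambda>v. X v - X b :: 'k::field mpoly) vs)"
  using assms
proof (induction arbitrary: Y rule: stair.induct)
  case (base b)
  have Z: "insert b Y \<subseteq> {1..n}" using base by auto
  have "weakly_regular n (sqid n ((\<lambda>z. {z}) ` insert b Y)) (map (\<lambda>v. X v - X b :: 'k mpoly) vs)"
    by (rule weakly_regular_differences[OF presents_variables[OF Z]]) (use base in auto)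
  then show ?case by simp
next
  case (add b A R G x)
  have "weakly_regular n (sqid n (G \<union> (\<lambda>z. {z}) ` insert x Y)) (map (\<lambda>v. X v - X b :: 'k mpoly) vs)"
    using add.prems add.hyps(2) by (intro add.IH) auto
  then show ?case by simp
next
  case (mul b A R G x)
  note st = stair_facts[OF mul.hyps(1)]
  let ?Y = "(\<lambda>z. {z}) ` Y" and ?hs = "map (\<lambda>v. X v - X b :: 'k mpoly) vs"
  have x: "x \<in> {1..n}" "x \<notin> \<Union> G" "x \<notin> \<Union> ?Y" using mul.prems mul.hyps(2) st(6) by auto
  have b: "b \<in> {1..n}" "b \<notin> Y" "b \<noteq> x" "b \<notin> set vs" using mul.prems mul.hyps(2) st(4) by auto
  have "weakly_regular n (scale_mod (X x) (sqid n (G \<union> ?Y)) (sqid n ?Y)) ?hs"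
  proof (rule weakly_regular_scale_mod)
    show "idl n (sqid n (G \<union> ?Y) :: 'k mpoly set)" "idl n (sqid n ?Y :: 'k mpoly set)" by (rule idl_sqid)+
    show "sqid n ?Y \<subseteq> (sqid n (G \<union> ?Y) :: 'k mpoly set)" unfolding sqid_def by blast
    show "X x \<in> polys n" using x(1) by (rule X_in_polys)
    show "nonzerodiv n (sqid n ?Y) (X x)" using x(3) by (rule nonzerodiv_sqid)
    show "set ?hs \<subseteq> polys n" using mul.prems(5) b(1) by (auto intro!: polys_diff X_in_polys)
    show "weakly_regular n (sqid n (G \<union> ?Y)) ?hs" using mul.prems by (intro mul.IH) auto
    have Z: "insert x Y \<subseteq> {1..n}" using x(1) mul.prems(2) by auto
    have "weakly_regular n (sqid n ((\<lambda>z. {z}) ` insert x Y)) ?hs"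
      by (rule weakly_regular_differences[OF presents_variables[OF Z]]) (use mul.prems b in auto)
    then show "weakly_regular n (extend n (sqid n ?Y) (X x)) ?hs"
      by (simp add: extend_sqid[OF x(1)])
  qed
  then show ?case unfolding scale_mod_sqid[OF x(1,2)] .
qed


section \<open>Depth of the quotient module\<close>

lemma irrelevant_ideal_iff:
  "p \<in> irrelevant_ideal n \<longleftrightarrow> p \<in> polys n \<and> Poly_Mapping.lookup p 0 = (0 :: 'k::field)"
proof -
  have "(\<lambda>i. mono_poly (Poly_Mapping.single i 1)) ` {1..n}
      = (mono_poly :: exps \<Rightarrow> 'k mpoly) ` (\<lambda>i. Poly_Mapping.single i 1) ` {1..n}"
    by (simp add: image_image)
  moreover have "(\<lambda>i. Poly_Mapping.single i 1) ` {1..n} \<subseteq> sqfree_monoms n"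
    by (auto simp: sqfree_monoms_def monoms_def lookup_single when_def)
  moreover have "Poly_Mapping.keys ` (\<lambda>i. Poly_Mapping.single i (1::nat)) ` {1..n} = (\<lambda>i. {i}) ` {1..n}"
    by (simp add: image_image)
  ultimately have "irrelevant_ideal n = (sqid n ((\<lambda>i. {i}) ` {1..n}) :: 'k mpoly set)"
    unfolding irrelevant_ideal_def by (simp only: genideal_sqfree)
  then show ?thesis by (simp only: maximal_sqid_iff)
qed

lemma (in module) seq_mult_snoc:
  assumes "set (fs @ [f]) \<subseteq> carrier R"
  shows "seq_mult M (fs @ [f]) = {a \<oplus>\<^bsub>M\<^esub> f \<odot>\<^bsub>M\<^esub> y | a y. a \<in> seq_mult M fs \<and> y \<in> carrier M}"
proof -
  have "(\<Oplus>\<^bsub>M\<^esub>i\<in>{..<length (fs @ [f])}. ((fs @ [f]) ! i) \<odot>\<^bsub>M\<^esub> x i)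
      = (\<Oplus>\<^bsub>M\<^esub>i\<in>{..<length fs}. (fs ! i) \<odot>\<^bsub>M\<^esub> x i) \<oplus>\<^bsub>M\<^esub> f \<odot>\<^bsub>M\<^esub> x (length fs)"
    if x: "x \<in> {..<Suc (length fs)} \<rightarrow> carrier M" for x
  proof -
    have c: "fs ! i \<odot>\<^bsub>M\<^esub> x i \<in> carrier M" if "i < length fs" for i
      using that assms x nth_mem[of i fs] by (intro smult_closed) auto
    have cf: "f \<odot>\<^bsub>M\<^esub> x (length fs) \<in> carrier M"
      using assms x by (intro smult_closed) auto
    have "(\<Oplus>\<^bsub>M\<^esub>i\<in>{..<length (fs @ [f])}. ((fs @ [f]) ! i) \<odot>\<^bsub>M\<^esub> x i)
        = (\<Oplus>\<^bsub>M\<^esub>i\<in>insert (length fs) {..<length fs}. ((fs @ [f]) ! i) \<odot>\<^bsub>M\<^esub> x i)"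
      by (simp add: lessThan_Suc)
    also have "\<dots> = ((fs @ [f]) ! length fs) \<odot>\<^bsub>M\<^esub> x (length fs)
        \<oplus>\<^bsub>M\<^esub> (\<Oplus>\<^bsub>M\<^esub>i\<in>{..<length fs}. ((fs @ [f]) ! i) \<odot>\<^bsub>M\<^esub> x i)"
      using c cf by (intro M.finsum_insert) (auto simp: nth_append)
    also have "(\<Oplus>\<^bsub>M\<^esub>i\<in>{..<length fs}. ((fs @ [f]) ! i) \<odot>\<^bsub>M\<^esub> x i)
        = (\<Oplus>\<^bsub>M\<^esub>i\<in>{..<length fs}. (fs ! i) \<odot>\<^bsub>M\<^esub> x i)"
      using c by (intro M.finsum_cong') (auto simp: nth_append)
    finally show ?thesis
      using c cf by (simp add: M.a_comm M.finsum_closed Pi_def)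
  qed
  note step = this
  show ?thesis
  proof (intro equalityI subsetI)
    fix z assume "z \<in> seq_mult M (fs @ [f])"
    then obtain x where x: "x \<in> {..<Suc (length fs)} \<rightarrow> carrier M"
      "z = (\<Oplus>\<^bsub>M\<^esub>i\<in>{..<length (fs @ [f])}. ((fs @ [f]) ! i) \<odot>\<^bsub>M\<^esub> x i)"
      unfolding seq_mult_def by auto
    have "(\<Oplus>\<^bsub>M\<^esub>i\<in>{..<length fs}. (fs ! i) \<odot>\<^bsub>M\<^esub> x i) \<in> seq_mult M fs"
      using x(1) unfolding seq_mult_def by (intro CollectI exI[of _ x] conjI refl) auto
    moreover have "x (length fs) \<in> carrier M" using x(1) by auto
    ultimately show "z \<in> {a \<oplus>\<^bsub>M\<^esub> f \<odot>\<^bsub>M\<^esub> y | a y. a \<in> seq_mult M fs \<and> y \<in> carrier M}"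
      unfolding x(2) step[OF x(1)] by blast
  next
    fix z assume "z \<in> {a \<oplus>\<^bsub>M\<^esub> f \<odot>\<^bsub>M\<^esub> y | a y. a \<in> seq_mult M fs \<and> y \<in> carrier M}"
    then obtain a y where z: "z = a \<oplus>\<^bsub>M\<^esub> f \<odot>\<^bsub>M\<^esub> y" "a \<in> seq_mult M fs" "y \<in> carrier M"
      by (elim CollectE exE conjE)
    obtain x where x: "x \<in> {..<length fs} \<rightarrow> carrier M" "a = (\<Oplus>\<^bsub>M\<^esub>i\<in>{..<length fs}. (fs ! i) \<odot>\<^bsub>M\<^esub> x i)"
      using z(2) unfolding seq_mult_def by (elim CollectE exE conjE)
    let ?x = "x(length fs := y)"
    have x': "?x \<in> {..<Suc (length fs)} \<rightarrow> carrier M" using x(1) z(3) by (auto simp: Pi_def less_Suc_eq)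
    have "(\<Oplus>\<^bsub>M\<^esub>i\<in>{..<length fs}. (fs ! i) \<odot>\<^bsub>M\<^esub> ?x i) = a"
    proof -
      have "fs ! i \<odot>\<^bsub>M\<^esub> x i \<in> carrier M" if "i < length fs" for i
        using that assms x nth_mem[of i fs] by (intro smult_closed) auto
      then show ?thesis unfolding x(2) by (intro M.finsum_cong') auto
    qed
    then have "z = (\<Oplus>\<^bsub>M\<^esub>i\<in>{..<length (fs @ [f])}. ((fs @ [f]) ! i) \<odot>\<^bsub>M\<^esub> ?x i)"
      unfolding step[OF x'] by (simp only: z(1) fun_upd_same)
    with x' show "z \<in> seq_mult M (fs @ [f])"
      unfolding seq_mult_def mem_Collect_eq length_append_singleton by (intro exI conjI)
  qed
qed

section \<open>Regular sequences on A/I in terms of ideals of A\<close>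

context
  fixes n :: nat and I :: "'k::field mpoly set"
  assumes I: "idl n I"
begin

private abbreviation (input) "P \<equiv> poly_ring n :: 'k mpoly ring"
private abbreviation (input) "M \<equiv> quot_module P I"

interpretation P: cring P by (rule cring_poly_ring)
interpretation I: ideal I P using I by (simp add: ideal_iff_idl)
interpretation h: ring_hom_ring P "P Quot I" "(+>\<^bsub>P\<^esub>) I" by (rule I.rcos_ring_hom_ring)
interpretation M: module P M by (rule module_quot_module) (fact P.cring_axioms I.ideal_axioms)+

lemma carrier_quot_module: "carrier M = (+>\<^bsub>P\<^esub>) I ` polys n"
  by (auto simp: FactRing_def A_RCOSETS_def')

lemma coset_eq_iff:
  assumes "p \<in> polys n" "q \<in> polys n"
  shows "I +>\<^bsub>P\<^esub> p = I +>\<^bsub>P\<^esub> q \<longleftrightarrow> p - q \<in> I"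
proof
  assume eq: "I +>\<^bsub>P\<^esub> p = I +>\<^bsub>P\<^esub> q"
  have "p \<in> I +>\<^bsub>P\<^esub> p" using idlD(2)[OF I] unfolding a_r_coset_def' by force
  then have "p \<in> I +>\<^bsub>P\<^esub> q" by (simp only: eq)
  then obtain i where "i \<in> I" "p = i + q" unfolding a_r_coset_def' poly_ring_simps by blast
  then show "p - q \<in> I" by simp
next
  assume pq: "p - q \<in> I"
  have "i + p \<in> I +>\<^bsub>P\<^esub> q" if "i \<in> I" for i
    using idlD(3)[OF I that pq] unfolding a_r_coset_def' by (auto intro!: bexI[of _ "i + (p - q)"])
  moreover have "i + q \<in> I +>\<^bsub>P\<^esub> p" if "i \<in> I" for i
    using idlD(6)[OF I that pq] unfolding a_r_coset_def' by (auto intro!: bexI[of _ "i - (p - q)"])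
  ultimately show "I +>\<^bsub>P\<^esub> p = I +>\<^bsub>P\<^esub> q"
    unfolding a_r_coset_def' by auto
qed

text \<open>Submodules of A/I correspond to ideals containing \<open>I\<close>; the fold computes
  the ideal generated by \<open>I\<close> and the sequence.\<close>

lemma seq_mult_eq:
  assumes "set fs \<subseteq> polys n"
  shows "seq_mult M fs = (+>\<^bsub>P\<^esub>) I ` foldl (extend n) I fs"
  using assms
proof (induction fs rule: rev_induct)
  case Nil
  have "seq_mult M [] = {\<zero>\<^bsub>M\<^esub>}" by (auto simp: seq_mult_def)
  also have "\<dots> = {I +>\<^bsub>P\<^esub> 0}" using h.hom_zero by simp
  also have "\<dots> = (+>\<^bsub>P\<^esub>) I ` I"
  proof -
    have "I +>\<^bsub>P\<^esub> 0 = I +>\<^bsub>P\<^esub> i" if "i \<in> I" for i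
      using that idlD(1,7)[OF I] by (subst coset_eq_iff) auto
    then have "(+>\<^bsub>P\<^esub>) I ` I = (\<lambda>_. I +>\<^bsub>P\<^esub> 0) ` I" by (intro image_cong) simp_all
    also have "\<dots> = {I +>\<^bsub>P\<^esub> 0}" by (rule image_constant[OF idlD(2)[OF I]])
    finally show ?thesis ..
  qed
  finally show ?case by simp
next
  case (snoc f fs)
  let ?J = "foldl (extend n) I fs"
  have fs: "set fs \<subseteq> polys n" "f \<in> polys n" using snoc.prems by auto
  have J: "idl n ?J" using I fs(1) by (rule idl_foldl_extend)
  have hom: "(I +>\<^bsub>P\<^esub> p) \<oplus>\<^bsub>M\<^esub> f \<odot>\<^bsub>M\<^esub> (I +>\<^bsub>P\<^esub> q) = I +>\<^bsub>P\<^esub> (p + f * q)"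
    if "p \<in> ?J" "q \<in> polys n" for p q
  proof -
    have "p \<in> polys n" using that(1) idlD(1)[OF J] by blast
    then show ?thesis using that(2) fs(2) polys_mult[OF fs(2) that(2)] h.hom_add h.hom_mult by simp
  qed
  have "seq_mult M (fs @ [f]) = {(I +>\<^bsub>P\<^esub> p) \<oplus>\<^bsub>M\<^esub> f \<odot>\<^bsub>M\<^esub> (I +>\<^bsub>P\<^esub> q) | p q. p \<in> ?J \<and> q \<in> polys n}"
    unfolding M.seq_mult_snoc[OF snoc.prems[folded poly_ring_simps(1)]] snoc.IH[OF fs(1)] carrier_quot_module by blast
  also have "\<dots> = {I +>\<^bsub>P\<^esub> (p + f * q) | p q. p \<in> ?J \<and> q \<in> polys n}"
    using hom by (intro Collect_cong) metis
  also have "\<dots> = (+>\<^bsub>P\<^esub>) I ` extend n ?J f"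
    unfolding extend_def by blast
  finally show ?case by simp
qed

lemma coset_in_image_iff:
  assumes "idl n J" "I \<subseteq> J" "p \<in> polys n"
  shows "I +>\<^bsub>P\<^esub> p \<in> (+>\<^bsub>P\<^esub>) I ` J \<longleftrightarrow> p \<in> J"
proof
  assume "I +>\<^bsub>P\<^esub> p \<in> (+>\<^bsub>P\<^esub>) I ` J"
  then obtain q where q: "q \<in> J" "I +>\<^bsub>P\<^esub> p = I +>\<^bsub>P\<^esub> q" by blast
  have "q \<in> polys n" using q(1) idlD(1)[OF assms(1)] by blast
  then have "p - q \<in> J" using coset_eq_iff[OF assms(3)] q(2) assms(2) by blast
  from idlD(3)[OF assms(1) this q(1)] show "p \<in> J" by simp
qed blast

lemma regular_seq_iff:
  assumes fs: "set fs \<subseteq> polys n"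
  shows "regular_seq M fs \<longleftrightarrow> weakly_regular n I fs \<and> foldl (extend n) I fs \<noteq> polys n"
proof -
  have J: "idl n (foldl (extend n) I (take k fs))" "set (take k fs) \<subseteq> polys n" for k
    using fs set_take_subset[of k fs] by (auto intro!: idl_foldl_extend I)
  have "(\<forall>x\<in>carrier M. fs ! k \<odot>\<^bsub>M\<^esub> x \<in> seq_mult M (take k fs) \<longrightarrow> x \<in> seq_mult M (take k fs))
      \<longleftrightarrow> nonzerodiv n (foldl (extend n) I (take k fs)) (fs ! k)" if k: "k < length fs" for k
  proof -
    let ?J = "foldl (extend n) I (take k fs)"
    have f: "fs ! k \<in> polys n" using fs k by auto
    have "fs ! k \<odot>\<^bsub>M\<^esub> (I +>\<^bsub>P\<^esub> p) = I +>\<^bsub>P\<^esub> (fs ! k * p)" if "p \<in> polys n" for p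
      using that f h.hom_mult by simp
    moreover have "I +>\<^bsub>P\<^esub> p \<in> (+>\<^bsub>P\<^esub>) I ` ?J \<longleftrightarrow> p \<in> ?J" if "p \<in> polys n" for p
      using J(1) foldl_extend_superset that by (rule coset_in_image_iff)
    ultimately show ?thesis
      unfolding carrier_quot_module seq_mult_eq[OF J(2)] nonzerodiv_def
      using polys_mult[OF f] by simp
  qed
  moreover have "seq_mult M fs = carrier M \<longleftrightarrow> foldl (extend n) I fs = polys n"
  proof
    assume eq: "seq_mult M fs = carrier M"
    show "foldl (extend n) I fs = polys n"
    proof
      show "foldl (extend n) I fs \<subseteq> polys n" using idlD(1)[OF idl_foldl_extend[OF I fs]] .
      show "polys n \<subseteq> foldl (extend n) I fs"
      proof
        fix p :: "'k mpoly" assume p: "p \<in> polys n"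
        then have "I +>\<^bsub>P\<^esub> p \<in> (+>\<^bsub>P\<^esub>) I ` foldl (extend n) I fs"
          using eq unfolding seq_mult_eq[OF fs] carrier_quot_module by blast
        then show "p \<in> foldl (extend n) I fs"
          using coset_in_image_iff[OF idl_foldl_extend[OF I fs] foldl_extend_superset p] by blast
      qed
    qed
  qed (simp only: seq_mult_eq[OF fs] carrier_quot_module)
  ultimately show ?thesis
    unfolding regular_seq_def weakly_regular_iff_nth by simp
qed

end

theorem depth_quot_stair:
  assumes st: "stair b A R G" and sub: "A \<union> R \<subseteq> {1..n}"
  shows "depth n (quot_module (poly_ring n) (sqid n G :: 'k::field mpoly set)) = ereal (real n - real (card G))"
proof -
  let ?I = "sqid n G :: 'k mpoly set" and ?m = "sqid n ((\<lambda>j. {j}) ` {1..n}) :: 'k mpoly set"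
  note stf = stair_facts[OF st]
  have An: "card A \<le> n" "A \<subseteq> {1..n}" using sub card_mono[of "{1..n}" A] by auto
  have irr: "irrelevant_ideal n = ?m" unfolding set_eq_iff irrelevant_ideal_iff maximal_sqid_iff by blast
  have Im: "?I \<subseteq> ?m"
  proof
    fix p assume p: "p \<in> ?I"
    have "0 \<notin> Poly_Mapping.keys p"
      using p stf(7) by (force simp: sqid_def)
    with p show "p \<in> ?m" unfolding maximal_sqid_iff by (simp add: sqid_def in_keys_iff)
  qed
  have iff: "set fs \<subseteq> irrelevant_ideal n \<and> regular_seq (quot_module (poly_ring n) ?I) fs \<longleftrightarrow>
      set fs \<subseteq> ?m \<and> weakly_regular n ?I fs" for fs
  proof (cases "set fs \<subseteq> ?m")
    case True
    then have "set fs \<subseteq> polys n" by (auto simp: sqid_def)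
    \<comment> \<open>Properness is automatic: \<open>I\<close> and the sequence lie in the maximal
      ideal, which does not contain 1.\<close>
    moreover have "foldl (extend n) ?I fs \<noteq> polys n"
    proof
      assume "foldl (extend n) ?I fs = polys n"
      then have "polys n \<subseteq> ?m" using foldl_extend_subset[OF idl_sqid Im True] by simp
      then have "(1 :: 'k mpoly) \<in> ?m" using polys_1 by blast
      then show False unfolding maximal_sqid_iff by simp
    qed
    ultimately show ?thesis using True regular_seq_iff[OF idl_sqid, of fs n G] by (simp add: irr)
  qed (simp add: irr)
  have "length fs \<le> n - card A" if "set fs \<subseteq> ?m" "weakly_regular n ?I fs" for fs
  proof -
    obtain r a and D :: "nat \<Rightarrow> nat \<Rightarrow> nat \<Rightarrow> 'k mpoly" where
      D: "graded_resolves n ?I r a D" "minimal_difl r D" "0 < r (card A)"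
      using stair_resolution[OF assms] by blast
    have "card A + length fs \<le> n"
    proof (rule weakly_regular_length_le)
      show "resolves n ?I r D" using D(1) by (simp add: graded_resolves_def)
      show "f \<in> polys n \<and> Poly_Mapping.lookup f 0 = 0" if "f \<in> set fs" for f
        using that \<open>set fs \<subseteq> ?m\<close> by (auto simp only: maximal_sqid_iff subset_iff)
    qed (use D that in auto)
    then show ?thesis by simp
  qed
  moreover have "\<exists>fs. length fs = n - card A \<and> set fs \<subseteq> ?m \<and> weakly_regular n ?I fs"
  proof -
    \<comment> \<open>All variables outside \<open>A\<close>, the factors in \<open>R\<close>
      included. As \<open>b\<close> belongs to \<open>A\<close>, there are exactly
      \<open>n - card A\<close> differences with \<open>X b\<close>.\<close>
    define vs where "vs = sorted_list_of_set ({1..n} - A)"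
    have vs: "distinct vs" "set vs = {1..n} - A" by (simp_all add: vs_def)
    have len: "length vs = n - card A"
      using An(2) stf(1) by (simp add: vs_def card_Diff_subset)
    have b: "b \<in> {1..n}" using stf(4) An(2) by auto
    have "weakly_regular n (sqid n (G \<union> (\<lambda>z. {z}) ` {})) (map (\<lambda>v. X v - X b :: 'k mpoly) vs)"
      using st sub by (rule stair_weakly_regular) (use vs in auto)
    moreover have "X v - X b \<in> ?m" if "v \<in> {1..n}" for v
      using that b unfolding maximal_sqid_iff by (simp add: polys_diff X_in_polys lookup_minus)
    ultimately show ?thesis
      using len vs(2) by (intro exI[of _ "map (\<lambda>v. X v - X b :: 'k mpoly) vs"]) auto
  qed
  ultimately have "depth n (quot_module (poly_ring n) ?I) = ereal (real (n - card A))"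
    unfolding depth_def iff
    by (intro Sup_eqI) force+
  then show ?thesis using An(1) stf(10) by simp
qed


section \<open>Projective dimension and regularity\<close>

theorem proj_dim_reg_stair:
  assumes st: "stair b A R G" and sub: "A \<union> R \<subseteq> {1..n}"
  shows "proj_dim n (sqid n G :: 'k::field mpoly set) = ereal (real (card G) - 1)"
    and "reg n (sqid n G :: 'k::field mpoly set) = ereal (real (Max (card ` G)))"
proof -
  note stf = stair_facts[OF st]
  let ?I = "sqid n G :: 'k mpoly set"
  obtain r a and D :: "nat \<Rightarrow> nat \<Rightarrow> nat \<Rightarrow> 'k mpoly" where
    D: "graded_resolves n ?I r a D" "minimal_difl r D" and r: "0 < r (card A)" "\<forall>i>card A. r i = 0" and
    a: "\<forall>i. \<forall>k<r (Suc i). a (Suc i) k - int i \<le> int (Max (card ` G))"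
      "\<exists>i. \<exists>k<r (Suc i). a (Suc i) k - int i = int (Max (card ` G))"
    using stair_resolution[OF assms] by blast
  have "?I \<subseteq> polys n" by (auto simp: sqid_def)
  note betti = betti_nonzero_iff[OF this D]
  \<comment> \<open>The last nonzero module has index \<open>card A = Suc c\<close>, which is
    homological degree \<open>c\<close> for the ideal; this accounts for the
    \<open>- 1\<close>.\<close>
  obtain c where c: "card A = Suc c" using stf(1,4) by (metis card_gt_0_iff empty_iff gr0_conv_Suc)
  show "proj_dim n ?I = ereal (real (card G) - 1)"
    unfolding proj_dim_def
  proof (rule Sup_eqI)
    fix y assume "y \<in> {ereal (real i) | i. \<exists>j. betti n ?I i j \<noteq> 0}"
    then obtain i j where i: "y = ereal (real i)" "betti n ?I i j \<noteq> 0" by blast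
    then obtain k where "k < r (Suc i)" unfolding betti by blast
    then have "Suc i \<le> card A" using r(2) by (metis less_nat_zero_code not_le)
    then show "y \<le> ereal (real (card G) - 1)" using i(1) stf(10) by simp
  next
    fix y assume y: "\<And>z. z \<in> {ereal (real i) | i. \<exists>j. betti n ?I i j \<noteq> 0} \<Longrightarrow> z \<le> y"
    have "betti n ?I c (a (Suc c) 0) \<noteq> 0" unfolding betti using r(1) c by (intro exI[of _ 0]) simp
    then have "ereal (real c) \<le> y" by (intro y) blast
    then show "ereal (real (card G) - 1) \<le> y" using stf(10) c by simp
  qed
  show "reg n ?I = ereal (real (Max (card ` G)))"
    unfolding reg_def
  proof (rule Sup_eqI)
    fix y assume "y \<in> {ereal (real_of_int (j - int i)) | i j. betti n ?I i j \<noteq> 0}"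
    then obtain i j where i: "y = ereal (real_of_int (j - int i))" "betti n ?I i j \<noteq> 0" by blast
    then obtain k where "k < r (Suc i)" "a (Suc i) k = j" unfolding betti by blast
    then have "j - int i \<le> int (Max (card ` G))" using a(1) by blast
    then have "real_of_int (j - int i) \<le> real (Max (card ` G))" by linarith
    then show "y \<le> ereal (real (Max (card ` G)))" using i(1) by simp
  next
    fix y assume y: "\<And>z. z \<in> {ereal (real_of_int (j - int i)) | i j. betti n ?I i j \<noteq> 0} \<Longrightarrow> z \<le> y"
    obtain i k where k: "k < r (Suc i)" "a (Suc i) k - int i = int (Max (card ` G))" using a(2) by blast
    have "betti n ?I i (a (Suc i) k) \<noteq> 0" unfolding betti using k(1) by blast
    then have "ereal (real_of_int (a (Suc i) k - int i)) \<le> y" by (intro y) blast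
    then show "ereal (real (Max (card ` G))) \<le> y" unfolding k(2) by simp
  qed
qed

theorem corollary2p6:
  fixes I :: "'k::field mpoly set" and n t :: nat and d :: "nat \<Rightarrow> nat"
  assumes "usli n I"
    and "t \<ge> 1"
    and "strict_mono_on {1..t} d"
    and "d ` {1..t} = mdeg ` min_gens n I"
  shows "proj_dim n I = ereal (real (card (min_gens n I)) - 1)
      \<and> reg n I = ereal (real (d t))
      \<and> depth n (quot_module (poly_ring n) I) = ereal (real n - real (card (min_gens n I)))"
proof -
  have "1 \<in> {1..t}" using assms(2) by simp
  then have "min_gens n I \<noteq> {}" using assms(4) by auto
  then obtain b A R G where st: "stair b A R G" "A \<union> R \<subseteq> {1..n}"
    and I: "I = sqid n G" and G: "min_gens n I = sqmon ` G"
    using usli_stair[OF assms(1)] by blast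
  note stf = stair_facts[OF st(1)]
  have "inj_on sqmon G" using stf(9) by (intro inj_onI) (metis keys_sqmon)
  then have card: "card (min_gens n I) = card G" unfolding G by (rule card_image)
  have "mdeg ` sqmon ` G = card ` G"
    using stf(9) by (simp add: image_image mdeg_sqmon cong: image_cong_simp)
  then have img: "d ` {1..t} = card ` G" using assms(4) G by simp
  have "Max (d ` {1..t}) = d t"
  proof (rule Max_eqI)
    fix y assume "y \<in> d ` {1..t}"
    then obtain i where i: "y = d i" "i \<in> {1..t}" by blast
    then show "y \<le> d t"
      using strict_mono_on_leD[OF assms(3), of i t] by simp
  qed (use assms(2) in auto)
  then have "Max (card ` G) = d t" using img by simp
  then show ?thesis
    using proj_dim_reg_stair[OF st, where 'k = 'k] depth_quot_stair[OF st, where 'k = 'k]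
    unfolding card by (simp add: I)
qed

end
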